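(* Let $M$ be a connected manifold of dimension $n\ge2$ with a metric $g$, and let $F:T^*M\to\mathbb{R}$ be an integral of the geodesic flow of $g$. Assume that $F$ is polynomial in momenta of degree $d$. If $g$ is $C^k$-smooth for some $k\ge 2$, then $F$ is $C^{k-1}$-smooth.
   Context: "Metric" means pseudo-Riemannian metric of arbitrary signature (including Riemannian). Let $x=(x^1,\dots,x^n)$ be local coordinates on $M$ and $p=(p_1,\dots,p_n)$ the corresponding momenta on the cotangent spaces. The geodesic flow of $g=g_{ij}(x)dx^idx^j$ is the Hamiltonian system on $T^*M$ with Hamiltonian $H(x,p)=\tfrac12 g^{ij}(x)p_ip_j$. A function $F:T^*M\to\mathbb{R}$ is polynomial in momenta of degree $d$ if in local coordinates it has the (homogeneous) form $F(x,p)=\sum_{i_1,\dots,i_d=1}^n K^{i_1\dots i_d}(x)\,p_{i_1}\cdots p_{i_d}$ with coefficients $K^{i_1\dots i_d}$ symmetric in their indices. The coefficients are a priori arbitrary real functions of $x$; no regularity, not even continuity, is assumed. Such an $F$ is an integral of the geodesic flow of $g$ if for every (affinely parametrized) geodesic $\gamma$ of $g$ the function $t\mapsto \sum_{i_1,\dots,i_d=1}^n K_{i_1\dots i_d}(\gamma(t))\,\dot\gamma(t)^{i_1}\cdots\dot\gamma(t)^{i_d}$ does not depend on $t$, where the indices of $K$ are lowered with $g$. $F$ being $C^{k-1}$-smooth is the same as its coefficients $K^{i_1\dots i_d}$ being $C^{k-1}$-smooth functions of $x$. *)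

theory Defs
  imports "HOL-Analysis.Analysis"
begin

section \<open>Functions of class \<open>C\<^sup>k\<close> on open subsets of Euclidean spaces\<close>

text \<open>Since the domain is finite-dimensional, a function on an open set is of class \<open>C\<^bsup>k+1\<^esup>\<close> iff it is
  differentiable and all its directional derivatives are of class \<open>C\<^sup>k\<close>. Only meant for open \<open>S\<close>.\<close>

primrec Ck_on :: "nat \<Rightarrow> ('a::euclidean_space \<Rightarrow> 'b::real_normed_vector) \<Rightarrow> 'a set \<Rightarrow> bool" where
  "Ck_on 0 f S \<longleftrightarrow> continuous_on S f"
| "Ck_on (Suc k) f S \<longleftrightarrow>
     (\<forall>x\<in>S. f differentiable (at x)) \<and> (\<forall>v. Ck_on k (\<lambda>x. frechet_derivative f (at x) v) S)"

definition partial_deriv :: "'n \<Rightarrow> (real^'n \<Rightarrow> real) \<Rightarrow> real^'n \<Rightarrow> real" where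
  "partial_deriv i f x = frechet_derivative f (at x) (axis i 1)"

section \<open>Smooth manifolds\<close>

text \<open>A chart is a pair of its domain and its coordinate map; the latter is irrelevant outside
  the domain.\<close>

type_synonym ('a, 'n) chart = "'a set \<times> ('a \<Rightarrow> real^'n)"

abbreviation coord_image :: "('a, 'n::finite) chart \<Rightarrow> (real^'n) set" where
  "coord_image c \<equiv> snd c ` fst c"

abbreviation chart_inv :: "('a, 'n::finite) chart \<Rightarrow> real^'n \<Rightarrow> 'a" where
  "chart_inv c \<equiv> inv_into (fst c) (snd c)"

definition is_chart :: "'a topology \<Rightarrow> ('a, 'n::finite) chart \<Rightarrow> bool" where
  "is_chart M c \<longleftrightarrow>
     openin M (fst c) \<and> open (coord_image c) \<and>
     homeomorphic_map (subtopology M (fst c)) (top_of_set (coord_image c)) (snd c)"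

abbreviation transition :: "('a, 'n::finite) chart \<Rightarrow> ('a, 'n) chart \<Rightarrow> real^'n \<Rightarrow> real^'n" where
  "transition c c' \<equiv> snd c' \<circ> chart_inv c"

text \<open>The Jacobian matrix \<open>\<partial>x'\<^sup>j / \<partial>x\<^sup>i\<close> (row \<open>j\<close>, column \<open>i\<close>) at the point \<open>q\<close>, where \<open>x\<close> and \<open>x'\<close> are
  the coordinates of the charts \<open>c\<close> and \<open>c'\<close>.\<close>

definition transition_jacobian ::
    "('a, 'n::finite) chart \<Rightarrow> ('a, 'n) chart \<Rightarrow> 'a \<Rightarrow> real^'n^'n" where
  "transition_jacobian c c' q = jacobian (transition c c') (at (snd c q))"

definition smooth_manifold :: "'a topology \<Rightarrow> ('a, 'n::finite) chart set \<Rightarrow> bool" where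
  "smooth_manifold M A \<longleftrightarrow>
     Hausdorff_space M \<and> second_countable M \<and>
     (\<forall>c\<in>A. is_chart M c) \<and> topspace M = (\<Union>c\<in>A. fst c) \<and>
     (\<forall>c\<in>A. \<forall>c'\<in>A. \<forall>k. Ck_on k (transition c c') (snd c ` (fst c \<inter> fst c')))"

section \<open>The cotangent bundle\<close>

text \<open>A covector at \<open>q\<close> is the family of its momenta \<open>\<omega> c\<close> in all charts \<open>c\<close> around \<open>q\<close>, which are
  related by \<open>p\<^sub>i = (\<partial>x'\<^sup>j / \<partial>x\<^sup>i) p'\<^sub>j\<close>. The irrelevant values of \<open>\<omega>\<close> are normalised to zero, so that equal
  covectors are equal families.\<close>

definition cotangent_space ::
    "('a, 'n::finite) chart set \<Rightarrow> 'a \<Rightarrow> (('a, 'n) chart \<Rightarrow> real^'n) set" where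
  "cotangent_space A q =
     {\<omega>. (\<forall>c\<in>A. \<forall>c'\<in>A. q \<in> fst c \<inter> fst c' \<longrightarrow>
              \<omega> c = transpose (transition_jacobian c c' q) *v \<omega> c') \<and>
         (\<forall>c. \<not> (c \<in> A \<and> q \<in> fst c) \<longrightarrow> \<omega> c = 0)}"

definition cotangent_bundle ::
    "('a, 'n::finite) chart set \<Rightarrow> ('a \<times> (('a, 'n) chart \<Rightarrow> real^'n)) set" where
  "cotangent_bundle A = Sigma (\<Union>c\<in>A. fst c) (cotangent_space A)"

definition cotangent_domain ::
    "('a, 'n::finite) chart set \<Rightarrow> ('a, 'n) chart \<Rightarrow> ('a \<times> (('a, 'n) chart \<Rightarrow> real^'n)) set" where
  "cotangent_domain A c = {(q, \<omega>) \<in> cotangent_bundle A. q \<in> fst c}"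

text \<open>The coordinates \<open>(x, p)\<close> on the cotangent bundle.\<close>

definition cotangent_coords ::
    "('a, 'n::finite) chart \<Rightarrow> 'a \<times> (('a, 'n) chart \<Rightarrow> real^'n) \<Rightarrow> (real^'n) \<times> (real^'n)" where
  "cotangent_coords c = (\<lambda>(q, \<omega>). (snd c q, \<omega> c))"

text \<open>These coordinates identify the part of the bundle over the domain of \<open>c\<close> with an open set, so the
  inverse in \<open>Ck_on_cotangent_bundle\<close> below is a genuine one.\<close>

lemma chart_inv:
  assumes "is_chart M c" "q \<in> fst c"
  shows "chart_inv c (snd c q) = q"
proof -
  have "topspace (subtopology M (fst c)) = fst c"
    using assms(1) openin_subset unfolding is_chart_def by fastforce
  then have "inj_on (snd c) (fst c)"
    using assms(1) homeomorphic_imp_injective_map unfolding is_chart_def by fastforce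
  then show ?thesis using assms(2) by simp
qed

lemma open_overlap:
  assumes M: "smooth_manifold M A" and c: "c \<in> A" "c' \<in> A"
  shows "open (snd c ` (fst c \<inter> fst c'))"
proof -
  have ch: "is_chart M c" "is_chart M c'"
    using M c by (auto simp: smooth_manifold_def)
  then have "openin (subtopology M (fst c)) (fst c \<inter> fst c')"
    by (metis inf.commute is_chart_def openin_subtopology)
  then have "openin (top_of_set (coord_image c)) (snd c ` (fst c \<inter> fst c'))"
    using ch(1) homeomorphic_imp_open_map unfolding is_chart_def open_map_def by blast
  then show ?thesis
    using ch(1) openin_open_trans unfolding is_chart_def by blast
qed

lemma transition_has_derivative:
  assumes M: "smooth_manifold M A" and c: "c \<in> A" "c' \<in> A" and q: "q \<in> fst c \<inter> fst c'"
  shows "(transition c c' has_derivative (\<lambda>h. transition_jacobian c c' q *v h)) (at (snd c q))"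
proof -
  have "Ck_on (Suc 0) (transition c c') (snd c ` (fst c \<inter> fst c'))"
    using M c unfolding smooth_manifold_def by blast
  then have "transition c c' differentiable (at (snd c q))"
    using q by auto
  then show ?thesis
    unfolding transition_jacobian_def using jacobian_works by blast
qed

lemma transition_jacobian_cocycle:
  assumes M: "smooth_manifold M A" and c: "c \<in> A" "c' \<in> A" "c'' \<in> A"
    and q: "q \<in> fst c" "q \<in> fst c'" "q \<in> fst c''"
  shows "transition_jacobian c c'' q = transition_jacobian c' c'' q ** transition_jacobian c c' q"
proof -
  have ch: "is_chart M c" "is_chart M c'"
    using M c by (auto simp: smooth_manifold_def)
  have "(transition c' c'' has_derivative (\<lambda>h. transition_jacobian c' c'' q *v h))
          (at (transition c c' (snd c q)))"
    using transition_has_derivative[OF M c(2,3)] q chart_inv[OF ch(1)] by simp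
  from diff_chain_at[OF transition_has_derivative[OF M c(1,2)] this]
  have *: "(transition c' c'' \<circ> transition c c' has_derivative
      (\<lambda>h. (transition_jacobian c' c'' q ** transition_jacobian c c' q) *v h)) (at (snd c q))"
    using q by (simp add: comp_def matrix_vector_mul_assoc)
  have "(transition c c'' has_derivative
      (\<lambda>h. (transition_jacobian c' c'' q ** transition_jacobian c c' q) *v h)) (at (snd c q))"
  proof (rule has_derivative_transform_within_open[OF * open_overlap[OF M c(1,2)]])
    show "snd c q \<in> snd c ` (fst c \<inter> fst c')" using q by auto
    show "(transition c' c'' \<circ> transition c c') x = transition c c'' x"
      if "x \<in> snd c ` (fst c \<inter> fst c')" for x
      using that chart_inv[OF ch(1)] chart_inv[OF ch(2)] by auto
  qed
  then have "(\<lambda>h. (transition_jacobian c' c'' q ** transition_jacobian c c' q) *v h)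
      = (\<lambda>h. transition_jacobian c c'' q *v h)"
    using transition_has_derivative[OF M c(1,3)] q has_derivative_unique by blast
  then show ?thesis by (metis matrix_eq)
qed

lemma transition_jacobian_self:
  assumes M: "smooth_manifold M A" and c: "c \<in> A" and q: "q \<in> fst c"
  shows "transition_jacobian c c q = mat 1"
proof -
  have ch: "is_chart M c" using M c by (auto simp: smooth_manifold_def)
  have "(transition c c has_derivative (\<lambda>h. h)) (at (snd c q))"
  proof (rule has_derivative_transform_within_open[OF has_derivative_ident])
    show "open (coord_image c)" using ch by (simp add: is_chart_def)
    show "snd c q \<in> coord_image c" using q by auto
    show "x = transition c c x" if "x \<in> coord_image c" for x
      using that chart_inv[OF ch] by auto
  qed
  then have "(\<lambda>h. h) = (\<lambda>h. transition_jacobian c c q *v h)"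
    using transition_has_derivative[OF M c c] q has_derivative_unique by blast
  then show ?thesis by (metis matrix_eq matrix_vector_mul_lid)
qed

lemma bij_betw_cotangent_coords:
  assumes M: "smooth_manifold M A" and c: "c \<in> A"
  shows "bij_betw (cotangent_coords c) (cotangent_domain A c) (coord_image c \<times> UNIV)"
proof -
  have ch: "is_chart M c" using M c by (auto simp: smooth_manifold_def)
  have det: "\<omega> c' = transpose (transition_jacobian c' c q) *v \<omega> c"
    if "\<omega> \<in> cotangent_space A q" "q \<in> fst c" "c' \<in> A" "q \<in> fst c'" for \<omega> q c'
    using that c unfolding cotangent_space_def by blast
  have "inj_on (cotangent_coords c) (cotangent_domain A c)"
  proof (rule inj_onI, clarify)
    fix q \<omega> q' \<omega>'
    assume a: "(q, \<omega>) \<in> cotangent_domain A c" "(q', \<omega>') \<in> cotangent_domain A c"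
      and e: "cotangent_coords c (q, \<omega>) = cotangent_coords c (q', \<omega>')"
    have q: "q = q'"
      using a e chart_inv[OF ch] unfolding cotangent_domain_def cotangent_coords_def
      by (metis (mono_tags, lifting) case_prodD mem_Collect_eq old.prod.case prod.inject)
    have m: "\<omega> \<in> cotangent_space A q" "\<omega>' \<in> cotangent_space A q" "q \<in> fst c" "\<omega> c = \<omega>' c"
      using a e q by (auto simp: cotangent_domain_def cotangent_bundle_def cotangent_coords_def)
    have "\<omega> c' = \<omega>' c'" for c'
    proof (cases "c' \<in> A \<and> q \<in> fst c'")
      case True
      then show ?thesis using det[OF m(1,3)] det[OF m(2,3)] m(4) by metis
    next
      case False
      then show ?thesis using m(1,2) by (simp add: cotangent_space_def del: split_paired_All)
    qed
    then show "q = q' \<and> \<omega> = \<omega>'" using q by auto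
  qed
  moreover have "cotangent_coords c ` cotangent_domain A c = coord_image c \<times> UNIV"
  proof
    show "cotangent_coords c ` cotangent_domain A c \<subseteq> coord_image c \<times> UNIV"
      by (auto simp: cotangent_domain_def cotangent_coords_def)
    show "coord_image c \<times> UNIV \<subseteq> cotangent_coords c ` cotangent_domain A c"
    proof clarify
      fix q p assume q: "q \<in> fst c"
      define \<omega> where "\<omega> = (\<lambda>c'. if c' \<in> A \<and> q \<in> fst c'
          then transpose (transition_jacobian c' c q) *v p else 0)"
      have "\<omega> c1 = transpose (transition_jacobian c1 c2 q) *v \<omega> c2"
        if "c1 \<in> A" "c2 \<in> A" "q \<in> fst c1" "q \<in> fst c2" for c1 c2
        using that transition_jacobian_cocycle[OF M that(1,2) c that(3,4) q]
        by (simp add: \<omega>_def matrix_transpose_mul matrix_vector_mul_assoc del: transpose_matrix_vector)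
      moreover have "\<omega> c' = 0" if "\<not> (c' \<in> A \<and> q \<in> fst c')" for c'
        using that unfolding \<omega>_def by (rule if_not_P)
      ultimately have w: "\<omega> \<in> cotangent_space A q"
        unfolding cotangent_space_def by blast
      have p: "\<omega> c = p"
        using c q transition_jacobian_self[OF M c q] by (simp add: \<omega>_def transpose_mat)
      have "(q, \<omega>) \<in> cotangent_domain A c"
        using w c q unfolding cotangent_domain_def cotangent_bundle_def by blast
      moreover have "(snd c q, p) = cotangent_coords c (q, \<omega>)"
        unfolding cotangent_coords_def by (simp only: prod.case p)
      ultimately show "(snd c q, p) \<in> cotangent_coords c ` cotangent_domain A c"
        by (rule rev_image_eqI)
    qed
  qed
  ultimately show ?thesis by (simp add: bij_betw_def)
qed

definition Ck_on_cotangent_bundle ::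
    "nat \<Rightarrow> ('a, 'n::finite) chart set \<Rightarrow> ('a \<times> (('a, 'n) chart \<Rightarrow> real^'n) \<Rightarrow> real) \<Rightarrow> bool" where
  "Ck_on_cotangent_bundle k A F \<longleftrightarrow>
     (\<forall>c\<in>A. Ck_on k (F \<circ> inv_into (cotangent_domain A c) (cotangent_coords c))
                   (coord_image c \<times> UNIV))"

section \<open>Pseudo-Riemannian metrics and geodesics\<close>

text \<open>A metric is given by its matrices \<open>g\<^sub>i\<^sub>j(x)\<close> in all charts. Its signature is arbitrary.\<close>

definition is_metric ::
    "('a, 'n::finite) chart set \<Rightarrow> (('a, 'n) chart \<Rightarrow> real^'n \<Rightarrow> real^'n^'n) \<Rightarrow> bool" where
  "is_metric A g \<longleftrightarrow>
     (\<forall>c\<in>A. \<forall>x\<in>coord_image c. transpose (g c x) = g c x \<and> invertible (g c x)) \<and>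
     (\<forall>c\<in>A. \<forall>c'\<in>A. \<forall>q \<in> fst c \<inter> fst c'.
        g c (snd c q) =
          transpose (transition_jacobian c c' q) ** g c' (snd c' q) ** transition_jacobian c c' q)"

definition Ck_metric ::
    "nat \<Rightarrow> ('a, 'n::finite) chart set \<Rightarrow> (('a, 'n) chart \<Rightarrow> real^'n \<Rightarrow> real^'n^'n) \<Rightarrow> bool" where
  "Ck_metric k A g \<longleftrightarrow> (\<forall>c\<in>A. \<forall>i j. Ck_on k (\<lambda>x. g c x $ i $ j) (coord_image c))"

definition christoffel ::
    "(real^'n \<Rightarrow> real^'n^'n::finite) \<Rightarrow> 'n \<Rightarrow> 'n \<Rightarrow> 'n \<Rightarrow> real^'n \<Rightarrow> real" where
  "christoffel G i j k x =
     (\<Sum>l\<in>UNIV. matrix_inv (G x) $ i $ l *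
        (partial_deriv j (\<lambda>y. G y $ l $ k) x + partial_deriv k (\<lambda>y. G y $ l $ j) x
           - partial_deriv l (\<lambda>y. G y $ j $ k) x)) / 2"

definition velocity :: "('a, 'n::finite) chart \<Rightarrow> (real \<Rightarrow> 'a) \<Rightarrow> real \<Rightarrow> real^'n" where
  "velocity c \<gamma> t = vector_derivative (snd c \<circ> \<gamma>) (at t)"

text \<open>Affinely parametrized geodesics on an open interval \<open>J\<close>. As \<open>\<gamma>\<close> is continuous and \<open>J\<close> is open,
  \<open>\<gamma>\<close> stays in the domain of \<open>c\<close> near \<open>t\<close>, so the two-sided derivatives below only involve values of
  the coordinate map inside the domain.\<close>

definition is_geodesic ::
    "'a topology \<Rightarrow> ('a, 'n::finite) chart set \<Rightarrow> (('a, 'n) chart \<Rightarrow> real^'n \<Rightarrow> real^'n^'n) \<Rightarrow>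
     real set \<Rightarrow> (real \<Rightarrow> 'a) \<Rightarrow> bool" where
  "is_geodesic M A g J \<gamma> \<longleftrightarrow>
     open J \<and> is_interval J \<and> continuous_map (top_of_set J) M \<gamma> \<and>
     (\<forall>c\<in>A. \<forall>t\<in>J. \<gamma> t \<in> fst c \<longrightarrow>
        (snd c \<circ> \<gamma>) differentiable (at t) \<and>
        (velocity c \<gamma> has_vector_derivative
           (\<chi> i. - (\<Sum>j\<in>UNIV. \<Sum>k\<in>UNIV. christoffel (g c) i j k (snd c (\<gamma> t))
                      * velocity c \<gamma> t $ j * velocity c \<gamma> t $ k))) (at t))"

section \<open>Integrals polynomial in momenta\<close>

definition index_tuples :: "nat \<Rightarrow> 'n list set" where
  "index_tuples d = {is. length is = d}"

text \<open>\<open>\<Sum> K\<^bsub>i\<^sub>1\<dots>i\<^sub>d\<^esub> v\<^bsub>i\<^sub>1\<^esub> \<cdots> v\<^bsub>i\<^sub>d\<^esub>\<close>\<close>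

definition homogeneous_form :: "nat \<Rightarrow> ('n list \<Rightarrow> real) \<Rightarrow> real^'n::finite \<Rightarrow> real" where
  "homogeneous_form d K v = (\<Sum>is\<in>index_tuples d. K is * (\<Prod>i\<leftarrow>is. v $ i))"

definition symmetric_coeffs :: "nat \<Rightarrow> ('n list \<Rightarrow> real) \<Rightarrow> bool" where
  "symmetric_coeffs d K \<longleftrightarrow>
     (\<forall>is\<in>index_tuples d. \<forall>js\<in>index_tuples d. mset is = mset js \<longrightarrow> K is = K js)"

definition lower_indices ::
    "nat \<Rightarrow> real^'n^'n \<Rightarrow> ('n::finite list \<Rightarrow> real) \<Rightarrow> 'n list \<Rightarrow> real" where
  "lower_indices d G K js = (\<Sum>is\<in>index_tuples d. K is * (\<Prod>r<d. G $ (is ! r) $ (js ! r)))"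

text \<open>No regularity in \<open>x\<close> is imposed on the coefficients.\<close>

definition momentum_coeffs ::
    "('a, 'n::finite) chart set \<Rightarrow> nat \<Rightarrow> ('a \<times> (('a, 'n) chart \<Rightarrow> real^'n) \<Rightarrow> real) \<Rightarrow>
     (('a, 'n) chart \<Rightarrow> real^'n \<Rightarrow> 'n list \<Rightarrow> real) \<Rightarrow> bool" where
  "momentum_coeffs A d F K \<longleftrightarrow>
     (\<forall>c\<in>A. (\<forall>x\<in>coord_image c. symmetric_coeffs d (K c x)) \<and>
            (\<forall>(q, \<omega>)\<in>cotangent_domain A c. F (q, \<omega>) = homogeneous_form d (K c (snd c q)) (\<omega> c)))"

definition polynomial_in_momenta ::
    "('a, 'n::finite) chart set \<Rightarrow> nat \<Rightarrow> ('a \<times> (('a, 'n) chart \<Rightarrow> real^'n) \<Rightarrow> real) \<Rightarrow> bool" where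
  "polynomial_in_momenta A d F \<longleftrightarrow> (\<exists>K. momentum_coeffs A d F K)"

text \<open>The coefficients of \<open>F\<close> are unique on the chart images, so the existential quantifier over \<open>K\<close>
  merely names them.\<close>

definition geodesic_flow_integral ::
    "'a topology \<Rightarrow> ('a, 'n::finite) chart set \<Rightarrow> (('a, 'n) chart \<Rightarrow> real^'n \<Rightarrow> real^'n^'n) \<Rightarrow> nat \<Rightarrow>
     ('a \<times> (('a, 'n) chart \<Rightarrow> real^'n) \<Rightarrow> real) \<Rightarrow> bool" where
  "geodesic_flow_integral M A g d F \<longleftrightarrow>
     (\<exists>K. momentum_coeffs A d F K \<and>
        (\<forall>J \<gamma>. is_geodesic M A g J \<gamma> \<longrightarrow>
           (\<exists>const. \<forall>t\<in>J. \<forall>c\<in>A. \<gamma> t \<in> fst c \<longrightarrow>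
              homogeneous_form d
                (lower_indices d (g c (snd c (\<gamma> t))) (K c (snd c (\<gamma> t)))) (velocity c \<gamma> t) = const)))"

end

theory Submission
  imports Defs
begin

text \<open>Let \<open>x0\<close> be a point of a chart and \<open>p\<close> a covector. For \<open>x\<close> near \<open>x0\<close> join a fixed point \<open>y\<close>,
  reached from \<open>x0\<close> by going back a short time in the direction \<open>p\<close>, to \<open>x\<close> by a geodesic. Its initial and final
  velocities are \<open>C\<^bsup>k-1\<^esup>\<close> functions of \<open>x\<close>, since they solve a boundary value problem for an equation with
  \<open>C\<^bsup>k-1\<^esup>\<close> coefficients. At \<open>y\<close> the integral is one fixed polynomial, so its value at \<open>x\<close> on the final
  covector \<open>u(x)\<close> is a \<open>C\<^bsup>k-1\<^esup>\<close> function of \<open>x\<close>. Doing this for finitely many covectors \<open>p\<close> that are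
  nodes of an interpolation formula for homogeneous polynomials of degree \<open>d\<close> gives a linear system for the values of
  the integral at these \<open>p\<close>. Its matrix is close to the identity because \<open>u(x0)\<close> is close to \<open>p\<close>. Solving
  it, the integral itself is \<open>C\<^bsup>k-1\<^esup>\<close>.\<close>

text \<open>No regularity of the coefficients is given, so the Killing equation for them cannot be
  differentiated or even written down. All that is available is constancy along geodesics. With the
  starting point \<open>y\<close> held fixed, only the coefficients at \<open>y\<close> enter, and
  these are mere numbers; this is why a boundary value problem is solved and not an initial value
  problem. The arrival covector \<open>u(x)\<close> cannot be prescribed to be \<open>p\<close>, so
  values at \<open>p\<close> have to be recovered by interpolation. The boundary value problem is
  solved directly, as a fixed point of an integral operator on bounded continuous curves with the
  sup norm. The endpoint \<open>x\<close> enters this equation only through a constant curve that is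
  affine in \<open>x\<close>. The derivative of the fixed point is expressed by the inverse of an
  operator that is as regular in \<open>x\<close> as the fixed point itself, so its regularity rises
  one order at a time. The only derivative lost on the whole way is the one taken of the metric in
  the Christoffel symbols, which accounts for \<open>k - 1\<close>.\<close>

section \<open>Calculus of \<open>C\<^sup>k\<close> functions\<close>

lemma Ck_on_subset: "Ck_on k f S \<Longrightarrow> T \<subseteq> S \<Longrightarrow> Ck_on k f T"
  by (induction k arbitrary: f) (auto intro: continuous_on_subset)

lemma Ck_on_cong_imp:
  assumes "open S" "\<And>x. x \<in> S \<Longrightarrow> f x = g x" "Ck_on k f S"
  shows "Ck_on k g S"
  using assms
proof (induction k arbitrary: f g)
  case 0
  then show ?case using continuous_on_cong by fastforce
next
  case (Suc k)
  have D: "(g has_derivative frechet_derivative f (at x)) (at x)" if "x \<in> S" for x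
    using Suc.prems that
    by (auto intro: has_derivative_transform_within_open simp: frechet_derivative_works)
  have "Ck_on k (\<lambda>x. frechet_derivative g (at x) v) S" for v
  proof (rule Suc.IH[OF Suc.prems(1)])
    show "Ck_on k (\<lambda>x. frechet_derivative f (at x) v) S" using Suc.prems by simp
    show "frechet_derivative f (at x) v = frechet_derivative g (at x) v" if "x \<in> S" for x
      using frechet_derivative_at[OF D[OF that]] by simp
  qed
  then show ?case using D by (auto simp: differentiable_def)
qed

lemma Ck_on_SucI:
  assumes "open S" "\<And>x. x \<in> S \<Longrightarrow> (f has_derivative f' x) (at x)"
    "\<And>v. Ck_on k (\<lambda>x. f' x v) S"
  shows "Ck_on (Suc k) f S"
proof -
  have "Ck_on k (\<lambda>x. frechet_derivative f (at x) v) S" for v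
    by (rule Ck_on_cong_imp[OF assms(1) fun_cong[OF frechet_derivative_at[OF assms(2)]] assms(3)])
  then show ?thesis using assms(2) by (auto simp: differentiable_def)
qed

lemma Ck_on_Suc_has_derivative:
  "Ck_on (Suc k) f S \<Longrightarrow> x \<in> S \<Longrightarrow> (f has_derivative frechet_derivative f (at x)) (at x)"
  by (simp add: frechet_derivative_works)

lemma Ck_on_Suc_imp: "Ck_on (Suc k) f S \<Longrightarrow> Ck_on k f S"
proof (induction k arbitrary: f)
  case 0
  then show ?case
    by (auto intro!: continuous_at_imp_continuous_on differentiable_imp_continuous_within)
next
  case (Suc k)
  from Suc.prems have "\<forall>x\<in>S. f differentiable (at x)"
    "\<And>v. Ck_on (Suc k) (\<lambda>x. frechet_derivative f (at x) v) S"
    unfolding Ck_on.simps(2)[of "Suc k"] by blast+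
  then show ?case using Suc.IH unfolding Ck_on.simps(2)[of k f] by blast
qed

lemma Ck_on_mono: "Ck_on k f S \<Longrightarrow> m \<le> k \<Longrightarrow> Ck_on m f S"
proof (induction k)
  case (Suc k)
  then show ?case using Ck_on_Suc_imp le_Suc_eq by blast
qed simp

lemma Ck_on_imp_continuous_on: "Ck_on k f S \<Longrightarrow> continuous_on S f"
  using Ck_on_mono[of k f S 0] by simp

lemma Ck_on_local:
  assumes "\<And>x. x \<in> S \<Longrightarrow> \<exists>T. open T \<and> x \<in> T \<and> Ck_on k f T"
  shows "Ck_on k f S"
  using assms
proof (induction k arbitrary: f)
  case 0
  have "isCont f x" if x: "x \<in> S" for x
  proof -
    obtain T where "open T" "x \<in> T" "continuous_on T f" using 0[OF x] by auto
    then show ?thesis using continuous_on_eq_continuous_at by blast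
  qed
  then show ?case by (simp add: continuous_at_imp_continuous_on)
next
  case (Suc k)
  have "f differentiable (at x)" if "x \<in> S" for x
    using Suc.prems[OF that] by auto
  moreover have "Ck_on k (\<lambda>x. frechet_derivative f (at x) v) S" for v
  proof (rule Suc.IH)
    show "\<exists>T. open T \<and> x \<in> T \<and> Ck_on k (\<lambda>x. frechet_derivative f (at x) v) T" if "x \<in> S" for x
      using Suc.prems[OF that] by auto
  qed
  ultimately show ?case by simp
qed

lemma Ck_on_const [simp]: "Ck_on k (\<lambda>x. c) S"
  by (induction k arbitrary: c) auto

section \<open>Linear maps, products and quotients\<close>

lemma Ck_on_bounded_linear_compose:
  assumes T: "bounded_linear T" and "open S" "Ck_on k f S"
  shows "Ck_on k (\<lambda>x. T (f x)) S"
  using assms(3)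
proof (induction k arbitrary: f)
  case 0
  then show ?case by (auto intro: bounded_linear.continuous_on[OF T])
next
  case (Suc k)
  show ?case
  proof (rule Ck_on_SucI[OF assms(2)])
    show "((\<lambda>x. T (f x)) has_derivative (\<lambda>v. T (frechet_derivative f (at x) v))) (at x)"
      if "x \<in> S" for x
      using Ck_on_Suc_has_derivative[OF Suc.prems that] by (rule bounded_linear.has_derivative[OF T])
    show "Ck_on k (\<lambda>x. T (frechet_derivative f (at x) v)) S" for v
      by (rule Suc.IH) (use Suc.prems in simp)
  qed
qed

lemma Ck_on_ident [simp]: "Ck_on k (\<lambda>x. x) S"
proof (cases k)
  case (Suc m)
  then show ?thesis by simp
qed simp

lemma Ck_on_bounded_linear:
  assumes "bounded_linear T" "open S" shows "Ck_on k T S"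
  using Ck_on_bounded_linear_compose[OF assms Ck_on_ident] .

text \<open>Used with projections: functions of the base point, such as Christoffel symbols, become
  functions of the point and the velocity or momentum together.\<close>

lemma Ck_on_compose_bounded_linear:
  assumes T: "bounded_linear T" and "open S" "Ck_on k f S"
  shows "Ck_on k (\<lambda>x. f (T x)) (T -` S)"
  using assms(3)
proof (induction k arbitrary: f)
  case 0
  have "continuous_on (T -` S) T" using T by (rule linear_continuous_on)
  then show ?case using 0 by (auto intro!: continuous_on_compose2[of S f])
next
  case (Suc k)
  have o: "open (T -` S)"
    by (rule open_vimage[OF assms(2) linear_continuous_on[OF T]])
  show ?case
  proof (rule Ck_on_SucI[OF o])
    show "((\<lambda>x. f (T x)) has_derivative (\<lambda>v. frechet_derivative f (at (T x)) (T v))) (at x)"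
      if "x \<in> T -` S" for x
      using diff_chain_at[OF bounded_linear_imp_has_derivative[OF T] Ck_on_Suc_has_derivative[OF
          Suc.prems]] that
      unfolding comp_def by blast
    show "Ck_on k (\<lambda>x. frechet_derivative f (at (T x)) (T v)) (T -` S)" for v
      by (rule Suc.IH) (use Suc.prems in simp)
  qed
qed

lemma Ck_on_add:
  assumes S: "open S" and "Ck_on k f S" "Ck_on k g S"
  shows "Ck_on k (\<lambda>x. f x + g x) S"
  using assms(2,3)
proof (induction k arbitrary: f g)
  case 0
  then show ?case by (auto intro: continuous_intros)
next
  case (Suc k)
  show ?case
  proof (rule Ck_on_SucI[OF S])
    show "((\<lambda>x. f x + g x) has_derivative
        (\<lambda>v. frechet_derivative f (at x) v + frechet_derivative g (at x) v)) (at x)"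
      if "x \<in> S" for x
      by (intro has_derivative_add Ck_on_Suc_has_derivative[OF Suc.prems(1) that]
          Ck_on_Suc_has_derivative[OF Suc.prems(2) that])
    show "Ck_on k (\<lambda>x. frechet_derivative f (at x) v + frechet_derivative g (at x) v) S" for v
      by (rule Suc.IH) (use Suc.prems in simp_all)
  qed
qed

text \<open>The product rule yields two products of the same kind with one factor differentiated, so
  the induction closes. The spaces may be infinite-dimensional: besides products of numbers this
  covers composition and evaluation of operators on spaces of curves.\<close>

lemma Ck_on_bilinear:
  assumes T: "bounded_bilinear T" and S: "open S" and "Ck_on k f S" "Ck_on k g S"
  shows "Ck_on k (\<lambda>x. T (f x) (g x)) S"
  using assms(3,4)
proof (induction k arbitrary: f g)
  case 0
  then show ?case by (auto intro: bounded_bilinear.continuous_on[OF T])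
next
  case (Suc k)
  have k: "Ck_on k f S" "Ck_on k g S" using Suc.prems Ck_on_Suc_imp by blast+
  show ?case
  proof (rule Ck_on_SucI[OF S])
    show "((\<lambda>x. T (f x) (g x)) has_derivative
        (\<lambda>v. T (f x) (frechet_derivative g (at x) v) + T (frechet_derivative f (at x) v) (g x))) (at x)"
      if "x \<in> S" for x
      by (intro bounded_bilinear.FDERIV[OF T] Ck_on_Suc_has_derivative[OF Suc.prems(1) that]
          Ck_on_Suc_has_derivative[OF Suc.prems(2) that])
    show "Ck_on k (\<lambda>x. T (f x) (frechet_derivative g (at x) v) + T (frechet_derivative f (at x) v)
        (g x)) S" for v
      by (intro Ck_on_add[OF S] Suc.IH k) (use Suc.prems in simp_all)
  qed
qed

lemmas Ck_on_mult = Ck_on_bilinear[OF bounded_bilinear_mult]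
lemmas Ck_on_scaleR = Ck_on_bilinear[OF bounded_bilinear_scaleR]

lemma Ck_on_minus:
  assumes "open S" "Ck_on k f S" shows "Ck_on k (\<lambda>x. - f x) S"
  using Ck_on_bounded_linear_compose[OF bounded_linear_minus[OF bounded_linear_ident] assms] by simp

lemma Ck_on_diff:
  assumes "open S" "Ck_on k f S" "Ck_on k g S" shows "Ck_on k (\<lambda>x. f x - g x) S"
  using Ck_on_add[OF assms(1,2) Ck_on_minus[OF assms(1,3)]] by simp

lemma Ck_on_sum:
  assumes "open S" "\<And>i. i \<in> I \<Longrightarrow> Ck_on k (f i) S"
  shows "Ck_on k (\<lambda>x. \<Sum>i\<in>I. f i x) S"
  using assms(2) by (induction I rule: infinite_finite_induct) (auto intro: Ck_on_add[OF assms(1)])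

lemma Ck_on_prod:
  fixes f :: "'i \<Rightarrow> 'a::euclidean_space \<Rightarrow> real"
  assumes "open S" "\<And>i. i \<in> I \<Longrightarrow> Ck_on k (f i) S"
  shows "Ck_on k (\<lambda>x. \<Prod>i\<in>I. f i x) S"
  using assms(2) by (induction I rule: infinite_finite_induct) (auto intro: Ck_on_mult[OF assms(1)])

lemma Ck_on_prod_list:
  fixes f :: "'i \<Rightarrow> 'a::euclidean_space \<Rightarrow> real"
  assumes "open S" "\<And>i. i \<in> set is \<Longrightarrow> Ck_on k (f i) S"
  shows "Ck_on k (\<lambda>x. \<Prod>i\<leftarrow>is. f i x) S"
  using assms(2) by (induction "is") (auto intro: Ck_on_mult[OF assms(1)])

lemma Ck_on_inverse:
  fixes f :: "'a::euclidean_space \<Rightarrow> real"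
  assumes S: "open S" and "Ck_on k f S" and nz: "\<And>x. x \<in> S \<Longrightarrow> f x \<noteq> 0"
  shows "Ck_on k (\<lambda>x. inverse (f x)) S"
  using assms(2)
proof (induction k)
  case 0
  then show ?case using nz by (auto intro: continuous_intros)
next
  case (Suc k)
  have k: "Ck_on k (\<lambda>x. inverse (f x)) S" using Suc Ck_on_Suc_imp by blast
  show ?case
  proof (rule Ck_on_SucI[OF S])
    show "((\<lambda>x. inverse (f x)) has_derivative
        (\<lambda>v. - (inverse (f x) * frechet_derivative f (at x) v * inverse (f x)))) (at x)"
      if "x \<in> S" for x
      by (rule Deriv.has_derivative_inverse[OF nz[OF that] Ck_on_Suc_has_derivative[OF Suc.prems that]])
    show "Ck_on k (\<lambda>x. - (inverse (f x) * frechet_derivative f (at x) v * inverse (f x))) S" for v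
      using Suc k by (intro Ck_on_minus[OF S] Ck_on_mult[OF S]) simp_all
  qed
qed

lemma Ck_on_divide:
  fixes f :: "'a::euclidean_space \<Rightarrow> real"
  assumes "open S" "Ck_on k f S" "Ck_on k g S" "\<And>x. x \<in> S \<Longrightarrow> g x \<noteq> 0"
  shows "Ck_on k (\<lambda>x. f x / g x) S"
  using Ck_on_mult[OF assms(1,2) Ck_on_inverse[OF assms(1,3,4)]] by (simp add: divide_inverse)

lemma Ck_on_nth:
  fixes f :: "'a::euclidean_space \<Rightarrow> real^'n"
  assumes "open S" "Ck_on k f S" shows "Ck_on k (\<lambda>x. f x $ i) S"
  using Ck_on_bounded_linear_compose[OF bounded_linear_vec_nth assms] .

lemma Ck_on_vecI:
  fixes f :: "'a::euclidean_space \<Rightarrow> 'b::euclidean_space^'n"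
  assumes "open S" "\<And>i. Ck_on k (\<lambda>x. f x $ i) S" shows "Ck_on k f S"
proof -
  have "linear (axis i :: 'b \<Rightarrow> 'b^'n)" for i
    by (rule linearI) (simp_all add: vec_eq_iff axis_def)
  then have "Ck_on k (\<lambda>x. \<Sum>i\<in>UNIV. (axis i (f x $ i) :: 'b^'n)) S"
    by (intro Ck_on_sum Ck_on_bounded_linear_compose[of "axis _"] assms)
       (simp_all add: linear_conv_bounded_linear)
  moreover have "(\<Sum>i\<in>UNIV. axis i (f x $ i)) = f x" for x
    by (simp add: vec_eq_iff axis_def if_distrib)
  ultimately show ?thesis by (simp only:)
qed

lemma Ck_on_Pair:
  assumes "open S" "Ck_on k f S" "Ck_on k g S"
  shows "Ck_on k (\<lambda>x. (f x, g x)) S"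
proof -
  have "Ck_on k (\<lambda>x. (f x, 0) + (0, g x)) S"
    using assms by (intro Ck_on_add Ck_on_bounded_linear_compose[of "\<lambda>x. (x, 0)"]
        Ck_on_bounded_linear_compose[of "\<lambda>x. (0, x)"]) (auto intro: bounded_linear_intros)
  then show ?thesis by simp
qed

lemma Ck_on_partial_deriv:
  assumes "Ck_on (Suc k) f S" shows "Ck_on k (partial_deriv i f) S"
  using assms by (simp add: partial_deriv_def[abs_def])

section \<open>Determinants and inverse matrices\<close>

lemma Ck_on_det:
  fixes A :: "'a::euclidean_space \<Rightarrow> real^'n^'n"
  assumes "open S" "\<And>i j. Ck_on k (\<lambda>x. A x $ i $ j) S"
  shows "Ck_on k (\<lambda>x. det (A x)) S"
  unfolding det_def by (intro Ck_on_sum Ck_on_mult Ck_on_prod assms Ck_on_const)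

lemma matrix_inv_left: "invertible A \<Longrightarrow> matrix_inv A ** A = mat 1"
  and matrix_inv_right: "invertible A \<Longrightarrow> A ** matrix_inv A = mat 1"
  unfolding matrix_inv_def invertible_def
  by (metis (mono_tags, lifting) someI_ex)+

text \<open>Cramer's rule for the system whose right-hand side is the \<open>j\<close>-th basis
  vector and whose solution is the \<open>j\<close>-th column of the inverse. It makes the entries
  of the inverse rational functions of the entries of \<open>A\<close>.\<close>

lemma matrix_inv_nth_eq_det:
  fixes A :: "real^'n^'n"
  assumes "invertible A"
  shows "matrix_inv A $ i $ j = det (\<chi> r c. if c = i then (axis j 1 :: real^'n) $ r else A $ r $ c) / det A"
proof -
  have d: "det A \<noteq> 0" using assms invertible_det_nz by blast
  have "A *v (matrix_inv A *v axis j 1) = axis j 1"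
    by (simp add: matrix_vector_mul_assoc matrix_inv_right[OF assms] del: matrix_vector_mult_basis)
  then have "(matrix_inv A *v axis j 1) $ i =
      det (\<chi> r c. if c = i then (axis j 1 :: real^'n) $ r else A $ r $ c) / det A"
    using cramer[OF d] by simp
  then show ?thesis by (simp add: matrix_vector_mult_basis column_def)
qed

lemma Ck_on_matrix_inv:
  fixes A :: "'a::euclidean_space \<Rightarrow> real^'n^'n"
  assumes S: "open S" and A: "\<And>i j. Ck_on k (\<lambda>x. A x $ i $ j) S" "\<And>x. x \<in> S \<Longrightarrow> invertible (A x)"
  shows "Ck_on k (\<lambda>x. matrix_inv (A x) $ i $ j) S"
proof -
  have "Ck_on k (\<lambda>x. (\<chi> r c. if c = i then (axis j 1 :: real^'n) $ r else A x $ r $ c) $ r $ c) S" for r c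
    by (cases "c = i") (simp_all add: A)
  then have "Ck_on k (\<lambda>x. det (\<chi> r c. if c = i then (axis j 1 :: real^'n) $ r else A x $ r $ c) /
      det (A x)) S"
    using A(1) by (intro Ck_on_divide S Ck_on_det) (use A(2) invertible_det_nz in blast)+
  then show ?thesis
    by (rule Ck_on_cong_imp[OF S, rotated]) (simp add: matrix_inv_nth_eq_det A)
qed

section \<open>Neumann series with parameters\<close>

text \<open>Spaces of curves thereby admit both the fixed point theorem and the inversion of
  \<open>1 - L\<close> below.\<close>

instance bcontfun :: (metric_space, banach) banach ..

text \<open>The map \<open>R \<mapsto> 1 + L R\<close> on operators is a contraction with factor
  \<open>1 / 2\<close>, and its fixed point is a right inverse of \<open>1 - L\<close>. The equation
  \<open>R w = w + L (R w)\<close> also gives the bound 2.\<close>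

lemma neumann_inverse:
  fixes L :: "'b::banach \<Rightarrow>\<^sub>L 'b"
  assumes L: "norm L \<le> 1 / 2"
  shows "\<exists>R :: 'b \<Rightarrow>\<^sub>L 'b. norm R \<le> 2 \<and> (\<forall>w. blinfun_apply R (w - blinfun_apply L w) = w) \<and>
    (\<forall>w. blinfun_apply R w - blinfun_apply L (blinfun_apply R w) = w)"
proof -
  define T where "T R = id_blinfun + (L o\<^sub>L R)" for R :: "'b \<Rightarrow>\<^sub>L 'b"
  have "dist (T R) (T R') \<le> 1 / 2 * dist R R'" for R R'
  proof -
    have "T R - T R' = L o\<^sub>L (R - R')"
      by (simp add: T_def bounded_bilinear.diff_right[OF bounded_bilinear_blinfun_compose])
    then have "dist (T R) (T R') \<le> norm L * norm (R - R')"
      by (metis dist_norm norm_blinfun_compose)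
    also have "\<dots> \<le> 1 / 2 * norm (R - R')" by (rule mult_right_mono[OF L]) simp
    finally show ?thesis by (simp add: dist_norm)
  qed
  then obtain R where "T R = R"
    using banach_fix_type[of "1 / 2" T] by auto
  then have R: "R w = w + L (R w)" for w
    unfolding T_def by (metis blinfun.add_left blinfun_apply_blinfun_compose blinfun_apply_id_blinfun)
  have half: "norm (L w) \<le> norm w / 2" for w
    using norm_blinfun[of L w] mult_right_mono[OF L, of "norm w"] by simp
  have "norm (R w) \<le> 2 * norm w" for w
  proof -
    have "norm (R w) \<le> norm w + norm (L (R w))" by (metis R norm_triangle_ineq)
    then show ?thesis using half[of "R w"] by simp
  qed
  then have "norm R \<le> 2" by (intro norm_blinfun_bound) auto
  moreover have "R (w - L w) = w" for w
  proof -
    \<comment> \<open>The defect of \<open>R\<close> as a left inverse is fixed by \<open>L\<close>,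
      which halves norms; so it vanishes.\<close>
    define y where "y = R (w - L w) - w"
    have "L y = L (R (w - L w)) - L w" unfolding y_def by (rule blinfun.diff_right)
    moreover have "R (w - L w) - w = L (R (w - L w)) - L w" by (subst R) simp
    ultimately have "y = L y" by (simp only: y_def)
    then have "norm y \<le> norm y / 2" by (metis half)
    then show ?thesis by (simp add: y_def)
  qed
  moreover have "R w - L (R w) = w" for w
    using R[of w] by (simp add: algebra_simps)
  ultimately show ?thesis by blast
qed

text \<open>Lets a remainder that is small compared with the increment of \<open>f\<close> be
  estimated by the increment of the argument.\<close>

lemma has_derivative_eventually_lipschitz:
  assumes "(f has_derivative f') (at z)"
  shows "\<exists>B. \<forall>\<^sub>F y in at z. norm (f y - f z) \<le> B * norm (y - z)"
proof -
  obtain B where B: "\<And>h. norm (f' h) \<le> norm h * B"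
    using bounded_linear.bounded[OF has_derivative_bounded_linear[OF assms]] by blast
  have "((\<lambda>y. norm (f y - f z - f' (y - z)) / norm (y - z)) \<longlongrightarrow> 0) (at z)"
    using assms unfolding has_derivative_iff_norm by blast
  then have "\<forall>\<^sub>F y in at z. norm (f y - f z - f' (y - z)) / norm (y - z) < 1"
    by (rule order_tendstoD(2)) simp
  then have "\<forall>\<^sub>F y in at z. norm (f y - f z) \<le> (1 + B) * norm (y - z)"
    using eventually_neq_at_within[of z z UNIV]
  proof eventually_elim
    case (elim y)
    then have "norm (f y - f z - f' (y - z)) \<le> norm (y - z)"
      by (simp add: divide_simps)
    moreover have "norm (f y - f z) \<le> norm (f y - f z - f' (y - z)) + norm (f' (y - z))"
      by (metis diff_add_cancel norm_triangle_ineq)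
    ultimately show ?case using B[of "y - z"] by (simp add: algebra_simps)
  qed
  then show ?thesis by blast
qed

text \<open>One factor tends to zero and the other is of the order of \<open>y - z\<close>, so the
  product is of smaller order. Only continuity is asked of \<open>f\<close>, because this is applied
  to an inverse operator whose differentiability is still to be shown.\<close>

lemma has_derivative_bilinear_null:
  assumes T: "bounded_bilinear T" and f: "isCont f z" "f z = 0"
    and g: "(g has_derivative g') (at z)" "g z = 0"
  shows "((\<lambda>y. T (f y) (g y)) has_derivative (\<lambda>v. 0)) (at z)"
proof -
  obtain K where K: "K > 0" "\<And>a b. norm (T a b) \<le> norm a * norm b * K"
    using bounded_bilinear.pos_bounded[OF T] by blast
  obtain B where B: "\<forall>\<^sub>F y in at z. norm (g y - g z) \<le> B * norm (y - z)"
    using has_derivative_eventually_lipschitz[OF g(1)] by blast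
  have "((\<lambda>y. norm (f y) * B * K) \<longlongrightarrow> norm (f z) * B * K) (at z)"
    using f unfolding isCont_def by (intro tendsto_intros)
  then have lim: "((\<lambda>y. norm (f y) * B * K) \<longlongrightarrow> 0) (at z)" using f(2) by simp
  have "\<forall>\<^sub>F y in at z. norm (norm (T (f y) (g y)) / norm (y - z)) \<le> norm (f y) * B * K"
    using B eventually_neq_at_within[of z z UNIV]
  proof eventually_elim
    case (elim y)
    have "norm (T (f y) (g y)) \<le> norm (f y) * (B * norm (y - z)) * K"
      using elim(1) g(2) K(1)
      by (intro order_trans[OF K(2), of "f y" "g y"] mult_right_mono mult_left_mono) auto
    then have "norm (T (f y) (g y)) \<le> (norm (f y) * B * K) * norm (y - z)" by (simp only: mult_ac)
    then show ?case using elim(2) by (simp add: pos_divide_le_eq)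
  qed
  from Lim_null_comparison[OF this lim] show ?thesis
    unfolding has_derivative_iff_norm by (simp add: f g bounded_bilinear.zero_left[OF T])
qed

text \<open>Differentiating the inverse gives \<open>R L' R\<close>. This contains no derivative of
  \<open>R\<close>, so knowing \<open>R\<close> to order \<open>k\<close> and \<open>L\<close> to
  order \<open>k + 1\<close> yields \<open>R\<close> to order \<open>k + 1\<close>.\<close>

lemma Ck_on_neumann_inverse:
  fixes L R :: "'p::euclidean_space \<Rightarrow> 'b::banach \<Rightarrow>\<^sub>L 'b"
  assumes S: "open S" and L: "Ck_on k L S"
    and R: "\<And>z. z \<in> S \<Longrightarrow> norm (R z) \<le> 2" "\<And>z w. z \<in> S \<Longrightarrow> R z (w - L z w) = w"
      "\<And>z w. z \<in> S \<Longrightarrow> R z w - L z (R z w) = w"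
  shows "Ck_on k R S"
proof -
  note C = bounded_bilinear_blinfun_compose
  \<comment> \<open>The resolvent identity \<open>R y - R z = R y (L y - L z) R z\<close>. It serves
    both continuity and differentiability.\<close>
  have eq: "R y = R z + (R y o\<^sub>L ((L y - L z) o\<^sub>L R z))" if "y \<in> S" "z \<in> S" for y z
  proof (rule blinfun_eqI)
    fix w
    have "R y w = R y (R z w - L z (R z w))" using R(3)[OF that(2)] by simp
    also have "\<dots> = R y ((R z w - L y (R z w)) + (L y (R z w) - L z (R z w)))" by simp
    also have "\<dots> = R z w + R y (L y (R z w) - L z (R z w))"
      unfolding blinfun.add_right[of "R y"] using R(2)[OF that(1)] by simp
    finally show "R y w = (R z + (R y o\<^sub>L ((L y - L z) o\<^sub>L R z))) w"
      by (simp add: blinfun.add_left blinfun.diff_left)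
  qed
  have cont: "continuous_on S R"
  proof (rule continuous_at_imp_continuous_on, rule ballI)
    fix z assume z: "z \<in> S"
    have "isCont L z"
      using Ck_on_imp_continuous_on[OF L] S z continuous_on_eq_continuous_at by blast
    then have "((\<lambda>y. 4 * norm (L y - L z)) \<longlongrightarrow> 4 * norm (L z - L z)) (at z)"
      unfolding isCont_def by (intro tendsto_intros)
    then have lim: "((\<lambda>y. 4 * norm (L y - L z)) \<longlongrightarrow> 0) (at z)" by simp
    have "eventually (\<lambda>y. norm (R y - R z) \<le> 4 * norm (L y - L z)) (at z)"
      using eventually_at_in_open'[OF S z]
    proof eventually_elim
      case (elim y)
      have "norm (R y - R z) = norm (R y o\<^sub>L ((L y - L z) o\<^sub>L R z))"
        using eq[OF elim z] by (metis add_diff_cancel_left')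
      also have "\<dots> \<le> norm (R y) * (norm (L y - L z) * norm (R z))"
        by (meson norm_blinfun_compose mult_left_mono norm_ge_zero order_trans)
      also have "\<dots> \<le> 2 * (norm (L y - L z) * 2)"
        by (intro mult_mono R z elim) auto
      finally show ?case by simp
    qed
    from Lim_null_comparison[OF this lim] show "isCont R z" unfolding isCont_def by (simp add: LIM_zero_iff)
  qed
  show ?thesis using L
  proof (induction k)
    case 0
    then show ?case using cont by simp
  next
    case (Suc k)
    have k: "Ck_on k R S" using Suc Ck_on_Suc_imp by blast
    let ?L' = "\<lambda>z. frechet_derivative L (at z)"
    show ?case
    proof (rule Ck_on_SucI[OF S])
      fix z assume z: "z \<in> S"
      have L': "(L has_derivative ?L' z) (at z)"
        by (rule Ck_on_Suc_has_derivative[OF Suc.prems z])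
      have bl: "bounded_linear (\<lambda>v. R z o\<^sub>L (?L' z v o\<^sub>L R z))"
        using has_derivative_bounded_linear[OF L']
        by (intro bounded_linear_compose[OF bounded_bilinear.bounded_linear_right[OF C]]
             bounded_linear_compose[OF bounded_bilinear.bounded_linear_left[OF C]])
      have Q: "((\<lambda>y. R z o\<^sub>L ((L y - L z) o\<^sub>L R z)) has_derivative (\<lambda>v. R z o\<^sub>L (?L' z v o\<^sub>L R z))) (at z)"
        using has_derivative_diff[OF L' has_derivative_const[of "L z"]]
        by (intro bounded_linear.has_derivative[OF bounded_bilinear.bounded_linear_right[OF C]]
             bounded_linear.has_derivative[OF bounded_bilinear.bounded_linear_left[OF C]]) simp
      \<comment> \<open>The left factor \<open>R y\<close> in the resolvent identity is frozen to
        \<open>R z\<close>; the error made is a product of two quantities that vanish at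
        \<open>z\<close>.\<close>
      have "((\<lambda>y. (R y - R z) o\<^sub>L ((L y - L z) o\<^sub>L R z)) has_derivative (\<lambda>v. 0)) (at z)"
      proof (rule has_derivative_bilinear_null[OF C])
        show "isCont (\<lambda>y. R y - R z) z"
          using cont S z continuous_on_eq_continuous_at by (intro continuous_intros) blast
        show "((\<lambda>y. (L y - L z) o\<^sub>L R z) has_derivative (\<lambda>v. ?L' z v o\<^sub>L R z)) (at z)"
          using has_derivative_diff[OF L' has_derivative_const[of "L z"]]
          by (intro bounded_linear.has_derivative[OF bounded_bilinear.bounded_linear_left[OF C]]) simp
      qed simp_all
      from has_derivative_add[OF has_derivative_add[OF Q this] has_derivative_const[of "R z"]]
      have "((\<lambda>y. R z + (R y o\<^sub>L ((L y - L z) o\<^sub>L R z))) has_derivative (\<lambda>v. R z o\<^sub>L (?L' z v o\<^sub>L R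
          z))) (at z)"
        by (simp add: bounded_bilinear.diff_left[OF C] add.commute)
      then show "(R has_derivative (\<lambda>v. R z o\<^sub>L (?L' z v o\<^sub>L R z))) (at z)"
        by (rule has_derivative_transform_within_open[OF _ S z]) (use eq z in metis)
    next
      show "Ck_on k (\<lambda>z. R z o\<^sub>L (?L' z v o\<^sub>L R z)) S" for v
        by (intro Ck_on_bilinear[OF C S] k) (use Suc.prems in simp)
    qed
  qed
qed

section \<open>Superposition operators\<close>

text \<open>The Nemytskii operator of \<open>f\<close>. \<open>Bcontfun\<close> is meaningful only
  if the composite is bounded and continuous, which below is ensured either by values of
  \<open>u\<close> in a compact set or by linearity of \<open>f\<close>.\<close>

definition superpose :: "('a \<Rightarrow> 'b) \<Rightarrow> ('x::topological_space \<Rightarrow>\<^sub>C 'a::metric_space) \<Rightarrow> 'x \<Rightarrow>\<^sub>C 'b::metric_space"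
  where "superpose f u = Bcontfun (\<lambda>s. f (apply_bcontfun u s))"

lemma superpose_apply:
  assumes "compact C" "continuous_on C f" "\<And>s. apply_bcontfun u s \<in> C"
  shows "apply_bcontfun (superpose f u) s = f (apply_bcontfun u s)"
proof -
  have "continuous_on UNIV (\<lambda>s. f (apply_bcontfun u s))"
    using assms by (intro continuous_on_compose2[OF assms(2)]) auto
  moreover have "bounded (range (\<lambda>s. f (apply_bcontfun u s)))"
    by (rule bounded_subset[OF compact_imp_bounded[OF compact_continuous_image[OF assms(2,1)]]])
      (use assms(3) in auto)
  ultimately show ?thesis by (simp add: superpose_def Bcontfun_inverse bcontfun_def)
qed

lemma superpose_linear_apply:
  assumes "bounded_linear T"
  shows "apply_bcontfun (superpose T u) s = T (apply_bcontfun u s)"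
proof -
  have "continuous_on UNIV (\<lambda>s. T (apply_bcontfun u s))"
    by (intro bounded_linear.continuous_on[OF assms] continuous_on_apply_bcontfun)
  moreover have "bounded (range (\<lambda>s. T (apply_bcontfun u s)))"
    using bounded_linear_image[OF bounded_apply_bcontfun assms] by (simp add: image_image)
  ultimately show ?thesis by (simp add: superpose_def Bcontfun_inverse bcontfun_def)
qed

lemma bounded_linear_superpose:
  fixes T :: "'a::real_normed_vector \<Rightarrow> 'b::real_normed_vector"
  assumes T: "bounded_linear T"
  shows "bounded_linear (superpose T :: ('x::topological_space \<Rightarrow>\<^sub>C 'a) \<Rightarrow> 'x \<Rightarrow>\<^sub>C 'b)"
proof (rule bounded_linear_intro)
  interpret bounded_linear T by (rule T)
  fix u v :: "'x \<Rightarrow>\<^sub>C 'a" and r :: real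
  show "superpose T (u + v) = superpose T u + superpose T v"
    by (rule bcontfun_eqI) (simp add: superpose_linear_apply[OF T] add)
  show "superpose T (r *\<^sub>R u) = r *\<^sub>R superpose T u"
    by (rule bcontfun_eqI) (simp add: superpose_linear_apply[OF T] scaleR)
  show "norm (superpose T u) \<le> norm u * onorm T"
  proof (rule norm_bound)
    fix s
    have "norm (T (apply_bcontfun u s)) \<le> onorm T * norm (apply_bcontfun u s)" by (rule onorm[OF T])
    also have "\<dots> \<le> onorm T * norm u" by (intro mult_left_mono norm_bounded onorm_pos_le[OF T])
    finally show "norm (apply_bcontfun (superpose T u) s) \<le> norm u * onorm T"
      by (simp add: superpose_linear_apply[OF T] mult.commute)
  qed
qed

definition bscale :: "('x::topological_space \<Rightarrow>\<^sub>C real) \<Rightarrow> ('x \<Rightarrow>\<^sub>C 'b) \<Rightarrow> 'x \<Rightarrow>\<^sub>C 'b::real_normed_vector"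
  where "bscale p q = Bcontfun (\<lambda>s. apply_bcontfun p s *\<^sub>R apply_bcontfun q s)"

lemma bscale_apply: "apply_bcontfun (bscale p q) s = apply_bcontfun p s *\<^sub>R apply_bcontfun q s"
proof -
  have "(\<lambda>s. apply_bcontfun p s *\<^sub>R apply_bcontfun q s) \<in> bcontfun"
  proof (rule bcontfun_normI)
    show "norm (apply_bcontfun p s *\<^sub>R apply_bcontfun q s) \<le> norm p * norm q" for s
      using mult_mono[OF norm_bounded[of p s] norm_bounded[of q s]] by simp
  qed (auto intro: continuous_intros)
  then show ?thesis by (simp add: bscale_def Bcontfun_inverse)
qed

lemma bounded_bilinear_bscale: "bounded_bilinear bscale"
proof
  show "\<exists>K. \<forall>a b. norm (bscale a b :: 'a \<Rightarrow>\<^sub>C 'b) \<le> norm a * norm b * K"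
  proof (intro exI allI)
    fix a :: "'a \<Rightarrow>\<^sub>C real" and b :: "'a \<Rightarrow>\<^sub>C 'b"
    show "norm (bscale a b) \<le> norm a * norm b * 1"
      using mult_mono[OF norm_bounded[of a] norm_bounded[of b]]
      by (intro norm_bound) (simp add: bscale_apply)
  qed
qed (auto intro!: bcontfun_eqI simp: bscale_apply scaleR_add_left scaleR_add_right)

text \<open>The derivative of \<open>superpose f\<close> at \<open>u\<close>, expanded in a basis so that its regularity in \<open>u\<close> can be
  read off.\<close>

definition dsuperpose ::
    "('a::euclidean_space \<Rightarrow> 'b::real_normed_vector) \<Rightarrow> ('x::topological_space \<Rightarrow>\<^sub>C 'a) \<Rightarrow> ('x \<Rightarrow>\<^sub>C 'a) \<Rightarrow>
        'x \<Rightarrow>\<^sub>C 'b"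
  where "dsuperpose f u w = (\<Sum>b\<in>Basis. bscale (superpose (\<lambda>x. x \<bullet> b) w)
                        (superpose (\<lambda>x. frechet_derivative f (at x) b) u))"

lemma sum_bcontfun_apply: "apply_bcontfun (\<Sum>i\<in>I. f i) s = (\<Sum>i\<in>I. apply_bcontfun (f i) s)"
  by (induction I rule: infinite_finite_induct) auto

lemma linear_basis_expansion:
  fixes h :: "'a::euclidean_space"
  assumes "linear T" shows "T h = (\<Sum>b\<in>Basis. (h \<bullet> b) *\<^sub>R T b)"
proof -
  have "T h = T (\<Sum>b\<in>Basis. (h \<bullet> b) *\<^sub>R b)" by (simp add: euclidean_representation)
  also have "\<dots> = (\<Sum>b\<in>Basis. (h \<bullet> b) *\<^sub>R T b)"
    by (simp add: linear_sum[OF assms] linear_cmul[OF assms])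
  finally show ?thesis .
qed

text \<open>Curves are confined to \<open>C\<close>. Compactness gives uniform continuity and
  boundedness of the derivative, convexity allows the mean value inequality along segments.\<close>

locale compact_in_C1 =
  fixes f :: "'e::euclidean_space \<Rightarrow> 'f::real_normed_vector" and C V :: "'e set"
  assumes compact: "compact C" and convex: "convex C" and sub: "C \<subseteq> V"
    and C1: "Ck_on (Suc 0) f V"
begin

abbreviation "f' x \<equiv> frechet_derivative f (at x)"

lemma deriv: "x \<in> C \<Longrightarrow> (f has_derivative f' x) (at x)"
  using Ck_on_Suc_has_derivative[OF C1] sub by blast

lemma linear_deriv: "x \<in> C \<Longrightarrow> linear (f' x)"
  using deriv has_derivative_linear by blast

lemma cont: "continuous_on C f"
  using Ck_on_imp_continuous_on[OF C1] sub continuous_on_subset by blast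

lemma cont_deriv: "continuous_on C (\<lambda>x. f' x b)"
  by (rule continuous_on_subset[OF _ sub]) (use C1 in simp)

lemma dsuperpose_apply:
  assumes "\<And>s. apply_bcontfun u s \<in> C"
  shows "apply_bcontfun (dsuperpose f u w) s = f' (apply_bcontfun u s) (apply_bcontfun w s)"
  unfolding dsuperpose_def
  by (simp add: sum_bcontfun_apply bscale_apply superpose_apply[OF compact cont_deriv assms]
      superpose_linear_apply[OF bounded_linear_inner_left]
      linear_basis_expansion[OF linear_deriv[OF assms], of s "apply_bcontfun w s"])

text \<open>Frechet differentiability in the sup norm. Uniform continuity of the derivative gives
  one \<open>\<delta>\<close> for all points of \<open>C\<close>, so the pointwise mean value
  estimate holds uniformly in \<open>s\<close>.\<close>

lemma superpose_linearization:
  assumes e: "e > 0"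
  shows "\<exists>\<delta>>0. \<forall>(u :: 'x::topological_space \<Rightarrow>\<^sub>C 'e) w. (\<forall>s. apply_bcontfun u s \<in> C) \<longrightarrow> (\<forall>s.
      apply_bcontfun w s \<in> C) \<longrightarrow>
    norm (w - u) < \<delta> \<longrightarrow>
    norm (superpose f w - superpose f u - dsuperpose f u (w - u)) \<le> e * norm (w - u)"
proof -
  \<comment> \<open>\<open>g\<close> vanishes on the diagonal. Comparing \<open>(x, y)\<close> with
    \<open>(y, y)\<close> turns its uniform continuity into closeness of the derivatives at
    \<open>x\<close> and \<open>y\<close>.\<close>
  define g where "g = (\<lambda>(x, y). \<Sum>b\<in>Basis. norm (f' x b - f' y b))"
  have "continuous_on (C \<times> C) g"
    unfolding g_def split_def
    by (intro continuous_on_sum continuous_on_norm continuous_on_diff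
        continuous_on_compose2[OF cont_deriv continuous_on_fst[OF continuous_on_id]]
        continuous_on_compose2[OF cont_deriv continuous_on_snd[OF continuous_on_id]]) auto
  then have "uniformly_continuous_on (C \<times> C) g"
    using compact compact_Times compact_uniformly_continuous by blast
  then obtain \<delta> where \<delta>: "\<delta> > 0"
    "\<And>p q. p \<in> C \<times> C \<Longrightarrow> q \<in> C \<times> C \<Longrightarrow> dist p q < \<delta> \<Longrightarrow> dist (g p) (g q) < e"
    unfolding uniformly_continuous_on_def using e by metis
  have on: "onorm (\<lambda>h. f' x h - f' y h) \<le> e" if "x \<in> C" "y \<in> C" "norm (x - y) < \<delta>" for x y
  proof (rule onorm_le)
    fix h
    have "dist (g (x, y)) (g (y, y)) < e"
      using that by (intro \<delta>(2)) (auto simp: dist_Pair_Pair dist_norm)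
    then have ge: "(\<Sum>b\<in>Basis. norm (f' x b - f' y b)) < e"
      by (simp add: g_def dist_norm)
    have "f' x h - f' y h = (\<Sum>b\<in>Basis. (h \<bullet> b) *\<^sub>R (f' x b - f' y b))"
      using that linear_basis_expansion[OF linear_deriv]
      by (simp add: scaleR_diff_right sum_subtractf)
    also have "norm \<dots> \<le> (\<Sum>b\<in>Basis. norm h * norm (f' x b - f' y b))"
      by (intro sum_norm_le) (auto intro!: mult_right_mono Basis_le_norm)
    also have "\<dots> \<le> norm h * e"
      unfolding sum_distrib_left[symmetric] using ge by (intro mult_left_mono) auto
    finally show "norm (f' x h - f' y h) \<le> e * norm h" by (simp add: mult.commute)
  qed
  have pw: "norm (f b - f a - f' a (b - a)) \<le> norm (b - a) * e"
    if "a \<in> C" "b \<in> C" "norm (b - a) < \<delta>" for a b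
  proof (rule differentiable_bound_linearization[where S = "C \<inter> ball a \<delta>" and f' = f'])
    fix t :: real assume t: "t \<in> {0..1}"
    have "a + t *\<^sub>R (b - a) = (1 - t) *\<^sub>R a + t *\<^sub>R b" by (simp add: algebra_simps)
    then have "a + t *\<^sub>R (b - a) \<in> C" using convexD[OF convex that(1,2)] t by auto
    moreover have "norm (t *\<^sub>R (b - a)) < \<delta>"
      using that(3) t mult_left_le_one_le[of "norm (b - a)" t] by simp
    then have "a + t *\<^sub>R (b - a) \<in> ball a \<delta>" by (simp add: dist_norm)
    ultimately show "a + t *\<^sub>R (b - a) \<in> C \<inter> ball a \<delta>" by simp
  next
    show "onorm (f' x - f' a) \<le> e" if "x \<in> C \<inter> ball a \<delta>" for x
      using on[of x a] that \<open>a \<in> C\<close> by (simp add: dist_norm norm_minus_commute fun_diff_def)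
  next
    show "(f has_derivative f' x) (at x within C \<inter> ball a \<delta>)" if "x \<in> C \<inter> ball a \<delta>" for x
      by (rule has_derivative_at_withinI[OF deriv]) (use that in simp)
  qed (use that(1) \<delta>(1) in simp)
  show ?thesis
  proof (intro exI[of _ \<delta>] conjI allI impI \<delta>(1))
    fix u w :: "'x \<Rightarrow>\<^sub>C 'e" assume u: "\<forall>s. apply_bcontfun u s \<in> C" and w: "\<forall>s. apply_bcontfun w s \<in> C"
      and d: "norm (w - u) < \<delta>"
    show "norm (superpose f w - superpose f u - dsuperpose f u (w - u)) \<le> e * norm (w - u)"
    proof (rule norm_bound)
      fix s
      have n: "norm (apply_bcontfun w s - apply_bcontfun u s) \<le> norm (w - u)"
        using norm_bounded[of "w - u" s] by simp
      have "norm (f (apply_bcontfun w s) - f (apply_bcontfun u s)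
            - f' (apply_bcontfun u s) (apply_bcontfun w s - apply_bcontfun u s))
          \<le> norm (apply_bcontfun w s - apply_bcontfun u s) * e"
        using u w d n by (intro pw) auto
      also have "\<dots> \<le> norm (w - u) * e" using n e by (intro mult_right_mono) auto
      finally show "norm (apply_bcontfun (superpose f w - superpose f u - dsuperpose f u (w - u)) s)
          \<le> e * norm (w - u)"
        using u w by (simp add: superpose_apply[OF compact cont] dsuperpose_apply mult.commute)
    qed
  qed
qed

text \<open>Of \<open>U\<close> only a Lipschitz bound at \<open>z\<close> is assumed. In the fixed
  point argument this lemma is applied before \<open>U\<close> is known to be
  differentiable.\<close>

lemma superpose_remainder_has_derivative:
  fixes U :: "'p::real_normed_vector \<Rightarrow> 'x::topological_space \<Rightarrow>\<^sub>C 'e"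
  assumes S: "open S" "z \<in> S" and U: "\<And>y s. y \<in> S \<Longrightarrow> apply_bcontfun (U y) s \<in> C"
    and B: "\<forall>\<^sub>F y in at z. norm (U y - U z) \<le> B * norm (y - z)"
  shows "((\<lambda>y. superpose f (U y) - superpose f (U z) - dsuperpose f (U z) (U y - U z))
            has_derivative (\<lambda>v. 0)) (at z)"
proof -
  let ?E = "\<lambda>y. superpose f (U y) - superpose f (U z) - dsuperpose f (U z) (U y - U z)"
  have z: "apply_bcontfun (U z) s \<in> C" for s using U S by blast
  have Ez: "?E z = 0"
    by (rule bcontfun_eqI) (simp add: dsuperpose_apply[OF z] linear_0[OF linear_deriv[OF z]])
  have "((\<lambda>y. norm (?E y) / norm (y - z)) \<longlongrightarrow> 0) (at z)"
  proof (rule tendstoI)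
    fix e :: real assume e: "e > 0"
    \<comment> \<open>A positive constant, since it is divided by below.\<close>
    define B' where "B' = max B 1"
    have B': "B' > 0" "B \<le> B'" by (auto simp: B'_def)
    obtain \<delta> where \<delta>: "\<delta> > 0" and lin: "\<And>w. (\<forall>s. apply_bcontfun w s \<in> C) \<Longrightarrow> norm (w - U z) < \<delta> \<Longrightarrow>
        norm (superpose f w - superpose f (U z) - dsuperpose f (U z) (w - U z)) \<le> e / (2 * B') *
            norm (w - U z)"
      using superpose_linearization[of "e / (2 * B')"] e B' z by (metis divide_pos_pos mult_2 add_pos_pos)
    have "\<forall>\<^sub>F y in at z. dist y z < \<delta> / B'"
      unfolding eventually_at using \<delta> B' by (intro exI[of _ "\<delta> / B'"]) auto
    with B eventually_at_in_open'[OF S] eventually_neq_at_within[of z z UNIV]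
    show "\<forall>\<^sub>F y in at z. dist (norm (?E y) / norm (y - z)) 0 < e"
    proof eventually_elim
      case (elim y)
      have "B * norm (y - z) \<le> B' * norm (y - z)" using B' by (intro mult_right_mono) auto
      then have l: "norm (U y - U z) \<le> B' * norm (y - z)" using elim(1) by linarith
      also have "\<dots> < \<delta>" using elim(4) B' by (simp add: dist_norm pos_less_divide_eq mult.commute)
      finally have "norm (?E y) \<le> e / (2 * B') * norm (U y - U z)"
        using U[OF elim(2)] by (intro lin) auto
      also have "\<dots> \<le> e / (2 * B') * (B' * norm (y - z))"
        using l e B' by (intro mult_left_mono) auto
      also have "\<dots> = e / 2 * norm (y - z)" using B' by simp
      also have "\<dots> < e * norm (y - z)" using e elim(3) by (intro mult_strict_right_mono) auto
      finally show ?case using elim(3) by (simp add: pos_divide_less_eq)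
    qed
  qed
  then show ?thesis unfolding has_derivative_iff_norm Ez by simp
qed

lemma bounded_linear_dsuperpose: "bounded_linear (dsuperpose f u)"
  unfolding dsuperpose_def[abs_def]
  by (intro bounded_linear_sum bounded_linear_compose[OF
      bounded_bilinear.bounded_linear_left[OF bounded_bilinear_bscale]]
      bounded_linear_superpose bounded_linear_inner_left)

lemma superpose_has_derivative:
  fixes U :: "'p::real_normed_vector \<Rightarrow> 'x::topological_space \<Rightarrow>\<^sub>C 'e"
  assumes S: "open S" "z \<in> S" and U: "\<And>y s. y \<in> S \<Longrightarrow> apply_bcontfun (U y) s \<in> C"
    and U': "(U has_derivative U') (at z)"
  shows "((\<lambda>y. superpose f (U y)) has_derivative (\<lambda>v. dsuperpose f (U z) (U' v))) (at z)"
proof -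
  obtain B where B: "\<forall>\<^sub>F y in at z. norm (U y - U z) \<le> B * norm (y - z)"
    using has_derivative_eventually_lipschitz[OF U'] by blast
  have "((\<lambda>y. dsuperpose f (U z) (U y - U z)) has_derivative (\<lambda>v. dsuperpose f (U z) (U' v))) (at z)"
    using has_derivative_diff[OF U' has_derivative_const[of "U z"]]
    by (intro bounded_linear.has_derivative[OF bounded_linear_dsuperpose]) simp
  from has_derivative_add[OF has_derivative_add[OF this superpose_remainder_has_derivative[OF S U B]]
      has_derivative_const[of "superpose f (U z)"]]
  show ?thesis by simp
qed

lemma bounded_deriv: "\<exists>B\<ge>0. \<forall>x\<in>C. \<forall>h. norm (f' x h) \<le> B * norm h"
proof -
  have "continuous_on C (\<lambda>x. \<Sum>b\<in>Basis. norm (f' x b))"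
    by (intro continuous_intros cont_deriv)
  then have "bounded ((\<lambda>x. \<Sum>b\<in>Basis. norm (f' x b)) ` C)"
    using compact compact_continuous_image compact_imp_bounded by blast
  then obtain B where B: "\<And>x. x \<in> C \<Longrightarrow> norm (\<Sum>b\<in>Basis. norm (f' x b)) \<le> B" "B > 0"
    unfolding bounded_pos by blast
  have "norm (f' x h) \<le> B * norm h" if "x \<in> C" for x h
  proof -
    have "norm (f' x h) \<le> (\<Sum>b\<in>Basis. norm h * norm (f' x b))"
      unfolding linear_basis_expansion[OF linear_deriv[OF that], of h]
      by (intro sum_norm_le) (auto intro!: mult_right_mono Basis_le_norm)
    also have "\<dots> \<le> norm h * B"
      unfolding sum_distrib_left[symmetric]
      using B(1)[OF that] by (intro mult_left_mono) auto
    finally show ?thesis by (simp add: mult.commute)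
  qed
  then show ?thesis using B(2) by (intro exI[of _ B]) auto
qed

lemma lipschitz:
  assumes B: "\<And>x h. x \<in> C \<Longrightarrow> norm (f' x h) \<le> B * norm h" and "x \<in> C" "y \<in> C"
  shows "norm (f x - f y) \<le> B * norm (x - y)"
proof (rule differentiable_bound[OF convex _ _ assms(2,3)])
  show "(f has_derivative f' x) (at x within C)" if "x \<in> C" for x
    using deriv[OF that] has_derivative_at_withinI by blast
  show "onorm (f' x) \<le> B" if "x \<in> C" for x
    using onorm_le[of "f' x" B] B[OF that] by auto
qed

end

text \<open>By \<open>dsuperpose\<close>, the derivative consists of superpositions with the
  directional derivatives of \<open>f\<close>, multiplied by linear images of the derivative of
  \<open>U\<close>. Both are one order less regular, hence an induction over \<open>k\<close> for
  all \<open>f\<close> at once.\<close>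

lemma Ck_on_superpose:
  fixes f :: "'e::euclidean_space \<Rightarrow> 'f::real_normed_vector"
    and U :: "'p::euclidean_space \<Rightarrow> 'x::topological_space \<Rightarrow>\<^sub>C 'e"
  assumes C: "compact C" "convex C" "C \<subseteq> V" and S: "open S"
    and U: "Ck_on k U S" "\<And>y s. y \<in> S \<Longrightarrow> apply_bcontfun (U y) s \<in> C" and f: "Ck_on k f V"
  shows "Ck_on k (\<lambda>z. superpose f (U z)) S"
  using U(1) f
proof (induction k arbitrary: f)
  case 0
  have contf: "continuous_on C f" using 0 C(3) continuous_on_subset by auto
  then have uc: "uniformly_continuous_on C f" using C(1) compact_uniformly_continuous by blast
  have "continuous_on S (\<lambda>z. superpose f (U z))"
    unfolding continuous_on_iff
  proof (intro ballI allI impI)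
    fix z and e :: real assume z: "z \<in> S" and e: "e > 0"
    obtain \<delta> where \<delta>: "\<delta> > 0" "\<And>x y. x \<in> C \<Longrightarrow> y \<in> C \<Longrightarrow> dist x y < \<delta> \<Longrightarrow> dist (f x) (f y) < e / 2"
      using uc e unfolding uniformly_continuous_on_def by (metis half_gt_zero)
    obtain \<eta> where \<eta>: "\<eta> > 0" "\<And>y. y \<in> S \<Longrightarrow> dist y z < \<eta> \<Longrightarrow> dist (U y) (U z) < \<delta>"
      using 0(1) z \<delta>(1) unfolding Ck_on.simps continuous_on_iff by metis
    have "dist (superpose f (U y)) (superpose f (U z)) < e" if "y \<in> S" "dist y z < \<eta>" for y
    proof -
      have "dist (superpose f (U y)) (superpose f (U z)) \<le> e / 2"
      proof (rule dist_bound)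
        fix s
        have "dist (f (apply_bcontfun (U y) s)) (f (apply_bcontfun (U z) s)) < e / 2"
          using dist_bounded[of "U y" s "U z"] \<eta>(2)[OF that] by (intro \<delta>(2) U(2) z that(1)) simp
        then show "dist (apply_bcontfun (superpose f (U y)) s) (apply_bcontfun (superpose f (U z)) s) \<le> e / 2"
          using U(2) z that(1) by (simp add: superpose_apply[OF C(1) contf])
      qed
      then show ?thesis using e by simp
    qed
    then show "\<exists>d>0. \<forall>y\<in>S. dist y z < d \<longrightarrow> dist (superpose f (U y)) (superpose f (U z)) < e"
      using \<eta>(1) by blast
  qed
  then show ?case by simp
next
  case (Suc k)
  have "Ck_on (Suc 0) f V" by (rule Ck_on_mono[OF Suc.prems(2)]) simp
  then interpret compact_in_C1 f C V using C by unfold_locales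
  have k: "Ck_on k U S" using Ck_on_Suc_imp[OF Suc.prems(1)] .
  show ?case
  proof (rule Ck_on_SucI[OF S])
    show "((\<lambda>z. superpose f (U z)) has_derivative (\<lambda>v. dsuperpose f (U z) (frechet_derivative U (at
        z) v))) (at z)"
      if "z \<in> S" for z
      by (rule superpose_has_derivative[OF S that U(2) Ck_on_Suc_has_derivative[OF Suc.prems(1) that]])
    show "Ck_on k (\<lambda>z. dsuperpose f (U z) (frechet_derivative U (at z) v)) S" for v
      unfolding dsuperpose_def
      by (intro Ck_on_sum[OF S] Ck_on_bilinear[OF bounded_bilinear_bscale S] Suc.IH[OF k]
        Ck_on_bounded_linear_compose[OF bounded_linear_superpose[OF bounded_linear_inner_left] S])
        (use Suc.prems in simp_all)
  qed
qed

section \<open>Parametrised fixed points\<close>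

context compact_in_C1
begin

lemma norm_dsuperpose_le:
  assumes u: "\<And>s. apply_bcontfun u s \<in> C" and B: "\<And>x h. x \<in> C \<Longrightarrow> norm (f' x h) \<le> B * norm h" "B \<ge> 0"
  shows "norm (dsuperpose f u w) \<le> B * norm w"
proof (rule norm_bound)
  fix s
  have "norm (f' (apply_bcontfun u s) (apply_bcontfun w s)) \<le> B * norm (apply_bcontfun w s)"
    by (rule B(1)[OF u])
  also have "\<dots> \<le> B * norm w" by (intro mult_left_mono norm_bounded B)
  finally show "norm (apply_bcontfun (dsuperpose f u w) s) \<le> B * norm w"
    by (simp add: dsuperpose_apply[OF u])
qed

lemma norm_superpose_diff_le:
  assumes u: "\<And>s. apply_bcontfun u s \<in> C" "\<And>s. apply_bcontfun w s \<in> C"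
    and B: "\<And>x h. x \<in> C \<Longrightarrow> norm (f' x h) \<le> B * norm h" "B \<ge> 0"
  shows "norm (superpose f u - superpose f w) \<le> B * norm (u - w)"
proof (rule norm_bound)
  fix s
  have "norm (f (apply_bcontfun u s) - f (apply_bcontfun w s)) \<le> B * norm (apply_bcontfun (u - w) s)"
    using lipschitz[OF B(1) u(1)[of s] u(2)[of s]] by simp
  also have "\<dots> \<le> B * norm (u - w)" by (intro mult_left_mono norm_bounded B)
  finally show "norm (apply_bcontfun (superpose f u - superpose f w) s) \<le> B * norm (u - w)"
    using u by (simp add: superpose_apply[OF compact cont])
qed

end

text \<open>The derivative of the solution \<open>U z\<close> of \<open>U z = a z + K (superpose f (U z))\<close> is
  \<open>(1 - K \<circ> dsuperpose f (U z))\<^sup>-\<^sup>1 \<circ> a' z\<close>, which is as regular in \<open>z\<close> as \<open>U\<close> itself.\<close>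

lemma Ck_on_fixed_point:
  fixes f :: "'e::euclidean_space \<Rightarrow> 'e" and a U :: "'p::euclidean_space \<Rightarrow> 'x::metric_space \<Rightarrow>\<^sub>C 'e"
    and K :: "('x \<Rightarrow>\<^sub>C 'e) \<Rightarrow>\<^sub>L ('x \<Rightarrow>\<^sub>C 'e)"
  assumes C: "compact C" "convex C" "C \<subseteq> V" and S: "open S" and f: "Ck_on (Suc r) f V"
    and a: "Ck_on (Suc r) a S"
    and B: "\<And>x h. x \<in> C \<Longrightarrow> norm (frechet_derivative f (at x) h) \<le> B * norm h" "B \<ge> 0"
    and K: "norm K * B \<le> 1 / 2"
    and U: "\<And>z s. z \<in> S \<Longrightarrow> apply_bcontfun (U z) s \<in> C"
      "\<And>z. z \<in> S \<Longrightarrow> U z = a z + blinfun_apply K (superpose f (U z))"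
  shows "Ck_on (Suc r) U S"
proof -
  have "Ck_on (Suc 0) f V" by (rule Ck_on_mono[OF f]) simp
  then interpret compact_in_C1 f C V using C by unfold_locales
  have K': "norm (blinfun_apply K q) \<le> norm w / 2" if "norm q \<le> B * norm w" for q w
  proof -
    have "norm (blinfun_apply K q) \<le> norm K * (B * norm w)"
      using norm_blinfun[of K q] mult_left_mono[OF that norm_ge_zero[of K]] by linarith
    also have "\<dots> \<le> 1 / 2 * norm w"
      unfolding mult.assoc[symmetric] by (intro mult_right_mono K) simp
    finally show ?thesis by simp
  qed
  \<comment> \<open>The nonlinear term contributes at most half of the left-hand side and is
    absorbed into it. This is the Lipschitz bound from which differentiability of \<open>U\<close>
    starts.\<close>
  have lip: "norm (U y - U z) \<le> 2 * norm (a y - a z)" if "y \<in> S" "z \<in> S" for y z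
  proof -
    have "U y - U z = (a y - a z) + blinfun_apply K (superpose f (U y) - superpose f (U z))"
      by (subst (1 2) U(2)) (use that in \<open>simp_all add: blinfun.diff_right\<close>)
    then have "norm (U y - U z) \<le> norm (a y - a z) + norm (blinfun_apply K (superpose f (U y) -
        superpose f (U z)))"
      using norm_triangle_ineq by metis
    also have "\<dots> \<le> norm (a y - a z) + norm (U y - U z) / 2"
      using that by (intro add_left_mono K' norm_superpose_diff_le U B)
    finally show ?thesis by simp
  qed
  \<comment> \<open>The operator \<open>K \<circ> dsuperpose f (U z)\<close> as an element of the
    space of bounded operators. The parameter \<open>z\<close> enters only through superpositions
    with derivatives of \<open>f\<close>, so that \<open>Ck_on_superpose\<close> gives its
    regularity in the operator norm.\<close>
  define L where "L z = (\<Sum>b\<in>Basis. K o\<^sub>L ((bounded_bilinear.prod_left bscale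
      (superpose (\<lambda>x. frechet_derivative f (at x) b) (U z))) o\<^sub>L Blinfun (superpose (\<lambda>x. x \<bullet> b))))" for z
  have L: "blinfun_apply (L z) w = blinfun_apply K (dsuperpose f (U z) w)" for z w
    by (simp add: L_def dsuperpose_def blinfun.sum_left blinfun.sum_right
        bounded_bilinear.prod_left.rep_eq[OF bounded_bilinear_bscale]
        bounded_linear_Blinfun_apply[OF bounded_linear_superpose[OF bounded_linear_inner_left]])
  have CkL: "Ck_on m L S" if "Ck_on m U S" "m \<le> r" for m
  proof -
    have "Ck_on m (\<lambda>z. superpose (\<lambda>x. frechet_derivative f (at x) b) (U z)) S" for b
      using f by (intro Ck_on_superpose[OF C S that(1) U(1)] Ck_on_mono[OF _ that(2)]) simp_all
    then show ?thesis
      unfolding L_def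
      by (intro Ck_on_sum[OF S] Ck_on_bilinear[OF bounded_bilinear_blinfun_compose S] Ck_on_const
          Ck_on_bounded_linear_compose[OF bounded_bilinear.bounded_linear_prod_left[OF
              bounded_bilinear_bscale] S])
  qed
  have "norm (L z) \<le> 1 / 2" if "z \<in> S" for z
  proof (rule norm_blinfun_bound)
    show "norm (blinfun_apply (L z) w) \<le> 1 / 2 * norm w" for w
      unfolding L using K'[OF norm_dsuperpose_le[OF U(1)[OF that] B]] by simp
  qed simp
  then have "\<exists>R. \<forall>z\<in>S. norm (R z) \<le> 2 \<and> (\<forall>w. blinfun_apply (R z) (w - blinfun_apply (L z) w) = w) \<and>
      (\<forall>w. blinfun_apply (R z) w - blinfun_apply (L z) (blinfun_apply (R z) w) = w)"
    by (intro bchoice ballI neumann_inverse)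
  then obtain R where R: "\<And>z. z \<in> S \<Longrightarrow> norm (R z) \<le> 2"
    "\<And>z w. z \<in> S \<Longrightarrow> blinfun_apply (R z) (w - blinfun_apply (L z) w) = w"
    "\<And>z w. z \<in> S \<Longrightarrow> blinfun_apply (R z) w - blinfun_apply (L z) (blinfun_apply (R z) w) = w"
    by metis
  let ?a' = "\<lambda>z. frechet_derivative a (at z)"
  have a': "(a has_derivative ?a' z) (at z)" if "z \<in> S" for z
    by (rule Ck_on_Suc_has_derivative[OF a that])
  have U': "(U has_derivative (\<lambda>v. blinfun_apply (R z) (?a' z v))) (at z)" if z: "z \<in> S" for z
  proof -
    obtain B1 where B1: "\<forall>\<^sub>F y in at z. norm (a y - a z) \<le> B1 * norm (y - z)"
      using has_derivative_eventually_lipschitz[OF a'[OF z]] by blast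
    have "\<forall>\<^sub>F y in at z. norm (U y - U z) \<le> (2 * B1) * norm (y - z)"
      using B1 eventually_at_in_open'[OF S z]
    proof eventually_elim
      case (elim y)
      then show ?case using lip[OF elim(2) z] by simp
    qed
    from superpose_remainder_has_derivative[OF S z U(1) this]
    have "((\<lambda>y. blinfun_apply K (superpose f (U y) - superpose f (U z) - dsuperpose f (U z) (U y - U z)))
        has_derivative (\<lambda>v. blinfun_apply K 0)) (at z)" (is "(?E has_derivative _) _")
      by (rule bounded_linear.has_derivative[OF blinfun.bounded_linear_right])
    from has_derivative_add[OF has_derivative_diff[OF a'[OF z] has_derivative_const[of "a z"]] this]
    have "((\<lambda>y. (a y - a z) + ?E y) has_derivative ?a' z) (at z)" by simp
    then have "((\<lambda>y. blinfun_apply (R z) ((a y - a z) + ?E y)) has_derivative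
        (\<lambda>v. blinfun_apply (R z) (?a' z v))) (at z)"
      by (rule bounded_linear.has_derivative[OF blinfun.bounded_linear_right])
    from has_derivative_add[OF has_derivative_const[of "U z"] this]
    have "((\<lambda>y. U z + blinfun_apply (R z) ((a y - a z) + ?E y)) has_derivative
        (\<lambda>v. blinfun_apply (R z) (?a' z v))) (at z)" by simp
    then show ?thesis
    proof (rule has_derivative_transform_within_open[OF _ S z])
      fix y assume y: "y \<in> S"
      \<comment> \<open>The difference of the fixed point equations at \<open>y\<close> and
        \<open>z\<close>, with the linear part moved to the left; applying \<open>R z\<close> solves
        it for \<open>U y - U z\<close>.\<close>
      have "(U y - U z) - blinfun_apply (L z) (U y - U z) = (a y - a z) + ?E y"
      proof -
        have K: "blinfun_apply K (superpose f (U y)) = U y - a y" "blinfun_apply K (superpose f (U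
            z)) = U z - a z"
          using U(2)[OF y] U(2)[OF z] by (simp_all add: algebra_simps)
        show ?thesis unfolding L blinfun.diff_right[of K] K by (simp add: algebra_simps)
      qed
      then show "U z + blinfun_apply (R z) ((a y - a z) + ?E y) = U y"
        using R(2)[OF z, of "U y - U z"] by simp
    qed
  qed
  \<comment> \<open>Bootstrapping: if \<open>U\<close> has order \<open>m\<close>, then so do
    \<open>L\<close>, \<open>R\<close> and the derivative of \<open>U\<close>. As \<open>L\<close>
    contains one derivative of \<open>f\<close>, this works for \<open>m \<le> r\<close> and ends at
    \<open>Suc r\<close>.\<close>
  have "Ck_on m U S" if "m \<le> Suc r" for m
    using that
  proof (induction m)
    case 0
    have "continuous_on S U"
      by (intro continuous_at_imp_continuous_on ballI has_derivative_continuous[OF U'])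
    then show ?case by simp
  next
    case (Suc m)
    then have "Ck_on m R S"
      by (intro Ck_on_neumann_inverse[OF S CkL] R) auto
    moreover have "Ck_on m (\<lambda>z. ?a' z v) S" for v
      by (rule Ck_on_mono[of r]) (use a Suc in simp_all)
    ultimately have "Ck_on m (\<lambda>z. blinfun_apply (R z) (?a' z v)) S" for v
      by (intro Ck_on_bilinear[OF bounded_bilinear_blinfun_apply S])
    with U' show ?case by (rule Ck_on_SucI[OF S])
  qed
  then show ?thesis by blast
qed

text \<open>Contraction on the closed set of curves with values in \<open>C\<close>. Smallness of
  \<open>K\<close> bounds the Lipschitz constant but not the location of the image, which is the
  content of \<open>self\<close>.\<close>

lemma ex_fixed_point_superpose:
  fixes f :: "'e::euclidean_space \<Rightarrow> 'e" and a :: "'x::metric_space \<Rightarrow>\<^sub>C 'e"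
    and K :: "('x \<Rightarrow>\<^sub>C 'e) \<Rightarrow>\<^sub>L ('x \<Rightarrow>\<^sub>C 'e)"
  assumes C: "compact C" "convex C" "C \<subseteq> V" "C \<noteq> {}" and f: "Ck_on (Suc 0) f V"
    and B: "\<And>x h. x \<in> C \<Longrightarrow> norm (frechet_derivative f (at x) h) \<le> B * norm h" "B \<ge> 0"
    and K: "norm K * B \<le> 1 / 2"
    and self: "\<And>u s. (\<And>s. apply_bcontfun u s \<in> C) \<Longrightarrow>
      apply_bcontfun (a + blinfun_apply K (superpose f u)) s \<in> C"
  shows "\<exists>u. (\<forall>s. apply_bcontfun u s \<in> C) \<and> u = a + blinfun_apply K (superpose f u)"
proof -
  interpret compact_in_C1 f C V using C f by unfold_locales
  let ?X = "PiC UNIV (\<lambda>_. C) :: ('x \<Rightarrow>\<^sub>C 'e) set"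
  have X: "u \<in> ?X \<longleftrightarrow> (\<forall>s. apply_bcontfun u s \<in> C)" for u by (auto simp: mem_PiC_iff)
  have "closed ?X" using compact by (intro closed_PiC) (simp add: compact_imp_closed)
  then have "complete ?X" by (simp add: complete_eq_closed)
  moreover obtain c where "c \<in> C" using C(4) by blast
  then have "const_bcontfun c \<in> ?X" unfolding X by simp
  moreover have "(\<lambda>u. a + blinfun_apply K (superpose f u)) ` ?X \<subseteq> ?X"
    using self unfolding X image_subset_iff Ball_def by blast
  moreover have "dist (a + blinfun_apply K (superpose f u)) (a + blinfun_apply K (superpose f w))
      \<le> 1 / 2 * dist u w" if "u \<in> ?X" "w \<in> ?X" for u w
  proof -
    have "norm (blinfun_apply K (superpose f u - superpose f w)) \<le> norm K * (B * norm (u - w))"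
      using that unfolding X
      by (intro order_trans[OF norm_blinfun] mult_left_mono norm_superpose_diff_le B) auto
    also have "\<dots> \<le> 1 / 2 * norm (u - w)"
      unfolding mult.assoc[symmetric] by (intro mult_right_mono K) simp
    finally show ?thesis by (simp add: dist_norm blinfun.diff_right)
  qed
  ultimately have "\<exists>!u\<in>?X. a + blinfun_apply K (superpose f u) = u"
    by (intro Banach_fix[where c = "1 / 2"]) auto
  then show ?thesis unfolding X by metis
qed

section \<open>A boundary value problem for second order equations\<close>

text \<open>Antiderivative on \<open>[-1, 2]\<close>, extended by constants. The interval contains the nodes \<open>0\<close> and \<open>1\<close> of
  the boundary value problem in its interior.\<close>

definition antideriv :: "(real \<Rightarrow>\<^sub>C 'e) \<Rightarrow> real \<Rightarrow>\<^sub>C 'e::euclidean_space"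
  where "antideriv h = Bcontfun (\<lambda>s. integral {-1..max (-1) (min 2 s)} (apply_bcontfun h))"

lemma integrable_bcontfun: "(apply_bcontfun (h :: real \<Rightarrow>\<^sub>C 'e::euclidean_space)) integrable_on {a..b}"
  by (intro integrable_continuous_real continuous_on_apply_bcontfun)

lemma
  shows antideriv_apply: "apply_bcontfun (antideriv h) s = integral {-1..max (-1) (min 2 s)}
      (apply_bcontfun h)"
    and norm_antideriv_le: "norm (antideriv h) \<le> norm h * 3"
proof -
  let ?f = "\<lambda>s. integral {-1..max (-1) (min 2 s)} (apply_bcontfun h)"
  have b: "norm (?f s) \<le> norm h * 3" for s
  proof -
    have "norm (?f s) \<le> norm h * (max (-1) (min 2 s) - (-1))"
      by (intro integral_bound continuous_on_apply_bcontfun norm_bounded) simp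
    also have "\<dots> \<le> norm h * 3" by (intro mult_left_mono) auto
    finally show ?thesis .
  qed
  have "continuous_on UNIV ?f"
    by (intro continuous_on_compose2[OF indefinite_integral_continuous_1[OF integrable_bcontfun[of h "-1" 2]]]
        continuous_intros) auto
  then have "?f \<in> bcontfun" using b by (intro bcontfun_normI)
  then show e: "apply_bcontfun (antideriv h) s = ?f s" for s
    by (simp add: antideriv_def Bcontfun_inverse)
  show "norm (antideriv h) \<le> norm h * 3" by (rule norm_bound) (simp only: e b)
qed

lemma bounded_linear_antideriv: "bounded_linear antideriv"
proof (rule bounded_linear_intro)
  show "antideriv (u + v) = antideriv u + antideriv v" for u v :: "real \<Rightarrow>\<^sub>C 'a"
    by (rule bcontfun_eqI) (simp add: antideriv_apply integral_add integrable_bcontfun)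
  show "antideriv (r *\<^sub>R u) = r *\<^sub>R antideriv u" for r and u :: "real \<Rightarrow>\<^sub>C 'a"
    by (rule bcontfun_eqI) (simp add: antideriv_apply)
qed (rule norm_antideriv_le)

lemma antideriv_has_vector_derivative:
  assumes s: "s \<in> {-1<..<2}"
  shows "(apply_bcontfun (antideriv h) has_vector_derivative apply_bcontfun h s) (at s)"
proof -
  have "((\<lambda>u. integral {-1..u} (apply_bcontfun h)) has_vector_derivative apply_bcontfun h s) (at s
      within {-1..2})"
    using s by (intro integral_has_vector_derivative continuous_on_apply_bcontfun) auto
  then have "((\<lambda>u. integral {-1..u} (apply_bcontfun h)) has_vector_derivative apply_bcontfun h s) (at s)"
    using s at_within_interior[of s "{-1..2}"] by simp
  then show ?thesis
    by (rule has_vector_derivative_transform_within_open[OF _ _ s]) (auto simp: antideriv_apply)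
qed

lemma antideriv_const_diff:
  "apply_bcontfun (antideriv (const_bcontfun c)) 1 - apply_bcontfun (antideriv (const_bcontfun c)) 0 = c"
  by (simp add: antideriv_apply scaleR_2)

lemma bounded_linear_eval: "bounded_linear (\<lambda>u :: 'x::topological_space \<Rightarrow>\<^sub>C 'b::real_normed_vector.
    apply_bcontfun u s)"
  by (rule bounded_linear_intro[of _ 1]) (auto simp: norm_bounded)

lemma bounded_linear_const_bcontfun:
  "bounded_linear (const_bcontfun :: 'b::real_normed_vector \<Rightarrow> 'x::topological_space \<Rightarrow>\<^sub>C 'b)"
  by (rule bounded_linear_intro[of _ 1]) (auto intro!: bcontfun_eqI norm_bound)

text \<open>The first component is integrated so as to vanish at 0; the second is integrated and
  then shifted to have mean zero on \<open>[0, 1]\<close>. Added to a constant curve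
  \<open>(y, \<xi>)\<close>, this keeps the position \<open>y\<close> at time 0 and the mean
  velocity \<open>\<xi>\<close> over \<open>[0, 1]\<close>, so both boundary conditions are built
  in.\<close>

definition bvp_operator :: "(real \<Rightarrow>\<^sub>C ('e \<times> 'e)) \<Rightarrow> real \<Rightarrow>\<^sub>C ('e \<times> 'e::euclidean_space)" where
  "bvp_operator h =
     superpose (\<lambda>x. (x, 0)) (antideriv (superpose fst h)
       - const_bcontfun (apply_bcontfun (antideriv (superpose fst h)) 0)) +
     superpose (\<lambda>x. (0, x)) (antideriv (superpose snd h)
       - const_bcontfun (apply_bcontfun (antideriv (antideriv (superpose snd h))) 1
           - apply_bcontfun (antideriv (antideriv (superpose snd h))) 0))"

lemma bounded_linear_inl: "bounded_linear (\<lambda>x. (x, 0))" and bounded_linear_inr: "bounded_linear (\<lambda>x. (0, x))"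
  by (auto intro!: bounded_linear_Pair bounded_linear_ident bounded_linear_zero)

lemma bvp_operator_apply:
  "apply_bcontfun (bvp_operator h) s =
    (apply_bcontfun (antideriv (superpose fst h)) s - apply_bcontfun (antideriv (superpose fst h)) 0,
     apply_bcontfun (antideriv (superpose snd h)) s
       - (apply_bcontfun (antideriv (antideriv (superpose snd h))) 1
           - apply_bcontfun (antideriv (antideriv (superpose snd h))) 0))"
  by (simp add: bvp_operator_def superpose_linear_apply[OF bounded_linear_inl]
      superpose_linear_apply[OF bounded_linear_inr])

lemma bounded_linear_bvp_operator: "bounded_linear bvp_operator"
proof -
  note A = bounded_linear_compose[OF bounded_linear_antideriv]
  note fs = A[OF bounded_linear_superpose[OF bounded_linear_fst]] A[OF bounded_linear_superpose[OF
      bounded_linear_snd]]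
  show ?thesis
    unfolding bvp_operator_def[abs_def]
    by (intro bounded_linear_add bounded_linear_sub
        bounded_linear_compose[OF bounded_linear_superpose[OF bounded_linear_inl]]
        bounded_linear_compose[OF bounded_linear_superpose[OF bounded_linear_inr]]
        bounded_linear_compose[OF bounded_linear_const_bcontfun]
        bounded_linear_compose[OF bounded_linear_eval] A fs)
qed

text \<open>Time is rescaled by \<open>\<epsilon>\<close>: a short solution becomes one on a fixed
  interval, and shortness becomes smallness of the integral operator, which is what the fixed point
  lemmas require.\<close>

lemma ex_second_order_bvp:
  fixes P :: "'e::euclidean_space \<times> 'e \<Rightarrow> 'e"
  assumes V: "open V" "(x0, v0) \<in> V" and P: "Ck_on (Suc r) P V" and \<delta>: "\<delta> > 0"
  shows "\<exists>\<epsilon>>0. \<exists>y S c w. open S \<and> x0 \<in> S \<and>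
    Ck_on (Suc r) (\<lambda>x. w x 0) S \<and> Ck_on (Suc r) (\<lambda>x. w x 1) S \<and>
    (\<forall>x\<in>S. c x 0 = y \<and> c x 1 = x \<and> norm (w x 1 - v0) < \<delta> \<and>
      (\<forall>s\<in>{-1<..<2::real}. (c x s, w x s) \<in> V \<and> (c x has_vector_derivative \<epsilon> *\<^sub>R w x s) (at s) \<and>
         (w x has_vector_derivative \<epsilon> *\<^sub>R P (c x s, w x s)) (at s)))"
proof -
  obtain A1 A2 where A: "open A1" "open A2" "x0 \<in> A1" "v0 \<in> A2" "A1 \<times> A2 \<subseteq> V"
    using V open_prod_def[of V] by (metis mem_Sigma_iff)
  obtain \<rho>1 \<rho>2 where \<rho>: "\<rho>1 > 0" "cball x0 \<rho>1 \<subseteq> A1" "\<rho>2 > 0" "cball v0 \<rho>2 \<subseteq> A2"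
    using A open_contains_cball by metis
  \<comment> \<open>The bound \<open>\<delta> / 2\<close> is for the final velocity, which stays
    within \<open>\<rho>\<close> of \<open>v0\<close>.\<close>
  define \<rho> where "\<rho> = min (min \<rho>1 \<rho>2) (\<delta> / 2)"
  define C where "C = cball x0 \<rho> \<times> cball v0 \<rho>"
  have \<rho>0: "\<rho> > 0" "\<rho> < \<delta>" using \<rho> \<delta> by (auto simp: \<rho>_def)
  have CV: "C \<subseteq> V" using A(5) \<rho> by (auto simp: C_def \<rho>_def subset_iff)
  have C: "compact C" "convex C" "C \<noteq> {}"
    using \<rho>0 by (auto simp: C_def compact_Times convex_Times)
  define \<Phi> where "\<Phi> = (\<lambda>p :: 'e \<times> 'e. (snd p, P p))"
  have \<Phi>: "Ck_on (Suc r) \<Phi> V"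
    unfolding \<Phi>_def by (intro Ck_on_Pair V(1) P Ck_on_bounded_linear bounded_linear_snd)
  have \<Phi>1: "Ck_on (Suc 0) \<Phi> V" by (rule Ck_on_mono[OF \<Phi>]) simp
  interpret \<Phi>: compact_in_C1 \<Phi> C V using C CV \<Phi>1 by unfold_locales
  obtain B where B: "B \<ge> 0" "\<And>x h. x \<in> C \<Longrightarrow> norm (frechet_derivative \<Phi> (at x) h) \<le> B * norm h"
    using \<Phi>.bounded_deriv by metis
  obtain M where M: "M > 0" "\<And>x. x \<in> C \<Longrightarrow> norm (\<Phi> x) \<le> M"
    using compact_imp_bounded[OF compact_continuous_image[OF \<Phi>.cont C(1)]] unfolding bounded_pos by blast
  define K0 :: "(real \<Rightarrow>\<^sub>C ('e \<times> 'e)) \<Rightarrow>\<^sub>L (real \<Rightarrow>\<^sub>C ('e \<times> 'e))" where "K0 = Blinfun bvp_operator"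
  have K0: "blinfun_apply K0 = bvp_operator"
    unfolding K0_def by (rule bounded_linear_Blinfun_apply[OF bounded_linear_bvp_operator])
  \<comment> \<open>Bounds the three quantities that the factor \<open>\<epsilon>\<close> must make
    small: the shift from \<open>x0\<close> to \<open>y\<close>, the size of the integral term, and
    its Lipschitz constant. The summand 1 makes it positive.\<close>
  define Q where "Q = 1 + norm v0 + norm K0 * M + norm K0 * B"
  have Q: "norm v0 \<le> Q" "norm K0 * M \<le> Q" "norm K0 * B \<le> Q" "Q > 0"
    using M(1) B(1) by (auto simp: Q_def add_nonneg_nonneg add_pos_nonneg)
  define \<epsilon> where "\<epsilon> = min (1 / 2) (\<rho> / 2) / Q"
  have \<epsilon>: "\<epsilon> > 0" using \<rho>0 Q(4) by (simp add: \<epsilon>_def)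
  have small: "\<epsilon> * X \<le> min (1 / 2) (\<rho> / 2)" if "X \<le> Q" for X
  proof -
    have "\<epsilon> * X \<le> \<epsilon> * Q" using that \<epsilon> by (intro mult_left_mono) auto
    then show ?thesis using Q(4) by (simp add: \<epsilon>_def)
  qed
  define y where "y = x0 - \<epsilon> *\<^sub>R v0"
  \<comment> \<open>The mean velocity \<open>\<xi> x\<close> equals \<open>v0\<close> at
    \<open>x0\<close> and varies with slope \<open>1 / \<epsilon>\<close>, so this radius keeps it
    within \<open>\<rho> / 2\<close> of \<open>v0\<close>.\<close>
  define S where "S = ball x0 (\<epsilon> * (\<rho> / 2))"
  define \<xi> where "\<xi> x = (1 / \<epsilon>) *\<^sub>R (x - y)" for x
  define a :: "'e \<Rightarrow> real \<Rightarrow>\<^sub>C ('e \<times> 'e)" where "a x = const_bcontfun (y, \<xi> x)" for x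
  define K where "K = \<epsilon> *\<^sub>R K0"
  have S: "open S" "x0 \<in> S" using \<epsilon> \<rho>0 by (auto simp: S_def)
  have a: "Ck_on (Suc r) a S"
    unfolding a_def[abs_def] \<xi>_def
    by (intro Ck_on_bounded_linear_compose[OF bounded_linear_const_bcontfun S(1)] Ck_on_Pair[OF S(1)]
       Ck_on_scaleR[OF S(1)] Ck_on_diff[OF S(1)] Ck_on_const Ck_on_ident)
  have KB: "norm K * B \<le> 1 / 2"
    using small[OF Q(3)] \<epsilon> by (simp add: K_def mult.assoc)
  have \<xi>: "norm (\<xi> x - v0) \<le> \<rho> / 2" if "x \<in> S" for x
  proof -
    have "\<xi> x - v0 = (1 / \<epsilon>) *\<^sub>R (x - x0)" using \<epsilon> by (simp add: \<xi>_def y_def algebra_simps)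
    moreover have "norm (x - x0) < \<epsilon> * (\<rho> / 2)" using that by (simp add: S_def dist_norm norm_minus_commute)
    ultimately show ?thesis using \<epsilon> by (simp add: divide_simps mult.commute)
  qed
  \<comment> \<open>In each component half of the radius \<open>\<rho>\<close> is spent on the
    constant curve and half on the integral term.\<close>
  have self: "apply_bcontfun (a x + blinfun_apply K (superpose \<Phi> u)) s \<in> C"
    if x: "x \<in> S" and u: "\<And>s. apply_bcontfun u s \<in> C" for x u s
  proof -
    have "norm (superpose \<Phi> u) \<le> M"
      by (rule norm_bound) (simp add: superpose_apply[OF C(1) \<Phi>.cont u] M u)
    then have "norm (blinfun_apply K (superpose \<Phi> u)) \<le> norm K * M"
      by (meson norm_blinfun order_trans mult_left_mono norm_ge_zero)
    also have "\<dots> \<le> \<rho> / 2"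
      using small[OF Q(2)] \<epsilon> by (simp add: K_def mult.assoc)
    finally have n: "norm (apply_bcontfun (blinfun_apply K (superpose \<Phi> u)) s) \<le> \<rho> / 2"
      using norm_bounded order_trans by blast
    obtain p q where pq: "apply_bcontfun (blinfun_apply K (superpose \<Phi> u)) s = (p, q)" by fastforce
    have p: "norm p \<le> \<rho> / 2" "norm q \<le> \<rho> / 2"
      using n norm_fst_le[of p q] norm_snd_le[of q p] unfolding pq by linarith+
    have "norm (x0 - (y + p)) \<le> norm (\<epsilon> *\<^sub>R v0) + norm p"
      unfolding y_def using norm_triangle_ineq4[of "\<epsilon> *\<^sub>R v0" p] by simp
    also have "\<dots> \<le> \<rho>" using small[OF Q(1)] \<epsilon> p by simp
    finally have 1: "y + p \<in> cball x0 \<rho>" by (simp add: dist_norm)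
    have "norm (v0 - (\<xi> x + q)) \<le> norm (\<xi> x - v0) + norm q"
      using norm_triangle_ineq4[of "v0 - \<xi> x" q] by (simp add: norm_minus_commute algebra_simps)
    also have "\<dots> \<le> \<rho>" using \<xi>[OF x] p by simp
    finally have 2: "\<xi> x + q \<in> cball v0 \<rho>" by (simp add: dist_norm)
    show ?thesis using 1 2 by (simp add: a_def pq C_def)
  qed
  have "\<exists>u. (\<forall>s. apply_bcontfun u s \<in> C) \<and> u = a x + blinfun_apply K (superpose \<Phi> u)" if "x \<in> S" for x
    by (rule ex_fixed_point_superpose[OF C(1,2) CV C(3) \<Phi>1 B(2,1) KB self[OF that]])
  then obtain U where U: "\<And>x s. x \<in> S \<Longrightarrow> apply_bcontfun (U x) s \<in> C"
    "\<And>x. x \<in> S \<Longrightarrow> U x = a x + blinfun_apply K (superpose \<Phi> (U x))"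
    by metis
  have CkU: "Ck_on (Suc r) U S"
    by (rule Ck_on_fixed_point[OF C(1,2) CV S(1) \<Phi> a B(2,1) KB U])
  define c where "c x s = fst (apply_bcontfun (U x) s)" for x s
  define w where "w x s = snd (apply_bcontfun (U x) s)" for x s
  have cw: "(c x s, w x s) = apply_bcontfun (U x) s" for x s by (simp add: c_def w_def)
  have Ckw: "Ck_on (Suc r) (\<lambda>x. w x s) S" for s
    unfolding w_def
    by (intro Ck_on_bounded_linear_compose[OF bounded_linear_snd S(1)]
        Ck_on_bounded_linear_compose[OF bounded_linear_eval S(1)] CkU)
  have "c x 0 = y \<and> c x 1 = x \<and> norm (w x 1 - v0) < \<delta> \<and>
      (\<forall>s\<in>{-1<..<2::real}. (c x s, w x s) \<in> V \<and> (c x has_vector_derivative \<epsilon> *\<^sub>R w x s) (at s) \<and>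
         (w x has_vector_derivative \<epsilon> *\<^sub>R P (c x s, w x s)) (at s))" if x: "x \<in> S" for x
  proof -
    define h where "h = superpose \<Phi> (U x)"
    define h1 where "h1 = superpose fst h"
    define h2 where "h2 = superpose snd h"
    have h: "apply_bcontfun h1 s = w x s" "apply_bcontfun h2 s = P (c x s, w x s)" for s
      unfolding cw
      by (simp_all add: h1_def h2_def h_def w_def \<Phi>_def[THEN fun_cong] superpose_linear_apply[OF
          bounded_linear_fst]
        superpose_linear_apply[OF bounded_linear_snd] superpose_apply[OF C(1) \<Phi>.cont U(1)[OF x]])
    define k where "k = apply_bcontfun (antideriv (antideriv h2)) 1 - apply_bcontfun (antideriv
        (antideriv h2)) 0"
    have Us: "apply_bcontfun (U x) s = (y, \<xi> x) + \<epsilon> *\<^sub>R apply_bcontfun (bvp_operator h) s" for s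
      by (subst U(2)[OF x]) (simp add: a_def K_def K0 h_def blinfun.scaleR_left)
    have c: "c x s = y + \<epsilon> *\<^sub>R (apply_bcontfun (antideriv h1) s - apply_bcontfun (antideriv h1) 0)"
      and w: "w x s = \<xi> x + \<epsilon> *\<^sub>R (apply_bcontfun (antideriv h2) s - k)" for s
      unfolding c_def w_def Us bvp_operator_apply by (simp_all add: h1_def h2_def k_def)
    note lin = bounded_linear.linear[OF bounded_linear_antideriv]
    \<comment> \<open>\<open>h1\<close> is the velocity component, so integrating its formula gives
      the displacement. Over \<open>[0, 1]\<close> both \<open>antideriv h2\<close> and the constant
      \<open>k\<close> have integral \<open>k\<close>; what remains is
      \<open>\<epsilon> *\<^sub>R \<xi> x = x - y\<close>.\<close>
    have "h1 = const_bcontfun (\<xi> x) + \<epsilon> *\<^sub>R (antideriv h2 - const_bcontfun k)"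
      by (rule bcontfun_eqI) (simp add: h w)
    then have "antideriv h1 = antideriv (const_bcontfun (\<xi> x)) + \<epsilon> *\<^sub>R (antideriv (antideriv h2) -
        antideriv (const_bcontfun k))"
      by (simp only: linear_add[OF lin] linear_cmul[OF lin] linear_diff[OF lin])
    then have e: "apply_bcontfun (antideriv h1) t = apply_bcontfun (antideriv (const_bcontfun (\<xi> x))) t
        + \<epsilon> *\<^sub>R (apply_bcontfun (antideriv (antideriv h2)) t - apply_bcontfun (antideriv
            (const_bcontfun k)) t)" for t
      by simp
    have kd: "apply_bcontfun (antideriv (antideriv h2)) 1 = k + apply_bcontfun (antideriv (antideriv h2)) 0"
      by (simp add: k_def)
    have "apply_bcontfun (antideriv h1) 1 - apply_bcontfun (antideriv h1) 0 =
       (apply_bcontfun (antideriv (const_bcontfun (\<xi> x))) 1 - apply_bcontfun (antideriv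
           (const_bcontfun (\<xi> x))) 0)
       + \<epsilon> *\<^sub>R (k - (apply_bcontfun (antideriv (const_bcontfun k)) 1 - apply_bcontfun (antideriv
           (const_bcontfun k)) 0))"
      unfolding e kd by (simp add: algebra_simps)
    then have "c x 1 = x" unfolding c antideriv_const_diff using \<epsilon> by (simp add: \<xi>_def)
    moreover have "c x 0 = y" by (simp add: c)
    moreover have "w x 1 \<in> cball v0 \<rho>" using U(1)[OF x, of 1] unfolding C_def cw[symmetric] by simp
    then have "norm (w x 1 - v0) < \<delta>" using \<rho>0 by (simp add: dist_norm norm_minus_commute)
    moreover have "(c x s, w x s) \<in> V" for s using U(1)[OF x] CV unfolding cw by blast
    moreover have "(c x has_vector_derivative \<epsilon> *\<^sub>R w x s) (at s)" if "s \<in> {-1<..<2}" for s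
    proof -
      have "((\<lambda>s. y + \<epsilon> *\<^sub>R (apply_bcontfun (antideriv h1) s - apply_bcontfun (antideriv h1) 0))
          has_vector_derivative 0 + \<epsilon> *\<^sub>R (apply_bcontfun h1 s - 0)) (at s)"
        by (intro has_vector_derivative_add has_vector_derivative_const has_vector_derivative_diff
           bounded_linear.has_vector_derivative[OF bounded_linear_scaleR_right]
               antideriv_has_vector_derivative that)
      then show ?thesis unfolding c[abs_def] h by simp
    qed
    moreover have "(w x has_vector_derivative \<epsilon> *\<^sub>R P (c x s, w x s)) (at s)" if "s \<in> {-1<..<2}" for s
    proof -
      have "((\<lambda>s. \<xi> x + \<epsilon> *\<^sub>R (apply_bcontfun (antideriv h2) s - k))
          has_vector_derivative 0 + \<epsilon> *\<^sub>R (apply_bcontfun h2 s - 0)) (at s)"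
        by (intro has_vector_derivative_add has_vector_derivative_const has_vector_derivative_diff
           bounded_linear.has_vector_derivative[OF bounded_linear_scaleR_right]
               antideriv_has_vector_derivative that)
      moreover have "w x = (\<lambda>s. \<xi> x + \<epsilon> *\<^sub>R (apply_bcontfun (antideriv h2) s - k))" using w by blast
      ultimately show ?thesis unfolding h by simp
    qed
    ultimately show ?thesis by blast
  qed
  then show ?thesis using \<epsilon> S Ckw by blast
qed

section \<open>Symmetry of second derivatives\<close>

text \<open>The mean value theorem twice: along \<open>u\<close> for the increment of
  \<open>f\<close> in direction \<open>v\<close>, then along \<open>v\<close> for the derivative in
  direction \<open>u\<close>. The left-hand side is symmetric in \<open>u\<close> and
  \<open>v\<close>.\<close>

lemma second_difference_mvt:
  fixes f :: "'a::euclidean_space \<Rightarrow> real"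
  assumes f: "Ck_on 2 f S" and h: "h > 0"
    and S: "\<And>s t. 0 \<le> s \<Longrightarrow> s \<le> h \<Longrightarrow> 0 \<le> t \<Longrightarrow> t \<le> h \<Longrightarrow> x + s *\<^sub>R u + t *\<^sub>R v \<in> S"
  shows "\<exists>s t. 0 < s \<and> s < h \<and> 0 < t \<and> t < h \<and>
    f (x + h *\<^sub>R u + h *\<^sub>R v) - f (x + h *\<^sub>R u) - (f (x + h *\<^sub>R v) - f x) =
      h * h * frechet_derivative (\<lambda>y. frechet_derivative f (at y) u) (at (x + s *\<^sub>R u + t *\<^sub>R v)) v"
proof -
  let ?D = "\<lambda>y. frechet_derivative f (at y)"
  let ?D2 = "\<lambda>y. frechet_derivative (\<lambda>y. ?D y u) (at y)"
  have f2: "Ck_on (Suc (Suc 0)) f S" using f by (simp add: numeral_2_eq_2)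
  have D: "(f has_derivative ?D y) (at y)" if "y \<in> S" for y
    by (rule Ck_on_Suc_has_derivative[OF f2 that])
  have "Ck_on (Suc 0) (\<lambda>y. ?D y u) S" using f2 by simp
  then have D2: "((\<lambda>y. ?D y u) has_derivative ?D2 y) (at y)" if "y \<in> S" for y
    using that by (rule Ck_on_Suc_has_derivative)
  have line: "((\<lambda>s. x0 + s *\<^sub>R w) has_derivative (\<lambda>r. r *\<^sub>R w)) (at s)" for x0 w :: 'a and s
    by (auto intro!: derivative_eq_intros)
  define \<phi> where "\<phi> s = f (x + h *\<^sub>R v + s *\<^sub>R u) - f (x + s *\<^sub>R u)" for s
  have "(\<phi> has_real_derivative (?D (x + h *\<^sub>R v + s *\<^sub>R u) u - ?D (x + s *\<^sub>R u) u)) (at s)"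
    if s: "0 \<le> s" "s \<le> h" for s
  proof -
    have i: "x + h *\<^sub>R v + s *\<^sub>R u \<in> S" "x + s *\<^sub>R u \<in> S"
      using S[OF s, of h] S[OF s, of 0] h by (simp_all add: algebra_simps)
    have "(\<phi> has_derivative (\<lambda>r. ?D (x + h *\<^sub>R v + s *\<^sub>R u) (r *\<^sub>R u) - ?D (x + s *\<^sub>R u) (r *\<^sub>R u))) (at s)"
      unfolding \<phi>_def[abs_def]
      by (intro has_derivative_diff diff_chain_at[OF line D, unfolded comp_def] i)
    then show ?thesis
      unfolding has_field_derivative_def
      by (rule has_derivative_eq_rhs) (rule ext, simp add: linear_cmul[OF has_derivative_linear[OF
          D[OF i(1)]]]
          linear_cmul[OF has_derivative_linear[OF D[OF i(2)]]] right_diff_distrib left_diff_distrib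
              mult.commute)
  qed
  from MVT2[OF h, of \<phi>, OF this] obtain s where s: "0 < s" "s < h"
    "\<phi> h - \<phi> 0 = h * (?D (x + h *\<^sub>R v + s *\<^sub>R u) u - ?D (x + s *\<^sub>R u) u)" by auto
  define \<psi> where "\<psi> t = ?D (x + s *\<^sub>R u + t *\<^sub>R v) u" for t
  have "(\<psi> has_real_derivative ?D2 (x + s *\<^sub>R u + t *\<^sub>R v) v) (at t)" if t: "0 \<le> t" "t \<le> h" for t
  proof -
    have i: "x + s *\<^sub>R u + t *\<^sub>R v \<in> S" using S[of s t] s t by simp
    have "(\<psi> has_derivative (\<lambda>r. ?D2 (x + s *\<^sub>R u + t *\<^sub>R v) (r *\<^sub>R v))) (at t)"
      unfolding \<psi>_def[abs_def] by (rule diff_chain_at[OF line D2, unfolded comp_def]) (rule i)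
    then show ?thesis
      unfolding has_field_derivative_def
      by (rule has_derivative_eq_rhs) (rule ext, simp add: linear_cmul[OF has_derivative_linear[OF
          D2[OF i]]] mult.commute)
  qed
  from MVT2[OF h, of \<psi>, OF this] obtain t where t: "0 < t" "t < h"
    "\<psi> h - \<psi> 0 = h * ?D2 (x + s *\<^sub>R u + t *\<^sub>R v) v" by auto
  have "f (x + h *\<^sub>R u + h *\<^sub>R v) - f (x + h *\<^sub>R u) - (f (x + h *\<^sub>R v) - f x) = \<phi> h - \<phi> 0"
    by (simp add: \<phi>_def algebra_simps)
  also have "\<dots> = h * (\<psi> h - \<psi> 0)" unfolding s(3) by (simp add: \<psi>_def algebra_simps)
  finally show ?thesis unfolding t(3) using s t by (auto simp: mult.assoc)
qed

text \<open>The same second difference is written with either order of differentiation. The two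
  intermediate points differ, but both tend to \<open>x\<close> and the second derivatives are
  continuous.\<close>

lemma second_derivative_symmetric_real:
  fixes f :: "'a::euclidean_space \<Rightarrow> real"
  assumes S: "open S" "x \<in> S" and f: "Ck_on 2 f S"
  shows "frechet_derivative (\<lambda>y. frechet_derivative f (at y) u) (at x) v =
    frechet_derivative (\<lambda>y. frechet_derivative f (at y) v) (at x) u"
proof -
  define D2 where "D2 u v y = frechet_derivative (\<lambda>y. frechet_derivative f (at y) u) (at y) v" for u v y
  have "Ck_on (Suc (Suc 0)) f S" using f by (simp add: numeral_2_eq_2)
  then have cont: "continuous_on S (D2 u v)" for u v by (simp add: D2_def[abs_def])
  have "\<bar>D2 u v x - D2 v u x\<bar> < e" if e: "e > 0" for e
  proof -
    have "\<exists>\<delta>>0. \<forall>y\<in>S. dist y x < \<delta> \<longrightarrow> dist (D2 u v y) (D2 u v x) < e / 2" for u v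
      using cont[of u v] S(2) e unfolding continuous_on_iff by (metis half_gt_zero)
    then obtain \<delta>1 \<delta>2 where \<delta>1: "\<delta>1 > 0" "\<And>y. y \<in> S \<Longrightarrow> dist y x < \<delta>1 \<Longrightarrow> dist (D2 u v y) (D2 u v x) < e / 2"
      and \<delta>2: "\<delta>2 > 0" "\<And>y. y \<in> S \<Longrightarrow> dist y x < \<delta>2 \<Longrightarrow> dist (D2 v u y) (D2 v u x) < e / 2"
      by metis
    obtain \<delta>3 where \<delta>3: "\<delta>3 > 0" "ball x \<delta>3 \<subseteq> S" using S open_contains_ball by blast
    define \<delta> where "\<delta> = min \<delta>1 (min \<delta>2 \<delta>3)"
    \<comment> \<open>Small enough for the parallelogram spanned by \<open>h *\<^sub>R u\<close> and
      \<open>h *\<^sub>R v\<close> to stay in the ball of radius \<open>\<delta>\<close> around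
      \<open>x\<close>.\<close>
    define h where "h = \<delta> / (2 * (1 + norm u + norm v))"
    have p: "1 + norm u + norm v > 0" by (simp add: add_pos_nonneg)
    have h: "h > 0" using \<delta>1 \<delta>2 \<delta>3 p by (simp add: h_def \<delta>_def)
    have near: "dist (x + s *\<^sub>R u' + t *\<^sub>R v') x < \<delta>"
      if "0 \<le> s" "s \<le> h" "0 \<le> t" "t \<le> h" "{u', v'} = {u, v}" for s t u' v'
    proof -
      have "dist (x + s *\<^sub>R u' + t *\<^sub>R v') x \<le> norm (s *\<^sub>R u') + norm (t *\<^sub>R v')"
        by (simp add: dist_norm add.assoc del: norm_scaleR) (rule norm_triangle_ineq)
      also have "\<dots> \<le> h * norm u' + h * norm v'"
        using that by (intro add_mono) (auto intro: mult_right_mono)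
      also have "\<dots> < h * (2 * (1 + norm u + norm v))"
      proof -
        have "norm u' + norm v' = norm u + norm v" using that(5) by (auto simp: doubleton_eq_iff)
        moreover have "0 \<le> norm u + norm v" by simp
        ultimately have "norm u' + norm v' < 2 * (1 + norm u + norm v)" unfolding distrib_left by linarith
        from mult_strict_left_mono[OF this h] show ?thesis by (simp add: distrib_left)
      qed
      finally show ?thesis using p by (simp add: h_def)
    qed
    have in_S: "x + s *\<^sub>R u' + t *\<^sub>R v' \<in> S"
      if "0 \<le> s" "s \<le> h" "0 \<le> t" "t \<le> h" "{u', v'} = {u, v}" for s t u' v'
      using near[OF that] \<delta>3(2) by (auto simp: \<delta>_def dist_commute)
    obtain s t where st: "0 < s" "s < h" "0 < t" "t < h"
      "f (x + h *\<^sub>R u + h *\<^sub>R v) - f (x + h *\<^sub>R u) - (f (x + h *\<^sub>R v) - f x) = h * h * D2 u v (x + s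
          *\<^sub>R u + t *\<^sub>R v)"
      using second_difference_mvt[OF f h in_S, of u v] unfolding D2_def by auto
    obtain s' t' where st': "0 < s'" "s' < h" "0 < t'" "t' < h"
      "f (x + h *\<^sub>R v + h *\<^sub>R u) - f (x + h *\<^sub>R v) - (f (x + h *\<^sub>R u) - f x) = h * h * D2 v u (x +
          s' *\<^sub>R v + t' *\<^sub>R u)"
      using second_difference_mvt[OF f h in_S, of v u] unfolding D2_def by auto
    have "h * h * D2 u v (x + s *\<^sub>R u + t *\<^sub>R v) = h * h * D2 v u (x + s' *\<^sub>R v + t' *\<^sub>R u)"
      unfolding st(5)[symmetric] st'(5)[symmetric] by (simp add: algebra_simps)
    then have "D2 u v (x + s *\<^sub>R u + t *\<^sub>R v) = D2 v u (x + s' *\<^sub>R v + t' *\<^sub>R u)" using h by simp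
    moreover have "dist (D2 u v (x + s *\<^sub>R u + t *\<^sub>R v)) (D2 u v x) < e / 2"
      using near[of s t u v] in_S[of s t u v] st by (intro \<delta>1(2)) (auto simp: \<delta>_def)
    moreover have "dist (D2 v u (x + s' *\<^sub>R v + t' *\<^sub>R u)) (D2 v u x) < e / 2"
      using near[of s' t' v u] in_S[of s' t' v u] st' by (intro \<delta>2(2)) (auto simp: \<delta>_def)
    ultimately show ?thesis unfolding dist_real_def by linarith
  qed
  then have "D2 u v x = D2 v u x" by (metis abs_not_less_zero less_irrefl zero_less_abs_iff right_minus_eq)
  then show ?thesis by (simp add: D2_def)
qed

lemma second_derivative_symmetric:
  fixes f :: "'a::euclidean_space \<Rightarrow> 'b::euclidean_space"
  assumes S: "open S" "x \<in> S" and f: "Ck_on 2 f S"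
  shows "frechet_derivative (\<lambda>y. frechet_derivative f (at y) u) (at x) v =
    frechet_derivative (\<lambda>y. frechet_derivative f (at y) v) (at x) u"
proof (rule euclidean_eqI)
  fix b :: 'b assume "b \<in> Basis"
  let ?g = "\<lambda>y. f y \<bullet> b"
  have g: "Ck_on 2 ?g S" by (rule Ck_on_bounded_linear_compose[OF bounded_linear_inner_left S(1) f])
  have f2: "Ck_on (Suc (Suc 0)) f S" using f by (simp add: numeral_2_eq_2)
  have D: "frechet_derivative ?g (at y) w = frechet_derivative f (at y) w \<bullet> b" if "y \<in> S" for y w
    using frechet_derivative_at[OF bounded_linear.has_derivative[OF bounded_linear_inner_left
          Ck_on_Suc_has_derivative[OF f2 that]], of b] by metis
  have D2: "frechet_derivative (\<lambda>y. frechet_derivative ?g (at y) w) (at x) =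
      (\<lambda>w'. frechet_derivative (\<lambda>y. frechet_derivative f (at y) w) (at x) w' \<bullet> b)" for w
  proof -
    have "Ck_on (Suc 0) (\<lambda>y. frechet_derivative f (at y) w) S" using f2 by simp
    from bounded_linear.has_derivative[OF bounded_linear_inner_left Ck_on_Suc_has_derivative[OF this
        S(2)], of b]
    have "((\<lambda>y. frechet_derivative ?g (at y) w) has_derivative
       (\<lambda>w'. frechet_derivative (\<lambda>y. frechet_derivative f (at y) w) (at x) w' \<bullet> b)) (at x)"
      by (rule has_derivative_transform_within_open[OF _ S]) (simp add: D)
    then show ?thesis using frechet_derivative_at by metis
  qed
  show "frechet_derivative (\<lambda>y. frechet_derivative f (at y) u) (at x) v \<bullet> b =
      frechet_derivative (\<lambda>y. frechet_derivative f (at y) v) (at x) u \<bullet> b"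
    using second_derivative_symmetric_real[OF S g, of u v] unfolding D2 .
qed

section \<open>Geodesics in different charts\<close>

lemma bounded_bilinear_matrix_vector_mult:
  "bounded_bilinear ((*v) :: real^'n^'m \<Rightarrow> real^'n \<Rightarrow> real^'m)"
  unfolding bilinear_conv_bounded_bilinear[symmetric] bilinear_def
  by (auto intro!: linearI simp: matrix_vector_mult_add_rdistrib matrix_vector_right_distrib
      scaleR_matrix_vector_assoc matrix_vector_mult_scaleR)

text \<open>The Euler--Lagrange form of the geodesic equation for a curve with velocity \<open>v\<close> and acceleration \<open>a\<close>,
  where \<open>G\<close> is the value and \<open>DG\<close> the derivative of the metric. Unlike the one with Christoffel symbols
  it is easily transformed to other charts.\<close>

definition geodesic_eq :: "real^'n^'n \<Rightarrow> (real^'n \<Rightarrow> real^'n^'n) \<Rightarrow> real^'n \<Rightarrow> real^'n \<Rightarrow> bool" where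
  "geodesic_eq G DG v a \<longleftrightarrow> (\<forall>u. u \<bullet> (G *v a) + u \<bullet> (DG v *v v) = (v \<bullet> (DG u *v v)) / 2)"

lemma linear_axis_expansion:
  fixes T :: "real^'n \<Rightarrow> 'b::real_vector"
  assumes "linear T" shows "T h = (\<Sum>j\<in>UNIV. (h $ j) *\<^sub>R T (axis j 1))"
proof -
  have "T h = T (\<Sum>j\<in>UNIV. (h $ j) *\<^sub>R axis j 1)"
    using basis_expansion[of h] by (simp add: scalar_mult_eq_scaleR)
  then show ?thesis by (simp add: linear_sum[OF assms] linear_cmul[OF assms])
qed

text \<open>Since the test vector \<open>u\<close> is arbitrary, the Euler--Lagrange form says
  \<open>G a + E = 0\<close>, which is solved for \<open>a\<close> by inverting the metric.\<close>

lemma geodesic_eq_iff_christoffel: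
  fixes G :: "real^'n \<Rightarrow> real^'n^'n"
  assumes G: "(G has_derivative DG) (at x)" and inv: "invertible (G x)"
  shows "geodesic_eq (G x) DG v a \<longleftrightarrow>
    a = (\<chi> i. - (\<Sum>j\<in>UNIV. \<Sum>k\<in>UNIV. christoffel G i j k x * v $ j * v $ k))"
proof -
  have lin: "linear DG" using G has_derivative_linear by blast
  \<comment> \<open>The Christoffel symbols with lowered first index, contracted twice with
    \<open>v\<close>.\<close>
  define E :: "real^'n" where "E = (\<chi> l. (DG v *v v) $ l - (v \<bullet> (DG (axis l 1) *v v)) / 2)"
  have "linear (\<lambda>u. v \<bullet> (DG u *v v))"
    by (intro linearI) (simp_all add: linear_add[OF lin] linear_cmul[OF lin]
        matrix_vector_mult_add_rdistrib inner_add_right scaleR_matrix_vector_assoc[symmetric])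
  note ax = linear_axis_expansion[OF this]
  have "u \<bullet> E = u \<bullet> (DG v *v v) - (v \<bullet> (DG u *v v)) / 2" for u
    by (subst ax) (simp add: E_def inner_vec_def[of u] right_diff_distrib sum_subtractf sum_divide_distrib)
  then have "u \<bullet> (G x *v a + E) = u \<bullet> (G x *v a) + u \<bullet> (DG v *v v) - (v \<bullet> (DG u *v v)) / 2" for u
    by (simp add: inner_add_right)
  then have "geodesic_eq (G x) DG v a \<longleftrightarrow> (\<forall>u. u \<bullet> (G x *v a + E) = 0)"
    by (simp add: geodesic_eq_def)
  also have "\<dots> \<longleftrightarrow> G x *v a + E = 0"
    by (auto dest: spec[of _ "G x *v a + E"])
  also have "\<dots> \<longleftrightarrow> a = - (matrix_inv (G x) *v E)"
  proof
    assume "G x *v a + E = 0"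
    then have "G x *v a = - E" by (rule eq_neg_iff_add_eq_0[THEN iffD2])
    then have "matrix_inv (G x) *v (G x *v a) = matrix_inv (G x) *v (- E)" by (simp only:)
    then show "a = - (matrix_inv (G x) *v E)"
      using bounded_bilinear.minus_right[OF bounded_bilinear_matrix_vector_mult, of "matrix_inv (G x)" E]
      by (simp add: matrix_vector_mul_assoc matrix_inv_left[OF inv])
  next
    assume "a = - (matrix_inv (G x) *v E)"
    then show "G x *v a + E = 0"
      using bounded_bilinear.minus_right[OF bounded_bilinear_matrix_vector_mult, of "G x"
          "matrix_inv (G x) *v E"]
      by (simp add: matrix_vector_mul_assoc matrix_inv_right[OF inv])
  qed
  also have "matrix_inv (G x) *v E = (\<chi> i. \<Sum>j\<in>UNIV. \<Sum>k\<in>UNIV. christoffel G i j k x * v $ j * v $ k)"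
  proof (rule vec_eq_iff[THEN iffD2], rule allI)
    fix i
    define p where "p j l k = DG (axis j 1) $ l $ k" for j l k
    have pd: "partial_deriv j (\<lambda>y. G y $ l $ k) x = p j l k" for j l k
    proof -
      have "((\<lambda>y. G y $ l $ k) has_derivative (\<lambda>h. DG h $ l $ k)) (at x)"
        by (intro bounded_linear.has_derivative[OF bounded_linear_vec_nth] G)
      then show ?thesis
        using frechet_derivative_at unfolding partial_deriv_def p_def by metis
    qed
    have DGv: "(DG v *v v) $ l = (\<Sum>j\<in>UNIV. \<Sum>k\<in>UNIV. p j l k * v $ j * v $ k)" for l
    proof -
      have "(DG v *v v) $ l = (\<Sum>k\<in>UNIV. (\<Sum>j\<in>UNIV. v $ j * p j l k) * v $ k)"
        by (subst linear_axis_expansion[OF lin]) (simp add: matrix_vector_mult_def p_def)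
      also have "\<dots> = (\<Sum>k\<in>UNIV. \<Sum>j\<in>UNIV. p j l k * v $ j * v $ k)"
        by (simp add: sum_distrib_left mult_ac)
      also have "\<dots> = (\<Sum>j\<in>UNIV. \<Sum>k\<in>UNIV. p j l k * v $ j * v $ k)" by (rule sum.swap)
      finally show ?thesis .
    qed
    have "(\<Sum>j\<in>UNIV. \<Sum>k\<in>UNIV. christoffel G i j k x * v $ j * v $ k) =
       (\<Sum>j\<in>UNIV. \<Sum>k\<in>UNIV. \<Sum>l\<in>UNIV. matrix_inv (G x) $ i $ l * ((p j l k + p k l j - p l j k) / 2 * v
           $ j * v $ k))"
      by (simp add: christoffel_def pd sum_divide_distrib sum_distrib_right mult.assoc)
    also have "\<dots> = (\<Sum>l\<in>UNIV. \<Sum>j\<in>UNIV. \<Sum>k\<in>UNIV. matrix_inv (G x) $ i $ l * ((p j l k + p k l j - p l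
        j k) / 2 * v $ j * v $ k))"
      by (rule trans[OF sum.cong[OF refl sum.swap] sum.swap])
    also have "\<dots> = (\<Sum>l\<in>UNIV. matrix_inv (G x) $ i $ l * E $ l)"
    proof (rule sum.cong[OF refl])
      fix l
      have DGl: "v \<bullet> (DG (axis l 1) *v v) = (\<Sum>j\<in>UNIV. \<Sum>k\<in>UNIV. p l j k * v $ j * v $ k)"
        by (simp add: inner_vec_def matrix_vector_mult_def p_def sum_distrib_left mult_ac)
      \<comment> \<open>Contracted with \<open>v $ j * v $ k\<close>, the first two terms of the
        Christoffel symbol coincide; this is why \<open>E\<close> has the factor
        \<open>1 / 2\<close> only in its second term.\<close>
      have sw: "(\<Sum>j\<in>UNIV. \<Sum>k\<in>UNIV. p k l j * v $ j * v $ k) = (\<Sum>j\<in>UNIV. \<Sum>k\<in>UNIV. p j l k * v $ j * v $ k)"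
        by (rule trans[OF sum.swap]) (simp add: mult_ac)
      have "(\<Sum>j\<in>UNIV. \<Sum>k\<in>UNIV. (p j l k + p k l j - p l j k) / 2 * v $ j * v $ k) =
         ((\<Sum>j\<in>UNIV. \<Sum>k\<in>UNIV. p j l k * v $ j * v $ k) + (\<Sum>j\<in>UNIV. \<Sum>k\<in>UNIV. p k l j * v $ j * v $ k)
          - (\<Sum>j\<in>UNIV. \<Sum>k\<in>UNIV. p l j k * v $ j * v $ k)) / 2"
        by (simp add: sum.distrib[symmetric] sum_subtractf[symmetric] sum_divide_distrib
            algebra_simps add_divide_distrib diff_divide_distrib)
      also have "\<dots> = E $ l" unfolding sw by (simp add: E_def DGv DGl field_simps)
      finally show "(\<Sum>j\<in>UNIV. \<Sum>k\<in>UNIV. matrix_inv (G x) $ i $ l * ((p j l k + p k l j - p l j k) / 2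
          * v $ j * v $ k))
          = matrix_inv (G x) $ i $ l * E $ l"
        by (simp only: sum_distrib_left[symmetric])
    qed
    finally show "(matrix_inv (G x) *v E) $ i =
       (\<chi> i. \<Sum>j\<in>UNIV. \<Sum>k\<in>UNIV. christoffel G i j k x * v $ j * v $ k) $ i"
      by (simp add: matrix_vector_mult_def)
  qed
  finally show ?thesis by (simp add: vec_eq_iff)
qed


text \<open>\<open>trans\<close> says that \<open>G\<close> is the pullback of \<open>G'\<close> by
  \<open>\<tau>\<close>. Its derivative \<open>key\<close> contains second derivatives of
  \<open>\<tau>\<close>: one of them is matched by the correction to the acceleration, the others
  cancel by symmetry of \<open>G'\<close> and of second derivatives. Surjectivity of
  \<open>J x\<close> makes the test vectors \<open>J x u\<close> exhaust all directions.\<close>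

lemma geodesic_eq_transform:
  fixes G G' :: "real^'n \<Rightarrow> real^'n^'n" and \<tau> :: "real^'n \<Rightarrow> real^'n"
  defines "J \<equiv> \<lambda>y. frechet_derivative \<tau> (at y)"
  assumes S: "open S" "x \<in> S" and \<tau>: "Ck_on 2 \<tau> S"
    and G: "(G has_derivative DG) (at x)" and G': "(G' has_derivative DG') (at (\<tau> x))"
    and trans: "\<And>y p q. y \<in> S \<Longrightarrow> p \<bullet> (G y *v q) = J y p \<bullet> (G' (\<tau> y) *v J y q)"
    and sym: "transpose (G' (\<tau> x)) = G' (\<tau> x)" and surj: "surj (J x)"
    and geo: "geodesic_eq (G x) DG v a"
  shows "geodesic_eq (G' (\<tau> x)) DG' (J x v) (J x a + frechet_derivative (\<lambda>y. J y v) (at x) v)"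
proof -
  note mv = bounded_bilinear_matrix_vector_mult
  have \<tau>2: "Ck_on (Suc (Suc 0)) \<tau> S" using \<tau> by (simp add: numeral_2_eq_2)
  define D2 where "D2 h w = frechet_derivative (\<lambda>y. J y w) (at x) h" for h w
  have D\<tau>: "(\<tau> has_derivative J x) (at x)"
    unfolding J_def by (rule Ck_on_Suc_has_derivative[OF \<tau>2 S(2)])
  have DJ: "((\<lambda>y. J y w) has_derivative (\<lambda>h. D2 h w)) (at x)" for w
  proof -
    have "Ck_on (Suc 0) (\<lambda>y. J y w) S" using \<tau>2 by (simp add: J_def)
    from Ck_on_Suc_has_derivative[OF this S(2)] show ?thesis by (simp add: D2_def)
  qed
  have sym2: "D2 h w = D2 w h" for h w
    unfolding D2_def J_def by (rule second_derivative_symmetric[OF S \<tau>])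
  let ?H = "G' (\<tau> x)"
  have swap: "p \<bullet> (?H *v q) = q \<bullet> (?H *v p)" for p q
    by (metis dot_lmul_matrix inner_commute sym transpose_matrix_vector)
  have key: "p \<bullet> (DG h *v q) = J x p \<bullet> (?H *v D2 h q + DG' (J x h) *v J x q) + D2 h p \<bullet> (?H *v J x
      q)" for p q h
  proof -
    have "((\<lambda>y. p \<bullet> (G y *v q)) has_derivative (\<lambda>h. p \<bullet> (DG h *v q))) (at x)"
      by (intro bounded_linear.has_derivative[OF bounded_linear_inner_right]
          bounded_linear.has_derivative[OF bounded_bilinear.bounded_linear_left[OF mv]] G)
    moreover have "((\<lambda>y. J y p \<bullet> (G' (\<tau> y) *v J y q)) has_derivative
        (\<lambda>h. J x p \<bullet> (?H *v D2 h q + DG' (J x h) *v J x q) + D2 h p \<bullet> (?H *v J x q))) (at x)"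
      by (intro bounded_bilinear.FDERIV[OF bounded_bilinear_inner] bounded_bilinear.FDERIV[OF mv] DJ
          diff_chain_at[OF D\<tau> G', unfolded comp_def])
    then have "((\<lambda>y. p \<bullet> (G y *v q)) has_derivative
        (\<lambda>h. J x p \<bullet> (?H *v D2 h q + DG' (J x h) *v J x q) + D2 h p \<bullet> (?H *v J x q))) (at x)"
      by (rule has_derivative_transform_within_open[OF _ S]) (simp add: trans)
    ultimately show ?thesis using has_derivative_unique by (metis (no_types, lifting))
  qed
  have "J x u \<bullet> (?H *v (J x a + D2 v v)) + J x u \<bullet> (DG' (J x v) *v J x v) = (J x v \<bullet> (DG' (J x u) *v
      J x v)) / 2" for u
  proof -
    have "u \<bullet> (G x *v a) + u \<bullet> (DG v *v v) = (v \<bullet> (DG u *v v)) / 2"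
      using geo unfolding geodesic_eq_def by blast
    then show ?thesis
      unfolding key trans[OF S(2)] inner_add_right matrix_vector_right_distrib
      using swap[of "D2 v u" "J x v"] swap[of "D2 u v" "J x v"] sym2[of u v] by (simp add: field_simps)
  qed
  then show ?thesis
    unfolding geodesic_eq_def D2_def using surj by (metis surjD)
qed

text \<open>\<open>J (x s) (v s)\<close> is the velocity of the image curve; this is its
  acceleration, in the form used by \<open>geodesic_eq_transform\<close>.\<close>

lemma deriv_along_curve_has_vector_derivative:
  fixes \<tau> :: "'a::euclidean_space \<Rightarrow> 'b::euclidean_space"
  defines "J \<equiv> \<lambda>y. frechet_derivative \<tau> (at y)"
  assumes S: "open S" "x t \<in> S" and \<tau>: "Ck_on 2 \<tau> S"
    and x: "(x has_vector_derivative v t) (at t)" and v: "(v has_vector_derivative a) (at t)"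
    and T: "open T" "t \<in> T" "\<And>s. s \<in> T \<Longrightarrow> x s \<in> S"
  shows "((\<lambda>s. J (x s) (v s)) has_vector_derivative
      (J (x t) a + frechet_derivative (\<lambda>y. J y (v t)) (at (x t)) (v t))) (at t)"
proof -
  have \<tau>2: "Ck_on (Suc (Suc 0)) \<tau> S" using \<tau> by (simp add: numeral_2_eq_2)
  define D2 where "D2 h w = frechet_derivative (\<lambda>y. J y w) (at (x t)) h" for h w
  have lin: "linear (J y)" if "y \<in> S" for y
    unfolding J_def by (rule has_derivative_linear[OF Ck_on_Suc_has_derivative[OF \<tau>2 that]])
  have DJ: "((\<lambda>y. J y w) has_derivative (\<lambda>h. D2 h w)) (at (x t))" for w
  proof -
    have "Ck_on (Suc 0) (\<lambda>y. J y w) S" using \<tau>2 by (simp add: J_def)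
    from Ck_on_Suc_has_derivative[OF this S(2)] show ?thesis by (simp add: D2_def)
  qed
  have sym2: "D2 h w = D2 w h" for h w
    unfolding D2_def J_def by (rule second_derivative_symmetric[OF S \<tau>])
  have lin2: "linear (D2 h)" for h
  proof -
    have "D2 h = (\<lambda>h'. D2 h' h)" using sym2 by blast
    then show ?thesis using has_derivative_linear[OF DJ[of h]] by (simp only:)
  qed
  have "((\<lambda>s. J (x s) b) has_vector_derivative D2 (v t) b) (at t)" for b
    using vector_derivative_diff_chain_within[of x "v t" t UNIV "\<lambda>y. J y b" "\<lambda>h. D2 h b"] x
      has_derivative_at_withinI[OF DJ[of b]] by (simp add: comp_def)
  \<comment> \<open>Expanding \<open>v s\<close> in a basis reduces the claim to the directional
    derivatives of \<open>\<tau>\<close> in fixed directions.\<close>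
  then have "((\<lambda>s. \<Sum>b\<in>Basis. (v s \<bullet> b) *\<^sub>R J (x s) b) has_vector_derivative
      (\<Sum>b\<in>Basis. (v t \<bullet> b) *\<^sub>R D2 (v t) b + (a \<bullet> b) *\<^sub>R J (x t) b)) (at t)"
    by (intro has_vector_derivative_sum bounded_bilinear.has_vector_derivative[OF bounded_bilinear_scaleR]
        bounded_linear.has_vector_derivative[OF bounded_linear_inner_left] v)
  also have "(\<Sum>b\<in>Basis. (v t \<bullet> b) *\<^sub>R D2 (v t) b + (a \<bullet> b) *\<^sub>R J (x t) b) = J (x t) a + D2 (v t) (v t)"
    using linear_basis_expansion[OF lin2, of "v t" "v t"] linear_basis_expansion[OF lin[OF S(2)], of a]
    by (simp add: sum.distrib)
  finally show ?thesis
    unfolding D2_def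
    by (rule has_vector_derivative_transform_within_open[OF _ T(1,2)])
       (use linear_basis_expansion[OF lin[OF T(3)]] in simp)
qed


section \<open>From solutions in one chart to geodesics of the manifold\<close>

lemma topspace_chart: "is_chart M c \<Longrightarrow> fst c \<subseteq> topspace M"
  using openin_subset unfolding is_chart_def by blast

lemma continuous_map_chart_inv:
  assumes c: "is_chart M c"
  shows "continuous_map (top_of_set (coord_image c)) M (chart_inv c)"
proof -
  have "homeomorphic_map (subtopology M (fst c)) (top_of_set (coord_image c)) (snd c)"
    using c unfolding is_chart_def by blast
  then obtain h where h: "homeomorphic_maps (subtopology M (fst c)) (top_of_set (coord_image c)) (snd c) h"
    unfolding homeomorphic_map_maps by blast
  have ts: "topspace (subtopology M (fst c)) = fst c" using topspace_chart[OF c] by auto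
  have inv: "h y = chart_inv c y" if "y \<in> coord_image c" for y
  proof -
    obtain q where q: "q \<in> fst c" "y = snd c q" using \<open>y \<in> coord_image c\<close> by blast
    then have "h y = q" using h ts unfolding homeomorphic_maps_def by simp
    then show ?thesis using chart_inv[OF c q(1)] q(2) by simp
  qed
  have "continuous_map (top_of_set (coord_image c)) (subtopology M (fst c)) h"
    using h unfolding homeomorphic_maps_def by blast
  then have "continuous_map (top_of_set (coord_image c)) (subtopology M (fst c)) (chart_inv c)"
    by (rule continuous_map_eq) (simp only: topspace_euclidean_subtopology inv)
  then show ?thesis by (rule continuous_map_into_fulltopology)
qed

lemma Ck_metric_has_derivative:
  assumes g: "Ck_metric (Suc k) A g" and c: "c \<in> A" "is_chart M c" and y: "y \<in> coord_image c"
  shows "(g c has_derivative frechet_derivative (g c) (at y)) (at y)"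
proof -
  have o: "open (coord_image c)" using c(2) unfolding is_chart_def by blast
  have "Ck_on (Suc k) (g c) (coord_image c)"
    by (rule Ck_on_vecI[OF o], rule Ck_on_vecI[OF o])
       (use g c in \<open>auto simp: Ck_metric_def simp del: Ck_on.simps\<close>)
  then show ?thesis using y by (rule Ck_on_Suc_has_derivative)
qed


text \<open>The hypotheses of \<open>geodesic_eq_transform\<close> for a change of charts.
  Surjectivity holds because the Jacobian of the reverse transition is a right inverse.\<close>

lemma metric_transition:
  assumes M: "smooth_manifold M A" and g: "is_metric A g" and c: "c \<in> A" "c' \<in> A"
    and y: "y \<in> snd c ` (fst c \<inter> fst c')"
  shows "p \<bullet> (g c y *v q) = frechet_derivative (transition c c') (at y) p \<bullet>
    (g c' (transition c c' y) *v frechet_derivative (transition c c') (at y) q)"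
    and "surj (frechet_derivative (transition c c') (at y))"
    and "transition c c' y \<in> coord_image c'"
proof -
  obtain a where a: "a \<in> fst c" "a \<in> fst c'" "y = snd c a" using y by blast
  have ch: "is_chart M c" using M c by (auto simp: smooth_manifold_def)
  let ?J = "transition_jacobian c c' a"
  have \<tau>y: "transition c c' y = snd c' a" using chart_inv[OF ch a(1)] a(3) by simp
  then show "transition c c' y \<in> coord_image c'" using a(2) by auto
  have J: "frechet_derivative (transition c c') (at y) = (\<lambda>h. ?J *v h)"
    using frechet_derivative_at[OF transition_has_derivative[OF M c, of a]] a by simp
  have "g c y = transpose ?J ** g c' (snd c' a) ** ?J"
    using g c a unfolding is_metric_def by blast
  then have "p \<bullet> (g c y *v q) = p \<bullet> (transpose ?J *v (g c' (snd c' a) *v (?J *v q)))"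
    by (simp only: matrix_vector_mul_assoc matrix_mul_assoc)
  also have "\<dots> = (?J *v p) \<bullet> (g c' (snd c' a) *v (?J *v q))"
    by (simp only: inner_commute[of p] transpose_matrix_vector dot_lmul_matrix) (rule inner_commute)
  finally show "p \<bullet> (g c y *v q) = frechet_derivative (transition c c') (at y) p \<bullet>
    (g c' (transition c c' y) *v frechet_derivative (transition c c') (at y) q)"
    unfolding J \<tau>y .
  have "?J ** transition_jacobian c' c a = mat 1"
    using transition_jacobian_cocycle[OF M c(2,1,2) a(2,1,2)] transition_jacobian_self[OF M c(2) a(2)] by simp
  then have "?J *v (transition_jacobian c' c a *v h) = h" for h
    by (simp add: matrix_vector_mul_assoc)
  then show "surj (frechet_derivative (transition c c') (at y))"
    unfolding J surj_def by metis
qed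

lemma velocity_chart_inv_compose:
  assumes c: "is_chart M c" and T: "open T" "s \<in> T" "\<And>s. s \<in> T \<Longrightarrow> x s \<in> coord_image c"
    and x: "(x has_vector_derivative v) (at s)"
  shows "velocity c (chart_inv c \<circ> x) s = v"
proof -
  have "(snd c \<circ> (chart_inv c \<circ> x) has_vector_derivative v) (at s)"
    by (rule has_vector_derivative_transform_within_open[OF x T(1,2)]) (simp add: f_inv_into_f T(3))
  then show ?thesis unfolding velocity_def by (rule vector_derivative_at)
qed

text \<open>The boundary value problem yields the equation in one chart only, whereas
  \<open>is_geodesic\<close> demands it in every chart of \<open>A\<close> that the curve
  meets.\<close>

lemma is_geodesic_chart_inv_compose:
  fixes x v :: "real \<Rightarrow> real^'n"
  assumes M: "smooth_manifold M A" and g: "is_metric A g" "Ck_metric (Suc k) A g" and c: "c \<in> A"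
    and J: "open J" "is_interval J"
    and x: "\<And>s. s \<in> J \<Longrightarrow> x s \<in> coord_image c" "\<And>s. s \<in> J \<Longrightarrow> (x has_vector_derivative v s) (at s)"
    and v: "\<And>s. s \<in> J \<Longrightarrow> (v has_vector_derivative
       (\<chi> i. - (\<Sum>j\<in>UNIV. \<Sum>k\<in>UNIV. christoffel (g c) i j k (x s) * v s $ j * v s $ k))) (at s)"
  shows "is_geodesic M A g J (chart_inv c \<circ> x)"
  unfolding is_geodesic_def
proof (intro conjI ballI impI J)
  have ch: "is_chart M c" using M c by (auto simp: smooth_manifold_def)
  have contx: "continuous_on J x"
    by (intro continuous_at_imp_continuous_on ballI has_vector_derivative_continuous[OF x(2)])
  then have "continuous_map (top_of_set J) (top_of_set (coord_image c)) x"
    using x(1) by auto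
  then show "continuous_map (top_of_set J) M (chart_inv c \<circ> x)"
    using continuous_map_chart_inv[OF ch] continuous_map_compose by blast
  fix c' t assume c': "c' \<in> A" and t: "t \<in> J" and tc': "(chart_inv c \<circ> x) t \<in> fst c'"
  have ch': "is_chart M c'" using M c' by (auto simp: smooth_manifold_def)
  define \<tau> where "\<tau> = transition c c'"
  define D where "D y = frechet_derivative \<tau> (at y)" for y
  define S where "S = snd c ` (fst c \<inter> fst c')"
  define a :: "real \<Rightarrow> real^'n" where
    "a s = (\<chi> i. - (\<Sum>j\<in>UNIV. \<Sum>k\<in>UNIV. christoffel (g c) i j k (x s) * v s $ j * v s $ k))" for s
  \<comment> \<open>The times at which the curve lies in both charts. This set is open, so
    derivatives at \<open>t\<close> may be computed with the transition map.\<close>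
  define T where "T = {s \<in> J. x s \<in> S}"
  have S: "open S" unfolding S_def by (rule open_overlap[OF M c c'])
  have xt: "x t \<in> S"
  proof -
    have "chart_inv c (x t) \<in> fst c \<inter> fst c'" using tc' x(1)[OF t] by (auto intro: inv_into_into)
    moreover have "x t = snd c (chart_inv c (x t))" using x(1)[OF t] by (simp add: f_inv_into_f)
    ultimately show ?thesis unfolding S_def by blast
  qed
  have T: "open T" "t \<in> T"
    using continuous_open_preimage[OF contx J(1) S] xt t by (auto simp: T_def vimage_def Int_def)
  have \<tau>: "Ck_on 2 \<tau> S" using M c c' unfolding smooth_manifold_def \<tau>_def S_def by blast
  have D\<tau>: "(\<tau> has_derivative D y) (at y)" if "y \<in> S" for y
    using Ck_on_Suc_has_derivative[of "Suc 0" \<tau> S y] \<tau> that unfolding D_def by (simp add: numeral_2_eq_2)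
  have e: "snd c' \<circ> (chart_inv c \<circ> x) = \<tau> \<circ> x" by (simp add: \<tau>_def comp_assoc)
  have vel: "((\<tau> \<circ> x) has_vector_derivative D (x s) (v s)) (at s)" if "s \<in> T" for s
    using that vector_derivative_diff_chain_within[of x "v s" s UNIV \<tau> "D (x s)"] x(2)
      has_derivative_at_withinI[OF D\<tau>] by (simp add: T_def)
  have velocity: "velocity c' (chart_inv c \<circ> x) s = D (x s) (v s)" if "s \<in> T" for s
    unfolding velocity_def e by (rule vector_derivative_at[OF vel[OF that]])
  show "snd c' \<circ> (chart_inv c \<circ> x) differentiable at t"
    unfolding e using vel[OF T(2)] by (rule differentiableI_vector)
  have \<tau>xt: "\<tau> (x t) \<in> coord_image c'"
    unfolding \<tau>_def by (rule metric_transition(3)[OF M g(1) c c' xt[unfolded S_def]])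
  have inv: "invertible (g c (x t))" "invertible (g c' (\<tau> (x t)))" "transpose (g c' (\<tau> (x t))) = g
      c' (\<tau> (x t))"
    using g(1) c c' x(1)[OF t] \<tau>xt unfolding is_metric_def by blast+
  note mt = metric_transition[OF M g(1) c c', folded \<tau>_def S_def]
  note dg = Ck_metric_has_derivative[OF g(2) c ch x(1)[OF t]] Ck_metric_has_derivative[OF g(2) c' ch' \<tau>xt]
  have "geodesic_eq (g c (x t)) (frechet_derivative (g c) (at (x t))) (v t) (a t)"
    unfolding geodesic_eq_iff_christoffel[OF dg(1) inv(1)] a_def ..
  then have "geodesic_eq (g c' (\<tau> (x t))) (frechet_derivative (g c') (at (\<tau> (x t)))) (D (x t) (v t))
      (D (x t) (a t) + frechet_derivative (\<lambda>y. D y (v t)) (at (x t)) (v t))"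
    unfolding D_def
    using mt(1) inv(3) mt(2)[OF xt] by (intro geodesic_eq_transform[OF S xt \<tau> dg])
  then have acc: "D (x t) (a t) + frechet_derivative (\<lambda>y. D y (v t)) (at (x t)) (v t) =
      (\<chi> i. - (\<Sum>j\<in>UNIV. \<Sum>k\<in>UNIV. christoffel (g c') i j k (\<tau> (x t)) * D (x t) (v t) $ j * D (x t) (v t) $ k))"
    unfolding geodesic_eq_iff_christoffel[OF dg(2) inv(2)] .
  have "((\<lambda>s. D (x s) (v s)) has_vector_derivative
      D (x t) (a t) + frechet_derivative (\<lambda>y. D y (v t)) (at (x t)) (v t)) (at t)"
    unfolding D_def
    by (rule deriv_along_curve_has_vector_derivative[where x = x and v = v and t = t, OF S xt \<tau>
        x(2)[OF t] _ T])
       (use v[OF t] in \<open>auto simp: a_def T_def\<close>)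
  then have "(velocity c' (chart_inv c \<circ> x) has_vector_derivative
      D (x t) (a t) + frechet_derivative (\<lambda>y. D y (v t)) (at (x t)) (v t)) (at t)"
    by (rule has_vector_derivative_transform_within_open[OF _ T]) (simp add: velocity)
  then show "(velocity c' (chart_inv c \<circ> x) has_vector_derivative
        (\<chi> i. - (\<Sum>j\<in>UNIV. \<Sum>k\<in>UNIV. christoffel (g c') i j k (snd c' ((chart_inv c \<circ> x) t))
                   * velocity c' (chart_inv c \<circ> x) t $ j * velocity c' (chart_inv c \<circ> x) t $ k))) (at t)"
    unfolding acc velocity[OF T(2)] by (simp add: \<tau>_def)
qed

section \<open>Homogeneous polynomials\<close>

lemma finite_index_tuples [simp]: "finite (index_tuples d :: 'n::finite list set)"
  unfolding index_tuples_def using finite_lists_length_eq[of "UNIV :: 'n set" d] by simp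

lemma sum_index_tuples_Suc:
  "(\<Sum>is\<in>index_tuples (Suc d). f is) = (\<Sum>i\<in>UNIV. \<Sum>is\<in>index_tuples d. f ((i :: 'n::finite) # is))"
proof -
  have "index_tuples (Suc d) = (\<lambda>(i, is). i # is) ` ((UNIV :: 'n set) \<times> index_tuples d)"
    by (auto simp: index_tuples_def length_Suc_conv image_iff)
  moreover have "inj_on (\<lambda>(i, is). i # is) ((UNIV :: 'n set) \<times> index_tuples d)" by (auto intro: inj_onI)
  ultimately show ?thesis
    by (simp add: sum.reindex sum.cartesian_product comp_def split_def)
qed

lemma sum_prod_list_matrix_vector:
  "is \<in> index_tuples d \<Longrightarrow>
    (\<Sum>js\<in>index_tuples d. (\<Prod>r<d. G $ (is ! r) $ (js ! r)) * (\<Prod>j\<leftarrow>js. v $ j)) =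
    (\<Prod>i\<leftarrow>is. (G *v (v :: real^'n)) $ i)"
proof (induction d arbitrary: "is")
  case 0
  then show ?case by (simp add: index_tuples_def)
next
  case (Suc d)
  then obtain i is' where is': "is = i # is'" "is' \<in> index_tuples d"
    by (auto simp: index_tuples_def length_Suc_conv)
  have "(\<Sum>js\<in>index_tuples (Suc d). (\<Prod>r<Suc d. G $ (is ! r) $ (js ! r)) * (\<Prod>j\<leftarrow>js. v $ j)) =
    (\<Sum>j\<in>UNIV. \<Sum>js\<in>index_tuples d. (G $ i $ j * v $ j) * ((\<Prod>r<d. G $ (is' ! r) $ (js ! r)) * (\<Prod>j\<leftarrow>js. v $ j)))"
    unfolding sum_index_tuples_Suc is'(1) by (simp only: prod.lessThan_Suc_shift) (simp add: mult_ac)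
  also have "\<dots> = (G *v v) $ i * (\<Prod>i\<leftarrow>is'. (G *v v) $ i)"
    by (simp only: Suc.IH[OF is'(2)] sum_distrib_left[symmetric] sum_distrib_right[symmetric]
        matrix_vector_mult_def vec_lambda_beta)
  finally show ?case by (simp add: is'(1))
qed

text \<open>The Legendre transformation: the conserved quantity of a curve with velocity
  \<open>v\<close> is the value of the form at the momentum \<open>G *v v\<close>.\<close>

lemma homogeneous_form_lower_indices:
  "homogeneous_form d (lower_indices d G K) v = homogeneous_form d K (G *v v)"
proof -
  have "homogeneous_form d (lower_indices d G K) v =
    (\<Sum>is\<in>index_tuples d. \<Sum>js\<in>index_tuples d. K is * ((\<Prod>r<d. G $ (is ! r) $ (js ! r)) * (\<Prod>j\<leftarrow>js. v $ j)))"
    unfolding homogeneous_form_def lower_indices_def sum_distrib_right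
    by (subst sum.swap) (simp add: mult.assoc)
  then show ?thesis
    by (simp add: homogeneous_form_def sum_distrib_left[symmetric] sum_prod_list_matrix_vector)
qed

lemma homogeneous_form_scaleR: "homogeneous_form d K (r *\<^sub>R v) = r ^ d * homogeneous_form d K v"
proof -
  have m: "(\<Prod>i\<leftarrow>is. (r *\<^sub>R v) $ i) = r ^ length is * (\<Prod>i\<leftarrow>is. v $ i)" for "is"
    by (induction "is") (auto simp: mult_ac)
  show ?thesis
    unfolding homogeneous_form_def sum_distrib_left m
    by (intro sum.cong) (auto simp: index_tuples_def mult_ac)
qed

lemma Ck_on_homogeneous_form:
  fixes u :: "'a::euclidean_space \<Rightarrow> real^'n"
  assumes "open S" "Ck_on k u S" shows "Ck_on k (\<lambda>x. homogeneous_form d K (u x)) S"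
  unfolding homogeneous_form_def
  by (intro Ck_on_sum Ck_on_mult Ck_on_prod_list Ck_on_nth Ck_on_const assms)

text \<open>Newton's scheme. The nodes and dual functions for \<open>B\<close> are extended by one
  node at which the interpolation error of \<open>b\<close> is nonzero, unless that error vanishes
  identically. \<open>Q\<close> keeps the dual functions inside a given class.\<close>

lemma ex_interpolation:
  fixes B :: "('x \<Rightarrow> real) set"
  assumes "finite B" "\<And>b. b \<in> B \<Longrightarrow> Q b"
    and Q: "\<And>f g r. Q f \<Longrightarrow> Q g \<Longrightarrow> Q (\<lambda>x. f x - r * g x)" "\<And>f r. Q f \<Longrightarrow> Q (\<lambda>x. f x / r)"
  shows "\<exists>P l. finite P \<and> (\<forall>p\<in>P. Q (l p)) \<and> (\<forall>p\<in>P. \<forall>q\<in>P. l p q = (if p = q then 1 else 0)) \<and>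
    (\<forall>b\<in>B. \<forall>x. b x = (\<Sum>p\<in>P. b p * l p x))"
  using assms(1,2)
proof (induction B)
  case empty
  show ?case by (rule exI[of _ "{}"]) simp
next
  case (insert b B)
  have "\<exists>P l. finite P \<and> (\<forall>p\<in>P. Q (l p)) \<and> (\<forall>p\<in>P. \<forall>q\<in>P. l p q = (if p = q then 1 else 0)) \<and>
      (\<forall>b\<in>B. \<forall>x. b x = (\<Sum>p\<in>P. b p * l p x))"
    by (rule insert.IH) (use insert.prems in blast)
  then obtain P l where *: "finite P" "\<forall>p\<in>P. Q (l p)"
    "\<forall>p\<in>P. \<forall>q\<in>P. l p q = (if p = q then 1 else 0)" "\<forall>b\<in>B. \<forall>x. b x = (\<Sum>p\<in>P. b p * l p x)"
    by (elim exE conjE)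
  have P: "finite P" "\<And>p. p \<in> P \<Longrightarrow> Q (l p)"
    and l: "\<And>p q. p \<in> P \<Longrightarrow> q \<in> P \<Longrightarrow> l p q = (if p = q then 1 else 0)"
    and B: "\<And>b x. b \<in> B \<Longrightarrow> b x = (\<Sum>p\<in>P. b p * l p x)"
    using * by blast+
  define r where "r x = b x - (\<Sum>p\<in>P. b p * l p x)" for x
  \<comment> \<open>Closure of \<open>Q\<close> allows subtracting one multiple at a time, so the
    interpolant is removed node by node.\<close>
  have "Q (\<lambda>x. b x - (\<Sum>p\<in>P'. b p * l p x))" if "P' \<subseteq> P" for P'
    using finite_subset[OF that P(1)] that
  proof (induction P' rule: finite_induct)
    case empty
    then show ?case using insert.prems[of b] by simp
  next
    case (insert q P')
    then show ?case
      using Q(1)[of "\<lambda>x. b x - (\<Sum>p\<in>P'. b p * l p x)" "l q" "b q"] P(2)[of q] by (simp add: algebra_simps)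
  qed
  then have Qr: "Q r" unfolding r_def by simp
  have r0: "r p = 0" if "p \<in> P" for p
  proof -
    have "(\<Sum>q\<in>P. b q * l q p) = (\<Sum>q\<in>P. if q = p then b p else 0)"
      by (intro sum.cong refl) (use l that in auto)
    then show ?thesis using P(1) that by (simp add: r_def)
  qed
  show ?case
  proof (cases "\<forall>x. r x = 0")
    case True
    then have "b x = (\<Sum>p\<in>P. b p * l p x)" for x
      unfolding r_def by (metis eq_iff_diff_eq_0)
    then have "\<forall>b\<in>insert b B. \<forall>x. b x = (\<Sum>p\<in>P. b p * l p x)" using *(4) by blast
    then show ?thesis using *(1-3) by blast
  next
    case False
    then obtain q where q: "r q \<noteq> 0" by blast
    then have qP: "q \<notin> P" using r0 by blast
    \<comment> \<open>\<open>r\<close> vanishes at the old nodes, so multiples of it do not disturb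
      duality there; the multiple is chosen to make the old functions vanish at
      \<open>q\<close>.\<close>
    define l' where "l' p = (if p = q then (\<lambda>x. r x / r q) else (\<lambda>x. l p x - l p q / r q * r x))" for p
    have l'P: "l' p = (\<lambda>x. l p x - l p q / r q * r x)" if "p \<in> P" for p
      using that qP by (auto simp: l'_def)
    have sum: "(\<Sum>p\<in>insert q P. b' p * l' p x) =
        (\<Sum>p\<in>P. b' p * l p x) + r x / r q * (b' q - (\<Sum>p\<in>P. b' p * l p q))" for b' x
    proof -
      have "(\<Sum>p\<in>P. b' p * l' p x) = (\<Sum>p\<in>P. b' p * l p x - r x / r q * (b' p * l p q))"
        by (intro sum.cong refl) (simp add: l'P algebra_simps)
      then have "(\<Sum>p\<in>P. b' p * l' p x) = (\<Sum>p\<in>P. b' p * l p x) - r x / r q * (\<Sum>p\<in>P. b' p * l p q)"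
        by (simp only: sum_subtractf sum_distrib_left)
      then show ?thesis
        using P(1) qP by (simp add: l'_def[of q] algebra_simps)
    qed
    show ?thesis
    proof (intro exI[of _ "insert q P"] exI[of _ l'] conjI ballI allI)
      show "Q (l' p)" if "p \<in> insert q P" for p
      proof (cases "p = q")
        case True
        then show ?thesis using Q(2)[OF Qr] by (simp add: l'_def)
      next
        case False
        then have p: "p \<in> P" using that by blast
        show ?thesis unfolding l'P[OF p] by (rule Q(1)[OF P(2)[OF p] Qr])
      qed
      show "l' p p' = (if p = p' then 1 else 0)" if "p \<in> insert q P" "p' \<in> insert q P" for p p'
        using that qP q l r0 by (auto simp: l'P l'_def[of q])
      show "b' x = (\<Sum>p\<in>insert q P. b' p * l' p x)" if "b' \<in> insert b B" for b' x
      proof (cases "b' = b")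
        case True
        have "b q - (\<Sum>p\<in>P. b p * l p q) = r q" "(\<Sum>p\<in>P. b p * l p x) = b x - r x"
          by (simp_all add: r_def)
        then show ?thesis using q unfolding True sum by simp
      next
        case False
        then have "b' \<in> B" using that by blast
        from B[OF this] show ?thesis unfolding sum by (metis add.right_neutral
            cancel_comm_monoid_add_class.diff_cancel mult_zero_right)
      qed
    qed (use P(1) in simp)
  qed
qed

text \<open>Interpolating the monomials suffices by linearity in \<open>K\<close>. The nodes and the
  functions \<open>l\<close> depend on no coefficients, so the same finite set of covectors serves
  all points \<open>x\<close>.\<close>

lemma ex_homogeneous_interpolation:
  "\<exists>(P :: (real^'n) set) l. finite P \<and> (\<forall>p\<in>P. \<exists>c. l p = homogeneous_form d c) \<and>
    (\<forall>p\<in>P. \<forall>q\<in>P. l p q = (if p = q then 1 else 0)) \<and>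
    (\<forall>K x. homogeneous_form d K x = (\<Sum>p\<in>P. homogeneous_form d K p * l p x))"
proof -
  define m where "m is x = (\<Prod>i\<leftarrow>is. x $ i)" for "is" :: "'n list" and x :: "real^'n"
  let ?Q = "\<lambda>f. \<exists>c. f = homogeneous_form d c"
  have "\<exists>P l. finite P \<and> (\<forall>p\<in>P. ?Q (l p)) \<and> (\<forall>p\<in>P. \<forall>q\<in>P. l p q = (if p = q then 1 else 0)) \<and>
    (\<forall>b\<in>m ` index_tuples d. \<forall>x. b x = (\<Sum>p\<in>P. b p * l p x))"
  proof (rule ex_interpolation)
    show "?Q b" if "b \<in> m ` index_tuples d" for b
    proof -
      from that obtain "is" where "is": "is \<in> index_tuples d" "b = m is" by blast
      have "b = homogeneous_form d (\<lambda>js. if js = is then 1 else 0)"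
        using "is" by (auto simp: homogeneous_form_def m_def if_distrib[of "\<lambda>c. c * _"] cong: if_cong)
      then show ?thesis by blast
    qed
    show "?Q (\<lambda>x. f x - r * g x)" if "?Q f" "?Q g" for f g r
    proof -
      from that obtain c c' where "f = homogeneous_form d c" "g = homogeneous_form d c'" by blast
      then have "(\<lambda>x. f x - r * g x) = homogeneous_form d (\<lambda>is. c is - r * c' is)"
        by (auto simp: homogeneous_form_def sum_subtractf sum_distrib_left algebra_simps)
      then show ?thesis by blast
    qed
    show "?Q (\<lambda>x. f x / r)" if "?Q f" for f r
    proof -
      from that obtain c where "f = homogeneous_form d c" by blast
      then have "(\<lambda>x. f x / r) = homogeneous_form d (\<lambda>is. c is / r)"
        by (auto simp: homogeneous_form_def sum_divide_distrib)
      then show ?thesis by blast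
    qed
  qed simp
  then obtain P l where P: "finite P" "\<forall>p\<in>P. ?Q (l p)" "\<forall>p\<in>P. \<forall>q\<in>P. l p q = (if p = q then 1 else 0)"
    and m': "\<forall>b\<in>m ` index_tuples d. \<forall>x. b x = (\<Sum>p\<in>P. b p * l p x)"
    by (elim exE conjE)
  have m: "m is x = (\<Sum>p\<in>P. m is p * l p x)" if "is \<in> index_tuples d" for "is" x
    using m' that by blast
  have "homogeneous_form d K x = (\<Sum>p\<in>P. homogeneous_form d K p * l p x)" for K x
  proof -
    have hf: "homogeneous_form d K y = (\<Sum>is\<in>index_tuples d. K is * m is y)" for y
      by (simp add: homogeneous_form_def m_def)
    have "homogeneous_form d K x = (\<Sum>is\<in>index_tuples d. \<Sum>p\<in>P. K is * m is p * l p x)"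
      unfolding hf by (intro sum.cong refl) (subst m, simp_all add: sum_distrib_left mult.assoc)
    also have "\<dots> = (\<Sum>p\<in>P. homogeneous_form d K p * l p x)"
      unfolding hf sum_distrib_right by (rule sum.swap)
    finally show ?thesis .
  qed
  then show ?thesis using P by blast
qed

text \<open>Gaussian elimination preserves the bound on the row sums, so no pivot vanishes.\<close>

lemma Ck_on_linear_system:
  fixes L :: "'i \<Rightarrow> 'i \<Rightarrow> 'a::euclidean_space \<Rightarrow> real"
  assumes S: "open S" and "finite I"
    and "\<And>i j. i \<in> I \<Longrightarrow> j \<in> I \<Longrightarrow> Ck_on k (L i j) S" "\<And>i. i \<in> I \<Longrightarrow> Ck_on k (c i) S"
    and "\<And>i x. i \<in> I \<Longrightarrow> x \<in> S \<Longrightarrow> w i x = c i x + (\<Sum>j\<in>I. L i j x * w j x)"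
    and "\<And>i x. i \<in> I \<Longrightarrow> x \<in> S \<Longrightarrow> (\<Sum>j\<in>I. \<bar>L i j x\<bar>) \<le> 1 / 2"
  shows "\<forall>i\<in>I. Ck_on k (w i) S"
  using assms(2-)
proof (induction I arbitrary: L c)
  case (insert m I)
  define D where "D x = 1 - L m m x" for x
  have row: "\<bar>L i m x\<bar> + (\<Sum>j\<in>I. \<bar>L i j x\<bar>) \<le> 1 / 2" if "i \<in> insert m I" "x \<in> S" for i x
    using insert.prems(4)[OF that] insert.hyps by simp
  \<comment> \<open>Half of the unit diagonal is out of reach of \<open>L m m x\<close>, and the
    rest of row \<open>m\<close> is at most \<open>1 / 2 - \<bar>L m m x\<bar>\<close>, hence at
    most the pivot.\<close>
  have D: "D x \<ge> 1 / 2" "(\<Sum>j\<in>I. \<bar>L m j x\<bar>) \<le> D x" if "x \<in> S" for x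
  proof -
    have "\<bar>L m m x\<bar> + (\<Sum>j\<in>I. \<bar>L m j x\<bar>) \<le> 1 / 2" "0 \<le> (\<Sum>j\<in>I. \<bar>L m j x\<bar>)"
      using row[OF _ that, of m] by (auto intro: sum_nonneg)
    then show "D x \<ge> 1 / 2" "(\<Sum>j\<in>I. \<bar>L m j x\<bar>) \<le> D x" unfolding D_def by linarith+
  qed
  have D0: "D x \<noteq> 0" "D x > 0" if "x \<in> S" for x using D(1)[OF that] by auto
  have CkD: "Ck_on k D S"
    unfolding D_def[abs_def] by (intro Ck_on_diff S Ck_on_const insert.prems) auto
  have wm: "w m x = (c m x + (\<Sum>j\<in>I. L m j x * w j x)) / D x" if "x \<in> S" for x
    using insert.prems(3)[of m x] that insert.hyps D0[OF that] by (simp add: D_def field_simps)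
  have IH: "\<forall>i\<in>I. Ck_on k (w i) S"
  proof (rule insert.IH)
    fix i x assume i: "i \<in> I" and x: "x \<in> S"
    have "w i x = c i x + L i m x * w m x + (\<Sum>j\<in>I. L i j x * w j x)"
      using insert.prems(3)[of i x] i x insert.hyps by simp
    then show "w i x = (c i x + L i m x / D x * c m x) + (\<Sum>j\<in>I. (L i j x + L i m x / D x * L m j x) * w j x)"
      unfolding wm[OF x]
      by (simp add: sum.distrib sum_distrib_left distrib_right add_divide_distrib distrib_left
          mult_ac sum_divide_distrib)
    \<comment> \<open>Eliminating \<open>w m\<close> replaces the entry
      \<open>\<bar>L i m x\<bar>\<close> of the row sum by this entry times a quotient that is at
      most 1.\<close>
    have "(\<Sum>j\<in>I. \<bar>L i j x + L i m x / D x * L m j x\<bar>) \<le>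
        (\<Sum>j\<in>I. \<bar>L i j x\<bar> + \<bar>L i m x\<bar> / D x * \<bar>L m j x\<bar>)"
      using D0[OF x] by (intro sum_mono order_trans[OF abs_triangle_ineq]) (simp add: abs_mult)
    also have "\<dots> = (\<Sum>j\<in>I. \<bar>L i j x\<bar>) + \<bar>L i m x\<bar> * ((\<Sum>j\<in>I. \<bar>L m j x\<bar>) / D x)"
      by (simp add: sum.distrib sum_distrib_left sum_divide_distrib)
    also have "\<dots> \<le> (\<Sum>j\<in>I. \<bar>L i j x\<bar>) + \<bar>L i m x\<bar> * 1"
      using D[OF x] D0[OF x] by (intro add_left_mono mult_left_mono) (auto simp: divide_le_eq)
    also have "\<dots> \<le> 1 / 2" using row[of i x] i x by simp
    finally show "(\<Sum>j\<in>I. \<bar>L i j x + L i m x / D x * L m j x\<bar>) \<le> 1 / 2" .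
  next
    show "Ck_on k (\<lambda>x. L i j x + L i m x / D x * L m j x) S" if "i \<in> I" "j \<in> I" for i j
      using that D0 by (intro Ck_on_add Ck_on_mult Ck_on_divide S CkD insert.prems) auto
    show "Ck_on k (\<lambda>x. c i x + L i m x / D x * c m x) S" if "i \<in> I" for i
      using that D0 by (intro Ck_on_add Ck_on_mult Ck_on_divide S CkD insert.prems) auto
  qed
  have "Ck_on k (\<lambda>x. (c m x + (\<Sum>j\<in>I. L m j x * w j x)) / D x) S"
    using IH D0 by (intro Ck_on_divide Ck_on_add Ck_on_sum Ck_on_mult S CkD insert.prems) auto
  then have "Ck_on k (w m) S" by (rule Ck_on_cong_imp[OF S, rotated]) (simp add: wm)
  then show ?case using IH by simp
qed simp

section \<open>Regularity of integrals\<close>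

lemma Ck_on_christoffel:
  fixes G :: "real^'n \<Rightarrow> real^'n^'n"
  assumes S: "open S" and G: "\<And>i j. Ck_on (Suc k) (\<lambda>x. G x $ i $ j) S" and inv: "\<And>x. x \<in> S \<Longrightarrow> invertible (G x)"
  shows "Ck_on k (christoffel G i j l) S"
proof -
  have "Ck_on k (\<lambda>x. matrix_inv (G x) $ i $ m) S" for m
    by (rule Ck_on_matrix_inv[OF S Ck_on_Suc_imp[OF G] inv])
  then have "Ck_on k (\<lambda>x. (\<Sum>m\<in>UNIV. matrix_inv (G x) $ i $ m *
        (partial_deriv j (\<lambda>y. G y $ m $ l) x + partial_deriv l (\<lambda>y. G y $ m $ j) x
           - partial_deriv m (\<lambda>y. G y $ j $ l) x)) / 2) S"
    by (intro Ck_on_divide Ck_on_sum Ck_on_mult Ck_on_add Ck_on_diff Ck_on_const S Ck_on_partial_deriv G) auto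
  then show ?thesis unfolding christoffel_def[abs_def] .
qed

text \<open>Regularity along a field of covectors close to \<open>p\<close>, not yet at
  \<open>p\<close> itself: \<open>u x\<close> is the momentum with which the geodesic from
  \<open>y\<close> arrives at \<open>x\<close>.\<close>

lemma integral_regular_on_section:
  fixes p :: "real^'n::finite"
  assumes M: "smooth_manifold M A" and g: "is_metric A g" "Ck_metric (Suc (Suc r)) A g" and c: "c \<in> A"
    and int: "\<And>J \<gamma>. is_geodesic M A g J \<gamma> \<Longrightarrow> \<exists>const. \<forall>t\<in>J. \<forall>c\<in>A. \<gamma> t \<in> fst c \<longrightarrow>
      homogeneous_form d (lower_indices d (g c (snd c (\<gamma> t))) (K c (snd c (\<gamma> t)))) (velocity c \<gamma> t) = const"
    and x0: "x0 \<in> coord_image c" and \<delta>: "\<delta> > 0"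
  shows "\<exists>S u. open S \<and> x0 \<in> S \<and> S \<subseteq> coord_image c \<and> Ck_on (Suc r) u S \<and> (\<forall>x\<in>S. norm (u x - p) < \<delta>) \<and>
    Ck_on (Suc r) (\<lambda>x. homogeneous_form d (K c x) (u x)) S"
proof -
  have ch: "is_chart M c" using M c by (auto simp: smooth_manifold_def)
  let ?U = "coord_image c"
  have U: "open ?U" using ch unfolding is_chart_def by blast
  have inv: "invertible (g c x)" if "x \<in> ?U" for x using g(1) c that unfolding is_metric_def by blast
  have Ckg: "Ck_on (Suc (Suc r)) (\<lambda>x. g c x $ i $ j) ?U" for i j
    using g(2) c unfolding Ck_metric_def by blast
  have Ckgm: "Ck_on (Suc r) (g c) ?U"
    by (rule Ck_on_vecI[OF U], rule Ck_on_vecI[OF U], rule Ck_on_Suc_imp[OF Ckg])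
  define V :: "((real^'n) \<times> (real^'n)) set" where "V = fst -` ?U"
  have V: "open V" unfolding V_def by (rule open_vimage[OF U linear_continuous_on[OF bounded_linear_fst]])
  define P :: "(real^'n) \<times> (real^'n) \<Rightarrow> real^'n" where
    "P = (\<lambda>q. \<chi> i. - (\<Sum>j\<in>UNIV. \<Sum>k\<in>UNIV. christoffel (g c) i j k (fst q) * snd q $ j * snd q $ k))"
  \<comment> \<open>Here the metric of order \<open>r + 2\<close> loses its one derivative.\<close>
  have \<Gamma>: "Ck_on (Suc r) (\<lambda>q. christoffel (g c) i j k (fst q)) V" for i j k
    unfolding V_def
    by (rule Ck_on_compose_bounded_linear[OF bounded_linear_fst U Ck_on_christoffel[OF U Ckg inv]])
  have "Ck_on (Suc r) (\<lambda>q. P q $ i) V" for i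
    unfolding P_def vec_lambda_beta
    by (intro Ck_on_minus Ck_on_sum Ck_on_mult Ck_on_nth Ck_on_bounded_linear[OF bounded_linear_snd] \<Gamma> V)
  then have P: "Ck_on (Suc r) P V" by (rule Ck_on_vecI[OF V])
  \<comment> \<open>The velocity whose momentum at \<open>x0\<close> is \<open>p\<close>.\<close>
  define v0 where "v0 = matrix_inv (g c x0) *v p"
  have v0: "g c x0 *v v0 = p"
    by (simp add: v0_def matrix_vector_mul_assoc matrix_inv_right[OF inv[OF x0]])
  have V0: "(x0, v0) \<in> V" using x0 by (simp add: V_def)
  have "Ck_on (Suc r) (\<lambda>q. g c (fst q)) V"
    unfolding V_def by (rule Ck_on_compose_bounded_linear[OF bounded_linear_fst U Ckgm])
  from Ck_on_bilinear[OF bounded_bilinear_matrix_vector_mult V this Ck_on_bounded_linear[OF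
      bounded_linear_snd V]]
  have "continuous_on V (\<lambda>q. g c (fst q) *v snd q)" by (rule Ck_on_imp_continuous_on)
  then have "\<exists>\<delta>'>0. \<forall>q\<in>V. dist q (x0, v0) < \<delta>' \<longrightarrow> dist (g c (fst q) *v snd q) (g c (fst (x0, v0)) *v
      snd (x0, v0)) < \<delta>"
    using V0 \<delta> unfolding continuous_on_iff by blast
  then obtain \<delta>' where \<delta>': "\<delta>' > 0" "\<And>q. q \<in> V \<Longrightarrow> dist q (x0, v0) < \<delta>' \<Longrightarrow> dist (g c (fst q) *v snd q) p < \<delta>"
    unfolding fst_conv snd_conv v0 by blast
  \<comment> \<open>Half, because the errors of the point and of the velocity add up in the distance
    on the product.\<close>
  define \<eta> where "\<eta> = \<delta>' / 2"
  have \<eta>: "\<eta> > 0" using \<delta>'(1) by (simp add: \<eta>_def)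
  from ex_second_order_bvp[OF V V0 P \<eta>] obtain \<epsilon> y S x w where \<epsilon>: "\<epsilon> > 0" and S: "open S" "x0 \<in> S"
    and w: "Ck_on (Suc r) (\<lambda>x. w x 0) S" "Ck_on (Suc r) (\<lambda>x. w x 1) S"
    and bvp: "\<forall>z\<in>S. x z 0 = y \<and> x z 1 = z \<and> norm (w z 1 - v0) < \<eta> \<and>
      (\<forall>s\<in>{-1<..<2::real}. (x z s, w z s) \<in> V \<and> (x z has_vector_derivative \<epsilon> *\<^sub>R w z s) (at s) \<and>
         (w z has_vector_derivative \<epsilon> *\<^sub>R P (x z s, w z s)) (at s))"
    by (elim exE conjE)
  have xw: "x z 0 = y" "x z 1 = z" "norm (w z 1 - v0) < \<eta>" if "z \<in> S" for z
    using bvp that by blast+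
  have xws: "(x z s, w z s) \<in> V" "(x z has_vector_derivative \<epsilon> *\<^sub>R w z s) (at s)"
    "(w z has_vector_derivative \<epsilon> *\<^sub>R P (x z s, w z s)) (at s)" if "z \<in> S" "s \<in> {-1<..<2}" for z s
    using bvp that by blast+
  define T where "T = S \<inter> ball x0 \<eta> \<inter> ?U"
  have T: "open T" "x0 \<in> T" "T \<subseteq> ?U" "T \<subseteq> S" using S U x0 \<eta> by (auto simp: T_def)
  define u where "u z = g c z *v w z 1" for z
  have Cku: "Ck_on (Suc r) u T"
    unfolding u_def[abs_def]
    by (intro Ck_on_bilinear[OF bounded_bilinear_matrix_vector_mult T(1)] Ck_on_subset[OF Ckgm T(3)]
        Ck_on_subset[OF w(2) T(4)])
  have near: "norm (u z - p) < \<delta>" if "z \<in> T" for z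
  proof -
    have "dist z x0 < \<eta>" "dist (w z 1) v0 < \<eta>"
      using that xw(3)[of z] by (auto simp: T_def dist_norm norm_minus_commute)
    then have "dist (z, w z 1) (x0, v0) < \<delta>'"
      using sqrt_sum_squares_le_sum_abs[of "dist z x0" "dist (w z 1) v0"]
      unfolding dist_Pair_Pair \<eta>_def by simp
    then show ?thesis using \<delta>'(2)[of "(z, w z 1)"] that T(3) by (auto simp: u_def V_def dist_norm)
  qed
  have const: "homogeneous_form d (K c z) (u z) = homogeneous_form d (K c y) (g c y *v w z 0)" if z:
      "z \<in> T" for z
  proof -
    let ?J = "{-1<..<2::real}"
    have zS: "z \<in> S" using z T by blast
    define \<gamma> where "\<gamma> = chart_inv c \<circ> x z"
    have xU: "x z s \<in> ?U" if "s \<in> ?J" for s using xws(1)[OF zS that] by (simp add: V_def)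
    have "is_geodesic M A g ?J \<gamma>"
      unfolding \<gamma>_def
    proof (rule is_geodesic_chart_inv_compose[OF M g c _ _ xU xws(2)[OF zS]])
      fix s assume s: "s \<in> ?J"
      have "((\<lambda>s. \<epsilon> *\<^sub>R w z s) has_vector_derivative \<epsilon> *\<^sub>R \<epsilon> *\<^sub>R P (x z s, w z s)) (at s)"
        by (rule bounded_linear.has_vector_derivative[OF bounded_linear_scaleR_right xws(3)[OF zS s]])
      \<comment> \<open>The right-hand side of the geodesic equation is quadratic in the velocity,
        so the two factors \<open>\<epsilon>\<close> turn \<open>w\<close> into the velocity
        \<open>\<epsilon> *\<^sub>R w\<close> with respect to the rescaled time.\<close>
      moreover have "\<epsilon> *\<^sub>R \<epsilon> *\<^sub>R P (x z s, w z s) = (\<chi> i. - (\<Sum>j\<in>UNIV. \<Sum>k\<in>UNIV.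
          christoffel (g c) i j k (x z s) * (\<epsilon> *\<^sub>R w z s) $ j * (\<epsilon> *\<^sub>R w z s) $ k))"
        by (simp add: vec_eq_iff P_def sum_distrib_left mult_ac)
      ultimately show "((\<lambda>s. \<epsilon> *\<^sub>R w z s) has_vector_derivative (\<chi> i. - (\<Sum>j\<in>UNIV. \<Sum>k\<in>UNIV.
          christoffel (g c) i j k (x z s) * (\<epsilon> *\<^sub>R w z s) $ j * (\<epsilon> *\<^sub>R w z s) $ k))) (at s)"
        by simp
    qed (use c in auto)
    from int[OF this] obtain C where C: "\<forall>t\<in>?J. \<forall>c\<in>A. \<gamma> t \<in> fst c \<longrightarrow>
        homogeneous_form d (lower_indices d (g c (snd c (\<gamma> t))) (K c (snd c (\<gamma> t)))) (velocity c \<gamma> t) = C"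
      by (elim exE)
    have "\<epsilon> ^ d * homogeneous_form d (K c (x z t)) (g c (x z t) *v w z t) = C" if t: "t \<in> ?J" for t
    proof -
      have "velocity c \<gamma> t = \<epsilon> *\<^sub>R w z t"
        unfolding \<gamma>_def by (rule velocity_chart_inv_compose[OF ch _ t xU xws(2)[OF zS t]]) auto
      moreover have "\<gamma> t \<in> fst c" "snd c (\<gamma> t) = x z t"
        using xU[OF t] by (auto simp: \<gamma>_def f_inv_into_f intro: inv_into_into)
      ultimately show ?thesis
        using C[rule_format, OF t c] by (simp add: homogeneous_form_lower_indices
            homogeneous_form_scaleR matrix_vector_mult_scaleR)
    qed
    \<comment> \<open>Time 0 is the fixed point \<open>y\<close>, time 1 the variable point
      \<open>z\<close>. The factor \<open>\<epsilon> ^ d\<close> comes from homogeneity and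
      cancels.\<close>
    from this[of 0] this[of 1] have "\<epsilon> ^ d * homogeneous_form d (K c z) (u z) =
        \<epsilon> ^ d * homogeneous_form d (K c y) (g c y *v w z 0)"
      using xw(1,2)[OF zS] by (simp add: u_def)
    then show ?thesis using \<epsilon> by simp
  qed
  have "Ck_on (Suc r) (\<lambda>z. homogeneous_form d (K c y) (g c y *v w z 0)) T"
    by (intro Ck_on_homogeneous_form[OF T(1)] Ck_on_bounded_linear_compose[OF
        matrix_vector_mul_bounded_linear T(1)]
        Ck_on_subset[OF w(1) T(4)])
  then have "Ck_on (Suc r) (\<lambda>z. homogeneous_form d (K c z) (u z)) T"
    by (rule Ck_on_cong_imp[OF T(1), rotated]) (simp add: const)
  then show ?thesis using T Cku near by blast
qed

text \<open>The interpolation formula at the covectors \<open>u p x\<close>, one for each node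
  \<open>p\<close>, is a linear system for the values at the nodes. Its right-hand side and
  coefficients are regular by \<open>integral_regular_on_section\<close>.\<close>

lemma integral_locally_Ck:
  assumes M: "smooth_manifold M A" and g: "is_metric A g" "Ck_metric (Suc (Suc r)) A g" and c: "c \<in> A"
    and int: "\<And>J \<gamma>. is_geodesic M A g J \<gamma> \<Longrightarrow> \<exists>const. \<forall>t\<in>J. \<forall>c\<in>A. \<gamma> t \<in> fst c \<longrightarrow>
      homogeneous_form d (lower_indices d (g c (snd c (\<gamma> t))) (K c (snd c (\<gamma> t)))) (velocity c \<gamma> t) = const"
    and x0: "x0 \<in> coord_image c"
  shows "\<exists>S. open S \<and> x0 \<in> S \<and> S \<subseteq> coord_image c \<and>
    Ck_on (Suc r) (\<lambda>q. homogeneous_form d (K c (fst q)) (snd q)) (S \<times> (UNIV :: (real^'n::finite) set))"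
proof -
  have ch: "is_chart M c" using M c by (auto simp: smooth_manifold_def)
  let ?U = "coord_image c"
  have U: "open ?U" using ch unfolding is_chart_def by blast
  from ex_homogeneous_interpolation[of d] obtain P :: "(real^'n) set" and l
    where P: "finite P" "\<forall>p\<in>P. \<exists>c. l p = homogeneous_form d c"
    and l: "\<forall>p\<in>P. \<forall>q\<in>P. l p q = (if p = q then 1 else 0)"
    and "\<forall>K x. homogeneous_form d K x = (\<Sum>p\<in>P. homogeneous_form d K p * l p x)"
    by (elim exE conjE)
  then have interp: "homogeneous_form d K x = (\<Sum>p\<in>P. homogeneous_form d K p * l p x)" for K x by blast
  \<comment> \<open>Bounds the entries of \<open>L\<close> so that a row of \<open>card P\<close> of
    them sums to at most \<open>1 / 2\<close>; the summand 1 keeps the denominator positive.\<close>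
  define e where "e = 1 / (2 * (1 + real (card P)))"
  have e: "e > 0" by (simp add: e_def add_pos_nonneg)
  have Ckl: "Ck_on k (\<lambda>x. l p (u x)) S" if "p \<in> P" "open S" "Ck_on k u S"
    for p k S and u :: "'b::euclidean_space \<Rightarrow> real^'n"
  proof -
    from P(2) that(1) obtain c where "l p = homogeneous_form d c" by blast
    then show ?thesis using Ck_on_homogeneous_form[OF that(2,3)] by simp
  qed
  have "\<forall>p. \<exists>\<delta>>0. \<forall>z. norm (z - p) < \<delta> \<longrightarrow> (\<forall>q\<in>P. \<bar>l q z - l q p\<bar> < e)"
  proof
    fix p
    have "\<forall>\<^sub>F z in nhds p. \<forall>q\<in>P. \<bar>l q z - l q p\<bar> < e"
    proof (rule eventually_ball_finite[OF P(1)], rule ballI)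
      fix q assume "q \<in> P"
      then have "continuous_on UNIV (l q)"
        using Ck_on_imp_continuous_on[OF Ckl[of q UNIV 0 "\<lambda>x. x"]] by simp
      then have "filterlim (l q) (nhds (l q p)) (nhds p)"
        by (simp add: continuous_on_eq_continuous_at isCont_def tendsto_at_iff_tendsto_nhds)
      from tendstoD[OF this e] show "\<forall>\<^sub>F z in nhds p. \<bar>l q z - l q p\<bar> < e"
        by (simp add: dist_real_def)
    qed
    then show "\<exists>\<delta>>0. \<forall>z. norm (z - p) < \<delta> \<longrightarrow> (\<forall>q\<in>P. \<bar>l q z - l q p\<bar> < e)"
      unfolding eventually_nhds_metric by (simp add: dist_norm)
  qed
  from choice[OF this] obtain \<delta>
    where \<delta>: "\<And>p. \<delta> p > 0" "\<And>p z q. norm (z - p) < \<delta> p \<Longrightarrow> q \<in> P \<Longrightarrow> \<bar>l q z - l q p\<bar> < e"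
    by blast
  have "\<forall>p. \<exists>S u. open S \<and> x0 \<in> S \<and> S \<subseteq> ?U \<and> Ck_on (Suc r) u S \<and> (\<forall>x\<in>S. norm (u x - p) < \<delta> p) \<and>
    Ck_on (Suc r) (\<lambda>x. homogeneous_form d (K c x) (u x)) S"
    by (rule allI, rule integral_regular_on_section[OF M g c int x0 \<delta>(1)])
  from choice[OF this] obtain S where
    "\<forall>p. \<exists>u. open (S p) \<and> x0 \<in> S p \<and> S p \<subseteq> ?U \<and> Ck_on (Suc r) u (S p) \<and> (\<forall>x\<in>S p. norm (u x - p) < \<delta> p) \<and>
    Ck_on (Suc r) (\<lambda>x. homogeneous_form d (K c x) (u x)) (S p)" by (elim exE)
  from choice[OF this] obtain u where S: "\<And>p. open (S p)" "\<And>p. x0 \<in> S p" and u: "\<And>p. Ck_on (Suc r)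
      (u p) (S p)"
    "\<And>p x. x \<in> S p \<Longrightarrow> norm (u p x - p) < \<delta> p" "\<And>p. Ck_on (Suc r) (\<lambda>x. homogeneous_form d (K c x) (u p
        x)) (S p)"
    by blast
  define T where "T = ?U \<inter> (\<Inter>p\<in>P. S p)"
  have T: "open T" "x0 \<in> T" "T \<subseteq> ?U" "\<And>p. p \<in> P \<Longrightarrow> T \<subseteq> S p"
    using U S x0 P(1) by (auto simp: T_def intro!: open_INT open_Int)
  \<comment> \<open>Identity minus the matrix of the system. It is small because
    \<open>u p x\<close> is close to the node \<open>p\<close>, where \<open>l q\<close> takes the
    values of the identity matrix.\<close>
  define L where "L p q x = (if p = q then 1 else 0) - l q (u p x)" for p q x
  have "\<forall>p\<in>P. Ck_on (Suc r) (\<lambda>x. homogeneous_form d (K c x) p) T"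
  proof (rule Ck_on_linear_system[OF T(1) P(1), of "Suc r" L])
    fix p assume p: "p \<in> P"
    show "Ck_on (Suc r) (L p q) T" if "q \<in> P" for q
      unfolding L_def[abs_def]
      by (intro Ck_on_diff[OF T(1)] Ck_on_const Ckl[OF that T(1)] Ck_on_subset[OF u(1) T(4)[OF p]])
    show "Ck_on (Suc r) (\<lambda>x. homogeneous_form d (K c x) (u p x)) T"
      by (rule Ck_on_subset[OF u(3) T(4)[OF p]])
    fix x assume x: "x \<in> T"
    have "(\<Sum>q\<in>P. L p q x * homogeneous_form d (K c x) q) =
        (\<Sum>q\<in>P. (if p = q then homogeneous_form d (K c x) q else 0) - homogeneous_form d (K c x) q *
            l q (u p x))"
      by (intro sum.cong refl) (simp add: L_def algebra_simps)
    also have "\<dots> = homogeneous_form d (K c x) p - homogeneous_form d (K c x) (u p x)"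
      using P(1) p interp[of "K c x" "u p x"] by (simp add: sum_subtractf)
    finally show "homogeneous_form d (K c x) p = homogeneous_form d (K c x) (u p x) +
        (\<Sum>q\<in>P. L p q x * homogeneous_form d (K c x) q)" by simp
    have "\<bar>L p q x\<bar> \<le> e" if q: "q \<in> P" for q
    proof -
      have "\<bar>l q (u p x) - l q p\<bar> < e" using u(2)[of x p] T(4)[OF p] x q by (intro \<delta>(2)) auto
      moreover have "l q p = (if p = q then 1 else 0)" using l p q by auto
      ultimately show ?thesis by (simp add: L_def abs_minus_commute)
    qed
    then have "(\<Sum>q\<in>P. \<bar>L p q x\<bar>) \<le> real (card P) * e"
      using sum_bounded_above[of P "\<lambda>q. \<bar>L p q x\<bar>" e] by simp
    also have "\<dots> \<le> 1 / 2" by (simp add: e_def divide_simps)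
    finally show "(\<Sum>q\<in>P. \<bar>L p q x\<bar>) \<le> 1 / 2" .
  qed
  then have Ckp: "Ck_on (Suc r) (\<lambda>x. homogeneous_form d (K c x) p) T" if "p \<in> P" for p using that by blast
  have vi: "T \<times> (UNIV :: (real^'n) set) = fst -` T" by auto
  have o: "open (T \<times> (UNIV :: (real^'n) set))" using T(1) by (simp add: open_Times)
  \<comment> \<open>The interpolation formula separates the variables, so regularity in
    \<open>x\<close> at finitely many covectors becomes joint regularity in \<open>x\<close> and the
    momentum.\<close>
  have "Ck_on (Suc r) (\<lambda>q. \<Sum>p\<in>P. homogeneous_form d (K c (fst q)) p * l p (snd q)) (T \<times> (UNIV ::
      (real^'n) set))"
  proof (rule Ck_on_sum[OF o], rule Ck_on_mult[OF o])
    fix p assume p: "p \<in> P"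
    show "Ck_on (Suc r) (\<lambda>q. homogeneous_form d (K c (fst q)) p) (T \<times> (UNIV :: (real^'n) set))"
      unfolding vi by (rule Ck_on_compose_bounded_linear[OF bounded_linear_fst T(1) Ckp[OF p]])
    show "Ck_on (Suc r) (\<lambda>q. l p (snd q)) (T \<times> (UNIV :: (real^'n) set))"
      by (intro Ckl[OF p o] Ck_on_bounded_linear[OF bounded_linear_snd o])
  qed
  then have "Ck_on (Suc r) (\<lambda>q. homogeneous_form d (K c (fst q)) (snd q)) (T \<times> (UNIV :: (real^'n) set))"
    unfolding interp[symmetric] .
  then show ?thesis using T(1-3) by blast
qed

theorem corollary2:
  fixes M :: "'a topology"
    and A :: "('a, 'n::finite) chart set"
    and g :: "('a, 'n) chart \<Rightarrow> real^'n \<Rightarrow> real^'n^'n"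
    and F :: "'a \<times> (('a, 'n) chart \<Rightarrow> real^'n) \<Rightarrow> real"
    and d k :: nat
  assumes "smooth_manifold M A" and "connected_space M" and "CARD('n) \<ge> 2"
    and "is_metric A g" and "k \<ge> 2" and "Ck_metric k A g"
    and "polynomial_in_momenta A d F"
    and "geodesic_flow_integral M A g d F"
  shows "Ck_on_cotangent_bundle (k - 1) A F"
  unfolding Ck_on_cotangent_bundle_def
proof
  fix c assume c: "c \<in> A"
  \<comment> \<open>With \<open>k \<ge> 2\<close> the geodesic equation has coefficients of order
    \<open>Suc r\<close>, hence at least \<open>C^1\<close>, as the contraction and linearization
    arguments require.\<close>
  obtain r where r: "k = Suc (Suc r)" using \<open>k \<ge> 2\<close> by (metis add_2_eq_Suc le_Suc_ex)
  obtain K where K: "momentum_coeffs A d F K"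
    and int: "\<And>J \<gamma>. is_geodesic M A g J \<gamma> \<Longrightarrow> \<exists>const. \<forall>t\<in>J. \<forall>c\<in>A. \<gamma> t \<in> fst c \<longrightarrow>
      homogeneous_form d (lower_indices d (g c (snd c (\<gamma> t))) (K c (snd c (\<gamma> t)))) (velocity c \<gamma> t) = const"
    using assms(8) unfolding geodesic_flow_integral_def by blast
  have ch: "is_chart M c" using assms(1) c by (auto simp: smooth_manifold_def)
  let ?U = "coord_image c"
  have U: "open ?U" using ch unfolding is_chart_def by blast
  have "F (inv_into (cotangent_domain A c) (cotangent_coords c) (x, p)) = homogeneous_form d (K c x) p"
    if x: "x \<in> ?U" for x p
  proof -
    have b: "cotangent_coords c ` cotangent_domain A c = ?U \<times> UNIV"
      using bij_betw_cotangent_coords[OF assms(1) c] by (rule bij_betw_imp_surj_on)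
    define q where "q = inv_into (cotangent_domain A c) (cotangent_coords c) (x, p)"
    have "q \<in> cotangent_domain A c" "cotangent_coords c q = (x, p)"
      unfolding q_def using x b by (auto intro!: inv_into_into f_inv_into_f)
    moreover from this(1) K c have "case q of (a, \<omega>) \<Rightarrow> F (a, \<omega>) = homogeneous_form d (K c (snd c a)) (\<omega> c)"
      unfolding momentum_coeffs_def by blast
    ultimately show ?thesis
      unfolding q_def[symmetric] by (cases q) (auto simp: cotangent_coords_def)
  qed
  then have eq: "homogeneous_form d (K c (fst q)) (snd q) = (F \<circ> inv_into (cotangent_domain A c)
      (cotangent_coords c)) q"
    if "q \<in> ?U \<times> UNIV" for q
    using that by (cases q) auto
  show "Ck_on (k - 1) (F \<circ> inv_into (cotangent_domain A c) (cotangent_coords c)) (?U \<times> UNIV)"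
  \<comment> \<open>In bundle coordinates \<open>F\<close> is its homogeneous form, and
    \<open>C^k\<close> regularity is local, so the neighbourhoods found for single base points
    suffice.\<close>
  proof (rule Ck_on_cong_imp[OF open_Times[OF U open_UNIV] eq Ck_on_local])
    fix q :: "(real^'n) \<times> (real^'n)" assume "q \<in> ?U \<times> UNIV"
    then have "fst q \<in> ?U" by auto
    from integral_locally_Ck[OF assms(1,4) assms(6)[unfolded r] c int this]
    obtain S where "open S" "fst q \<in> S" "Ck_on (Suc r) (\<lambda>q. homogeneous_form d (K c (fst q)) (snd
        q)) (S \<times> (UNIV :: (real^'n) set))"
      by blast
    then show "\<exists>T. open T \<and> q \<in> T \<and> Ck_on (k - 1) (\<lambda>q. homogeneous_form d (K c (fst q)) (snd q)) T"
      by (intro exI[of _ "S \<times> UNIV"]) (auto simp: r open_Times mem_Times_iff simp del: Ck_on.simps)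
  qed
qed

end
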